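(* Let $K$ be a field, let $S_1,\dots,S_n\subseteq \mathrm{S}(K)\setminus\{v_{\mathrm{trivial}}\}$ be nonempty and pairwise disjoint, $t\in K^\times$, $\underline{y}_1,\dots,\underline{y}_n\in K^m$ and $\underline{z}_1,\dots,\underline{z}_n\in(K^\times)^m$. Assume: (U) the exceptional uniformity assumption (defined in the context) holds for $S_1,\dots,S_n$ and $t$; (T) each $S_i$ is compact in the constructible topology; (I) the elements of $S=S_1\cup\dots\cup S_n$ are pairwise independent. Let $D\subseteq K^l$ be $v$-open for all $v\in S$, and let $g:D\to K^m$ be $S_i$-hereditarily continuous for all $i$. Suppose that for each $i$ and each $v\in S_i$ there exists some $\underline{x}_v\in D$ with $g(\underline{x}_v)\in \mathrm{B}_v(\underline{y}_i,\underline{z}_i)$. Then there exists $\underline{x}\in D$ with $$g(\underline{x})\in \mathrm{B}_v(\underline{y}_i,\underline{z}_i)$$ for every $i$ and every $v\in S_i$.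
   Context: Localities. For a field $K$, $\mathrm{S}_{\mathrm{val}}(K)$ is the set of equivalence classes of Krull valuations (written additively), $\mathrm{S}_{\mathrm{ord}}(K)$ the set of orderings, $\mathrm{S}_{\mathrm{abs}}(K)$ the set of equivalence classes of absolute values. $\mathrm{S}(K)$ is their union, with rank-1 valuations and archimedean orderings identified with the associated absolute values (and the trivial absolute value with the trivial valuation $v_{\mathrm{trivial}}$); its elements are called localities. For $v\in\mathrm{S}(K)$: $\mathcal{O}_v=\{v(x)\ge0\}$, $\{-1\le_v x\le_v 1\}$, $\{|x|_v\le 1\}$ and $\mathfrak{m}_v=\{v(x)>0\}$, $\{-1<_v x<_v 1\}$, $\{|x|_v<1\}$, according to whether $v$ is a valuation, ordering, or absolute value. The $v$-topology on $K$ is the field topology with neighbourhood base $\{z\mathfrak{m}_v: z\in K^\times\}$ at $0$; $K^l$ carries the product topology. $\mathrm{B}_v(\underline{y},\underline{z})=\prod_j(y_j+z_j\mathfrak{m}_v)$. Two localities are independent if they induce distinct topologies on $K$. Topologies on $\mathrm{S}(K)$: $\mathcal{T}_{\mathrm{Zar}^*}$ has open subbasis $\{v: x\in\mathfrak{m}_v\}$, $x\in K$; the constructible topology has open subbasis $\{v: x\in\mathcal{O}_v\}$, $\{v: x\in\mathfrak{m}_v\}$, $x\in K$. Compact means quasi-compact. Exceptional uniformity assumption for $S_1,\dots,S_n$ and $t\in K^\times$: there exists $f\in K[X]$ of degree $d\ge2$, with leading coefficient $a_d$, such that for all $v\in S_1\cup\dots\cup S_n$: (i) for any $x\in\mathcal{O}_v$,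 $f(x)\in\mathcal{O}_v$; (iii) for any $x\in K\setminus\mathcal{O}_v$, $f(x)\in x^d(\mathcal{O}_v\setminus t\mathfrak{m}_v)\cap(a_dx^d+x^{d-1}\mathcal{O}_v)$; (iv) $\mathcal{O}_v+\mathcal{O}_v\subseteq t^{-1}\mathcal{O}_v$; and such that for every infinite $S_i$ and all $v\in S_i$: (ii) for any $x\in\mathcal{O}_v$, $f(x)\notin t\mathfrak{m}_v$. $S'$-topology: let $S'$ be a nonempty $\mathcal{T}_{\mathrm{Zar}^*}$-compact subset of some $S_i$ (with $S_1,\dots,S_n,t$ as in the theorem). Put $\mathfrak{m}_{S'}=\bigcap_{v\in S'}\mathfrak{m}_v$. There is a unique field topology on $K$, the $S'$-topology, for which $\{z\mathfrak{m}_{S'}: z\in\mathfrak{m}_{S'}\setminus\{0\}\}$ is a neighbourhood base at $0$; $K^l$ and $K^m$ carry the product topologies. A map $g:D\to K^m$ with $D\subseteq K^l$ is $S'$-continuous if it is continuous for the $S'$-topologies (subspace topology on $D$), and it is $S_i$-hereditarily continuous if it is $S'$-continuous for each nonempty $\mathcal{T}_{\mathrm{Zar}^*}$-compact $S'\subseteq S_i$. *)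

theory Defs
  imports "HOL-Analysis.Analysis" "HOL-Computational_Algebra.Polynomial" "HOL-Algebra.Group"
begin

section \<open>Krull valuations, orderings, absolute values\<close>

text \<open>
  Value groups are written with the multiplicative record syntax of \<^theory>\<open>HOL-Algebra.Group\<close>,
  which is to be read additively; \<open>(a, b) \<in> r\<close> means \<open>a \<le> b\<close>. The value \<open>\<infinity>\<close> is \<^const>\<open>None\<close>.
\<close>

definition ordered_abelian_group :: "'g monoid \<Rightarrow> 'g rel \<Rightarrow> bool" where
  "ordered_abelian_group G r \<longleftrightarrow> comm_group G \<and> linear_order_on (carrier G) r \<and>
     (\<forall>a b c. (a, b) \<in> r \<longrightarrow> c \<in> carrier G \<longrightarrow> (a \<otimes>\<^bsub>G\<^esub> c, b \<otimes>\<^bsub>G\<^esub> c) \<in> r)"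

fun plus_inf :: "'g monoid \<Rightarrow> 'g option \<Rightarrow> 'g option \<Rightarrow> 'g option" where
  "plus_inf G (Some a) (Some b) = Some (a \<otimes>\<^bsub>G\<^esub> b)"
| "plus_inf G _ _ = None"

fun le_inf :: "'g rel \<Rightarrow> 'g option \<Rightarrow> 'g option \<Rightarrow> bool" where
  "le_inf r _ None \<longleftrightarrow> True"
| "le_inf r None (Some b) \<longleftrightarrow> False"
| "le_inf r (Some a) (Some b) \<longleftrightarrow> (a, b) \<in> r"

text \<open>The last conjunct says \<open>min (v x) (v y) \<le> v (x + y)\<close>.\<close>

definition krull_valuation :: "'g monoid \<Rightarrow> 'g rel \<Rightarrow> ('a::field \<Rightarrow> 'g option) \<Rightarrow> bool" where
  "krull_valuation G r v \<longleftrightarrow> ordered_abelian_group G r \<and>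
     range v = insert None (Some ` carrier G) \<and>
     (\<forall>x. v x = None \<longleftrightarrow> x = 0) \<and>
     (\<forall>x y. v (x * y) = plus_inf G (v x) (v y)) \<and>
     (\<forall>x y. le_inf r (v x) (v (x + y)) \<or> le_inf r (v y) (v (x + y)))"

definition valuation_ring :: "'g monoid \<Rightarrow> 'g rel \<Rightarrow> ('a::field \<Rightarrow> 'g option) \<Rightarrow> 'a set" where
  "valuation_ring G r v = {x. le_inf r (Some \<one>\<^bsub>G\<^esub>) (v x)}"

definition valuation_ideal :: "'g monoid \<Rightarrow> 'g rel \<Rightarrow> ('a::field \<Rightarrow> 'g option) \<Rightarrow> 'a set" where
  "valuation_ideal G r v = {x. le_inf r (Some \<one>\<^bsub>G\<^esub>) (v x) \<and> v x \<noteq> Some \<one>\<^bsub>G\<^esub>}"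

definition field_ordering :: "'a::field rel \<Rightarrow> bool" where
  "field_ordering r \<longleftrightarrow> linear_order_on UNIV r \<and>
     (\<forall>x y z. (x, y) \<in> r \<longrightarrow> (x + z, y + z) \<in> r) \<and>
     (\<forall>x y. (0, x) \<in> r \<longrightarrow> (0, y) \<in> r \<longrightarrow> (0, x * y) \<in> r)"

definition absolute_value :: "('a::field \<Rightarrow> real) \<Rightarrow> bool" where
  "absolute_value a \<longleftrightarrow> (\<forall>x. 0 \<le> a x) \<and> (\<forall>x. a x = 0 \<longleftrightarrow> x = 0) \<and>
     (\<forall>x y. a (x * y) = a x * a y) \<and> (\<forall>x y. a (x + y) \<le> a x + a y)"


section \<open>Localities\<close>

text \<open>
  The value group of a Krull valuation on \<open>'a\<close> is isomorphic to a group of cosets in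
  the multiplicative group of \<open>'a\<close>, so allowing value groups with carrier in
  \<^typ>\<open>'a set\<close> yields all equivalence classes; see lemma \<open>krull_valuation_transfer\<close> below.
\<close>

datatype 'a prelocality =
    Valuation "'a set monoid" "'a set rel" "'a \<Rightarrow> 'a set option"
  | Ordering "'a rel"
  | Absolute_Value "'a \<Rightarrow> real"

fun wf_prelocality :: "'a::field prelocality \<Rightarrow> bool" where
  "wf_prelocality (Valuation G r v) \<longleftrightarrow> krull_valuation G r v"
| "wf_prelocality (Ordering r) \<longleftrightarrow> field_ordering r"
| "wf_prelocality (Absolute_Value a) \<longleftrightarrow> absolute_value a"

text \<open>
  The first two clauses are equivalence of valuations and of absolute values.
  The value groups of the valuations of rank at most 1 are those with an order embedding \<open>\<phi>\<close>
  into \<open>(\<real>, +)\<close>; the associated absolute value is \<open>exp (- \<phi> (v x))\<close>.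
  Here \<open>\<phi> = 0\<close> identifies the trivial valuation with the trivial absolute value.
  The archimedean orderings are those given by an embedding \<open>\<sigma>\<close> of the field into \<open>\<real>\<close>.
\<close>

inductive identified :: "'a::field prelocality \<Rightarrow> 'a prelocality \<Rightarrow> bool" where
  equivalent_valuations:
    "\<lbrakk>krull_valuation G r v; krull_valuation H s w; valuation_ring G r v = valuation_ring H s w\<rbrakk>
     \<Longrightarrow> identified (Valuation G r v) (Valuation H s w)"
| equivalent_absolute_values:
    "\<lbrakk>absolute_value a; absolute_value b; s > 0; \<forall>x. b x = a x powr s\<rbrakk>
     \<Longrightarrow> identified (Absolute_Value a) (Absolute_Value b)"
| rank_one:
    "\<lbrakk>krull_valuation G r v; absolute_value a;
      \<forall>g\<in>carrier G. \<forall>h\<in>carrier G. \<phi> (g \<otimes>\<^bsub>G\<^esub> h) = \<phi> g + \<phi> h;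
      \<forall>g\<in>carrier G. \<forall>h\<in>carrier G. (g, h) \<in> r \<longleftrightarrow> \<phi> g \<le> (\<phi> h :: real);
      \<forall>x g. v x = Some g \<longrightarrow> a x = exp (- \<phi> g)\<rbrakk>
     \<Longrightarrow> identified (Valuation G r v) (Absolute_Value a)"
| archimedean:
    "\<lbrakk>field_ordering r; absolute_value a;
      \<forall>x y. \<sigma> (x + y) = \<sigma> x + \<sigma> y; \<forall>x y. \<sigma> (x * y) = \<sigma> x * \<sigma> y;
      \<forall>x y. (x, y) \<in> r \<longleftrightarrow> \<sigma> x \<le> (\<sigma> y :: real);
      \<forall>x. a x = \<bar>\<sigma> x\<bar>\<rbrakk>
     \<Longrightarrow> identified (Ordering r) (Absolute_Value a)"

definition locality_rel :: "'a::field prelocality \<Rightarrow> 'a prelocality \<Rightarrow> bool" where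
  "locality_rel p q \<longleftrightarrow> wf_prelocality p \<and> wf_prelocality q \<and> equivclp identified p q"

definition trivial_absolute_value :: "'a::field \<Rightarrow> real" where
  "trivial_absolute_value x = (if x = 0 then 0 else 1)"

lemma absolute_value_trivial: "absolute_value trivial_absolute_value"
  by (auto simp: absolute_value_def trivial_absolute_value_def)

lemma part_equivp_locality_rel: "part_equivp (locality_rel :: 'a::field prelocality \<Rightarrow> _)"
proof (rule part_equivpI)
  show "\<exists>p :: 'a prelocality. locality_rel p p"
    by (rule exI[of _ "Absolute_Value trivial_absolute_value"])
      (simp add: locality_rel_def absolute_value_trivial)
  show "symp (locality_rel :: 'a prelocality \<Rightarrow> _)"
    by (auto simp: locality_rel_def symp_def intro: equivclp_sym)
  show "transp (locality_rel :: 'a prelocality \<Rightarrow> _)"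
    by (auto simp: locality_rel_def transp_def intro: equivclp_trans)
qed

text \<open>The type of all localities of the field \<open>'a\<close>.\<close>

quotient_type (overloaded) 'a locality = "'a::field prelocality" / partial: locality_rel
  by (rule part_equivp_locality_rel)

fun pre_O :: "'a::field prelocality \<Rightarrow> 'a set" where
  "pre_O (Valuation G r v) = valuation_ring G r v"
| "pre_O (Ordering r) = {x. (- 1, x) \<in> r \<and> (x, 1) \<in> r}"
| "pre_O (Absolute_Value a) = {x. a x \<le> 1}"

fun pre_m :: "'a::field prelocality \<Rightarrow> 'a set" where
  "pre_m (Valuation G r v) = valuation_ideal G r v"
| "pre_m (Ordering r) = {x. (- 1, x) \<in> r \<and> x \<noteq> - 1 \<and> (x, 1) \<in> r \<and> x \<noteq> 1}"
| "pre_m (Absolute_Value a) = {x. a x < 1}"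

lemma krull_valuation_one:
  assumes "krull_valuation G r v"
  shows "v 1 = Some \<one>\<^bsub>G\<^esub>"
proof -
  interpret comm_group G
    using assms by (simp add: krull_valuation_def ordered_abelian_group_def)
  have "v 1 \<noteq> None"
    using assms by (simp add: krull_valuation_def)
  then obtain g where g: "v 1 = Some g" by blast
  have "Some g \<in> range v" using g by (metis rangeI)
  then have gc: "g \<in> carrier G"
    using assms by (auto simp: krull_valuation_def)
  have "v (1 * 1) = plus_inf G (v 1) (v 1)"
    using assms unfolding krull_valuation_def by blast
  then have "g \<otimes>\<^bsub>G\<^esub> g = g" using g by simp
  then show ?thesis using g gc by (simp add: r_cancel_one)
qed

lemma krull_valuation_SomeE:
  assumes "krull_valuation G r v" "x \<noteq> 0"
  obtains g where "v x = Some g" "g \<in> carrier G"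
proof -
  obtain g where g: "v x = Some g"
    using assms by (auto simp: krull_valuation_def)
  moreover have "Some g \<in> range v" using g by (metis rangeI)
  then have "g \<in> carrier G"
    using assms by (auto simp: krull_valuation_def)
  ultimately show ?thesis using that by blast
qed

lemma ordered_abelian_groupD:
  assumes "ordered_abelian_group G r"
  shows "\<And>a. a \<in> carrier G \<Longrightarrow> (a, a) \<in> r"
    and "\<And>a b. (a, b) \<in> r \<Longrightarrow> (b, a) \<in> r \<Longrightarrow> a = b"
    and "\<And>a b c. (a, b) \<in> r \<Longrightarrow> (b, c) \<in> r \<Longrightarrow> (a, c) \<in> r"
    and "\<And>a b. a \<in> carrier G \<Longrightarrow> b \<in> carrier G \<Longrightarrow> (a, b) \<in> r \<or> (b, a) \<in> r"
    and "\<And>a b c. (a, b) \<in> r \<Longrightarrow> c \<in> carrier G \<Longrightarrow> (a \<otimes>\<^bsub>G\<^esub> c, b \<otimes>\<^bsub>G\<^esub> c) \<in> r"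
proof -
  have r: "refl_on (carrier G) r" "antisym r" "trans r" "total_on (carrier G) r"
    using assms by (simp_all add: ordered_abelian_group_def order_on_defs)
  show rf: "(a, a) \<in> r" if "a \<in> carrier G" for a
    using r(1) that by (rule refl_onD)
  show "a = b" if "(a, b) \<in> r" "(b, a) \<in> r" for a b
    using r(2) that by (rule antisymD)
  show "(a, c) \<in> r" if "(a, b) \<in> r" "(b, c) \<in> r" for a b c
    using r(3) that by (rule transD)
  show "(a, b) \<in> r \<or> (b, a) \<in> r" if "a \<in> carrier G" "b \<in> carrier G" for a b
    using r(4) rf that by (cases "a = b") (auto simp: total_on_def)
  show "(a \<otimes>\<^bsub>G\<^esub> c, b \<otimes>\<^bsub>G\<^esub> c) \<in> r" if "(a, b) \<in> r" "c \<in> carrier G" for a b c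
    using assms that by (simp add: ordered_abelian_group_def)
qed

lemma valuation_inverse:
  assumes K: "krull_valuation G r v" and x: "x \<noteq> 0"
  shows "inverse x \<in> valuation_ring G r v \<longleftrightarrow> x \<notin> valuation_ideal G r v"
proof -
  interpret comm_group G
    using K by (simp add: krull_valuation_def ordered_abelian_group_def)
  have o: "ordered_abelian_group G r" using K by (simp add: krull_valuation_def)
  note D = ordered_abelian_groupD[OF o]
  obtain g where g: "v x = Some g" "g \<in> carrier G" by (rule krull_valuation_SomeE[OF K x])
  obtain h where h: "v (inverse x) = Some h" "h \<in> carrier G"
    using krull_valuation_SomeE[OF K, of "inverse x"] x by auto
  have "v (x * inverse x) = plus_inf G (v x) (v (inverse x))"
    using K unfolding krull_valuation_def by blast
  then have gh: "g \<otimes>\<^bsub>G\<^esub> h = \<one>\<^bsub>G\<^esub>"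
    using x g h krull_valuation_one[OF K] by simp
  have "(\<one>\<^bsub>G\<^esub>, h) \<in> r \<longleftrightarrow> (g, \<one>\<^bsub>G\<^esub>) \<in> r"
  proof
    assume "(\<one>\<^bsub>G\<^esub>, h) \<in> r"
    from D(5)[OF this g(2)] show "(g, \<one>\<^bsub>G\<^esub>) \<in> r" using g h gh by (simp add: m_comm)
  next
    assume "(g, \<one>\<^bsub>G\<^esub>) \<in> r"
    from D(5)[OF this h(2)] show "(\<one>\<^bsub>G\<^esub>, h) \<in> r" using h gh by simp
  qed
  moreover have "(g, \<one>\<^bsub>G\<^esub>) \<in> r \<longleftrightarrow> \<not> ((\<one>\<^bsub>G\<^esub>, g) \<in> r \<and> g \<noteq> \<one>\<^bsub>G\<^esub>)"
    using D(1,2,4) g(2) one_closed by metis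
  ultimately show ?thesis
    using g h by (simp add: valuation_ring_def valuation_ideal_def)
qed

lemma valuation_ideal_alt:
  assumes K: "krull_valuation G r v"
  shows "valuation_ideal G r v = {x. x = 0 \<or> inverse x \<notin> valuation_ring G r v}"
proof -
  have "v 0 = None" using K by (simp add: krull_valuation_def)
  then have 0: "0 \<in> valuation_ideal G r v" by (simp add: valuation_ideal_def)
  have "x \<in> valuation_ideal G r v \<longleftrightarrow> x = 0 \<or> inverse x \<notin> valuation_ring G r v" for x
    using 0 valuation_inverse[OF K, of x] by (cases "x = 0") simp_all
  then show ?thesis by (simp add: set_eq_iff)
qed

lemma identified_pre_O_pre_m:
  assumes "identified p q"
  shows "pre_O p = pre_O q \<and> pre_m p = pre_m q"
  using assms
proof cases
  case equivalent_valuations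
  then show ?thesis by (simp add: valuation_ideal_alt)
next
  case (equivalent_absolute_values a b s)
  have nn: "0 \<le> a x" for x
    using equivalent_absolute_values by (simp add: absolute_value_def)
  have "(a x powr s \<le> 1 \<longleftrightarrow> a x \<le> 1) \<and> (a x powr s < 1 \<longleftrightarrow> a x < 1)" for x
  proof (cases "a x" "1 :: real" rule: linorder_cases)
    case less
    then show ?thesis using powr_less_mono2[of s "a x" 1] \<open>s > 0\<close> nn[of x] by simp
  next
    case equal
    then show ?thesis by simp
  next
    case greater
    then have "1 powr s < a x powr s"
      by (intro powr_less_mono2 \<open>s > 0\<close>) simp_all
    then show ?thesis using greater by simp
  qed
  then show ?thesis using equivalent_absolute_values by simp
next
  case (rank_one G r v a \<phi>)
  note K = rank_one(3) and a = rank_one(4) and hom = rank_one(5)[rule_format]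
    and mono = rank_one(6)[rule_format] and av = rank_one(7)[rule_format]
  interpret comm_group G
    using K by (simp add: krull_valuation_def ordered_abelian_group_def)
  have o: "ordered_abelian_group G r" using K by (simp add: krull_valuation_def)
  have "\<phi> (\<one>\<^bsub>G\<^esub> \<otimes>\<^bsub>G\<^esub> \<one>\<^bsub>G\<^esub>) = \<phi> \<one>\<^bsub>G\<^esub> + \<phi> \<one>\<^bsub>G\<^esub>"
    by (rule hom) simp_all
  then have p1: "\<phi> \<one>\<^bsub>G\<^esub> = 0" by simp
  have "(le_inf r (Some \<one>\<^bsub>G\<^esub>) (v x) \<longleftrightarrow> a x \<le> 1) \<and>
        ((le_inf r (Some \<one>\<^bsub>G\<^esub>) (v x) \<and> v x \<noteq> Some \<one>\<^bsub>G\<^esub>) \<longleftrightarrow> a x < 1)" for x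
  proof (cases "x = 0")
    case True
    then have "v x = None" "a x = 0"
      using K a by (simp_all add: krull_valuation_def absolute_value_def)
    then show ?thesis by simp
  next
    case False
    then obtain g where g: "v x = Some g" "g \<in> carrier G"
      using krull_valuation_SomeE[OF K] by blast
    have ax: "a x = exp (- \<phi> g)" using av g by blast
    have 1: "(\<one>\<^bsub>G\<^esub>, g) \<in> r \<longleftrightarrow> 0 \<le> \<phi> g" "(g, \<one>\<^bsub>G\<^esub>) \<in> r \<longleftrightarrow> \<phi> g \<le> 0"
      using mono[of "\<one>\<^bsub>G\<^esub>" g] mono[of g "\<one>\<^bsub>G\<^esub>"] g(2) p1 by simp_all
    have "g = \<one>\<^bsub>G\<^esub> \<longleftrightarrow> \<phi> g = 0"
      using 1 p1 ordered_abelian_groupD(2)[OF o, of g "\<one>\<^bsub>G\<^esub>"] by force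
    then show ?thesis using ax 1 by (auto simp: g(1))
  qed
  then show ?thesis
    unfolding rank_one(1,2) pre_O.simps pre_m.simps valuation_ring_def valuation_ideal_def
    by (intro conjI Collect_cong) blast+
next
  case (archimedean r a \<sigma>)
  have an: "antisym r" using archimedean(3) by (simp add: field_ordering_def order_on_defs)
  have inj: "\<sigma> x = \<sigma> y \<longleftrightarrow> x = y" for x y
    using archimedean(7)[rule_format, of x y] archimedean(7)[rule_format, of y x]
      antisymD[OF an, of x y] by force
  have s0: "\<sigma> 0 = 0" using archimedean(5)[rule_format, of 0 0] by simp
  have "\<sigma> 1 * \<sigma> 1 = \<sigma> 1" using archimedean(6)[rule_format, of 1 1] by simp
  moreover have "\<sigma> 1 \<noteq> 0" using inj[of 1 0] s0 by simp
  ultimately have s1: "\<sigma> 1 = 1" by simp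
  have "\<sigma> (- 1) + \<sigma> 1 = \<sigma> 0" using archimedean(5)[rule_format, of "- 1" 1] by simp
  then have sm: "\<sigma> (- 1) = - 1" using s0 s1 by simp
  have O: "(- 1, x) \<in> r \<longleftrightarrow> - 1 \<le> \<sigma> x" "(x, 1) \<in> r \<longleftrightarrow> \<sigma> x \<le> 1" for x
    using archimedean(7)[rule_format, of "- 1" x] archimedean(7)[rule_format, of x 1] s1 sm
    by simp_all
  have E: "x = 1 \<longleftrightarrow> \<sigma> x = 1" "x = - 1 \<longleftrightarrow> \<sigma> x = - 1" for x
    using inj[of x 1] inj[of x "- 1"] s1 sm by simp_all
  have A: "a x = \<bar>\<sigma> x\<bar>" for x using archimedean(8) by blast
  have "(- 1, x) \<in> r \<and> (x, 1) \<in> r \<longleftrightarrow> a x \<le> 1" for x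
    unfolding O A by linarith
  moreover have "(- 1, x) \<in> r \<and> x \<noteq> - 1 \<and> (x, 1) \<in> r \<and> x \<noteq> 1 \<longleftrightarrow> a x < 1" for x
    unfolding O A using E[of x] by linarith
  ultimately show ?thesis
    unfolding archimedean(1,2) pre_O.simps pre_m.simps by (intro conjI Collect_cong)
qed

lemma equivclp_pre_O_pre_m:
  assumes "equivclp identified p q"
  shows "pre_O p = pre_O q \<and> pre_m p = pre_m q"
  using assms
proof (induction rule: equivclp_induct)
  case base
  show ?case by simp
next
  case (step y z)
  then show ?case using identified_pre_O_pre_m[of y z] identified_pre_O_pre_m[of z y] by metis
qed

lemma locality_rel_pre_O: "locality_rel p q \<Longrightarrow> pre_O p = pre_O q"
  and locality_rel_pre_m: "locality_rel p q \<Longrightarrow> pre_m p = pre_m q"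
  unfolding locality_rel_def using equivclp_pre_O_pre_m[of p q] by simp_all

lift_definition \<O> :: "'a::field locality \<Rightarrow> 'a set" is pre_O
  by (rule locality_rel_pre_O)

lift_definition \<mm> :: "'a::field locality \<Rightarrow> 'a set" is pre_m
  by (rule locality_rel_pre_m)

lemma locality_obtain:
  obtains p where "wf_prelocality p" "\<O> v = pre_O p" "\<mm> v = pre_m p"
proof -
  have "locality_rel (rep_locality v) (rep_locality v)"
    using Quotient3_locality by (rule Quotient3_rep_reflp)
  then show ?thesis
    by (intro that[of "rep_locality v"]) (simp_all add: locality_rel_def \<O>.rep_eq \<mm>.rep_eq)
qed

lemma field_orderingD:
  assumes "field_ordering r"
  shows "(x, x) \<in> r"
    and "(x, y) \<in> r \<Longrightarrow> (y, x) \<in> r \<Longrightarrow> x = y"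
    and "(x, y) \<in> r \<Longrightarrow> (y, z) \<in> r \<Longrightarrow> (x, z) \<in> r"
    and "(x, y) \<in> r \<or> (y, x) \<in> r"
    and "(x, y) \<in> r \<longleftrightarrow> (0, y - x) \<in> r"
    and "(0, x) \<in> r \<Longrightarrow> (0, y) \<in> r \<Longrightarrow> (0, x * y) \<in> r"
    and "(0, x) \<in> r \<Longrightarrow> (0, y) \<in> r \<Longrightarrow> (0, x + y) \<in> r"
    and "(0, x) \<in> r \<or> (0, - x) \<in> r"
    and "(0, x) \<in> r \<Longrightarrow> (0, - x) \<in> r \<Longrightarrow> x = 0"
proof -
  have l: "refl r" "antisym r" "trans r" "total r"
    and tl: "\<And>x y z. (x, y) \<in> r \<Longrightarrow> (x + z, y + z) \<in> r"
    and mult: "\<And>x y. (0, x) \<in> r \<Longrightarrow> (0, y) \<in> r \<Longrightarrow> (0, x * y) \<in> r"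
    using assms by (simp_all add: field_ordering_def order_on_defs)
  show rf: "(x, x) \<in> r" for x
    using l(1) by (rule reflD)
  show as: "(x, y) \<in> r \<Longrightarrow> (y, x) \<in> r \<Longrightarrow> x = y" for x y
    using l(2) by (rule antisymD)
  show tr: "(x, y) \<in> r \<Longrightarrow> (y, z) \<in> r \<Longrightarrow> (x, z) \<in> r" for x y z
    using l(3) by (rule transD)
  show tot: "(x, y) \<in> r \<or> (y, x) \<in> r" for x y
    using l(4) rf by (cases "x = y") (auto simp: total_on_def)
  show d: "(x, y) \<in> r \<longleftrightarrow> (0, y - x) \<in> r" for x y
    using tl[of x y "- x"] tl[of 0 "y - x" x] by auto
  show "(0, x) \<in> r \<Longrightarrow> (0, y) \<in> r \<Longrightarrow> (0, x * y) \<in> r"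
    by (rule mult)
  show "(0, x) \<in> r \<Longrightarrow> (0, y) \<in> r \<Longrightarrow> (0, x + y) \<in> r"
    using tl[of 0 x y] tr[of 0 y "x + y"] by simp
  have neg: "(x, 0) \<in> r \<longleftrightarrow> (0, - x) \<in> r" using d[of x 0] by simp
  show "(0, x) \<in> r \<or> (0, - x) \<in> r" using tot[of 0 x] neg by blast
  show "(0, x) \<in> r \<Longrightarrow> (0, - x) \<in> r \<Longrightarrow> x = 0" using as[of 0 x] neg by blast
qed

lemma ordering_mult_unit_interval:
  assumes r: "field_ordering r"
    and x: "(- 1, x) \<in> r" "(x, 1) \<in> r" and y: "(- 1, y) \<in> r" "y \<noteq> - 1" "(y, 1) \<in> r" "y \<noteq> 1"
  shows "(x * y, 1) \<in> r \<and> x * y \<noteq> 1"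
proof (rule ccontr)
  note D = field_orderingD[OF r]
  define A B where "A = (1 - x) * (1 + y)" and "B = (1 + x) * (1 - y)"
  have "(0, 1 - x) \<in> r" "(0, 1 + x) \<in> r" "(0, 1 - y) \<in> r" "(0, 1 + y) \<in> r"
    using x y D(5)[of x 1] D(5)[of "- 1" x] D(5)[of y 1] D(5)[of "- 1" y]
    by (simp_all add: add.commute)
  then have AB: "(0, A) \<in> r" "(0, B) \<in> r" unfolding A_def B_def by (auto intro: D(6))
  assume "\<not> ?thesis"
  then have "(1, x * y) \<in> r" using D(1,4) by metis
  then have p: "(0, x * y - 1) \<in> r" using D(5) by blast
  have e: "A + B = - ((x * y - 1) + (x * y - 1))" by (simp add: A_def B_def algebra_simps)
  have "(0, - (A + B)) \<in> r" unfolding e using D(7)[OF p p] by simp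
  moreover have "(0, A + B) \<in> r" using AB by (rule D(7))
  ultimately have "A + B = 0" using D(9) by blast
  then have "- A = B" by (simp add: add_eq_0_iff)
  then have "A = 0" "B = 0" using D(9)[OF AB(1)] AB(2) by auto
  moreover have "1 + y \<noteq> 0" using y(2) by (metis add_eq_0_iff)
  moreover have "1 - y \<noteq> 0" using y(4) by simp
  ultimately have "1 - x = 0" "1 + x = 0" unfolding A_def B_def by simp_all
  then have "(1 :: 'a) = - 1" by (metis eq_iff_diff_eq_0 add_eq_0_iff)
  then have "(1, y) \<in> r" using y(1) by metis
  then show False using D(2)[OF y(3)] y(4) by blast
qed

lemma wf_prelocality_unit_balls:
  assumes "wf_prelocality p"
  shows "pre_m p \<subseteq> pre_O p"
    and "x \<notin> pre_O p \<Longrightarrow> inverse x \<in> pre_m p"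
    and "x \<in> pre_O p \<Longrightarrow> y \<in> pre_m p \<Longrightarrow> x * y \<in> pre_m p"
proof -
  have "pre_m p \<subseteq> pre_O p \<and> (x \<notin> pre_O p \<longrightarrow> inverse x \<in> pre_m p) \<and>
    (x \<in> pre_O p \<longrightarrow> y \<in> pre_m p \<longrightarrow> x * y \<in> pre_m p)"
  proof (cases p)
    case (Valuation G r v)
    have K: "krull_valuation G r v" using assms Valuation by simp
    interpret comm_group G
      using K by (simp add: krull_valuation_def ordered_abelian_group_def)
    have o: "ordered_abelian_group G r" using K by (simp add: krull_valuation_def)
    note D = ordered_abelian_groupD[OF o]
    have "v 0 = None" using K by (simp add: krull_valuation_def)
    then have z: "0 \<in> valuation_ring G r v" "0 \<in> valuation_ideal G r v"
      by (simp_all add: valuation_ring_def valuation_ideal_def)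
    have "inverse x \<in> valuation_ideal G r v" if "x \<notin> valuation_ring G r v"
    proof -
      have "x \<noteq> 0" using z that by metis
      then show ?thesis using valuation_inverse[OF K, of "inverse x"] that by simp
    qed
    moreover have "x * y \<in> valuation_ideal G r v"
      if xy: "x \<in> valuation_ring G r v" "y \<in> valuation_ideal G r v"
    proof (cases "x = 0 \<or> y = 0")
      case True
      then show ?thesis using z by auto
    next
      case False
      obtain g where g: "v x = Some g" "g \<in> carrier G" using krull_valuation_SomeE[OF K] False by metis
      obtain h where h: "v y = Some h" "h \<in> carrier G" using krull_valuation_SomeE[OF K] False by metis
      have "v (x * y) = plus_inf G (v x) (v y)" using K unfolding krull_valuation_def by blast
      then have vxy: "v (x * y) = Some (g \<otimes>\<^bsub>G\<^esub> h)" using g h by simp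
      have 1: "(\<one>\<^bsub>G\<^esub>, g) \<in> r" "(\<one>\<^bsub>G\<^esub>, h) \<in> r" "h \<noteq> \<one>\<^bsub>G\<^esub>"
        using xy g h by (simp_all add: valuation_ring_def valuation_ideal_def)
      have hg: "(h, g \<otimes>\<^bsub>G\<^esub> h) \<in> r" using D(5)[OF 1(1) h(2)] h(2) by simp
      then have "(\<one>\<^bsub>G\<^esub>, g \<otimes>\<^bsub>G\<^esub> h) \<in> r" using D(3) 1(2) by blast
      moreover have "g \<otimes>\<^bsub>G\<^esub> h \<noteq> \<one>\<^bsub>G\<^esub>" using hg 1 D(2) by metis
      ultimately show ?thesis by (simp add: valuation_ideal_def vxy)
    qed
    moreover have "valuation_ideal G r v \<subseteq> valuation_ring G r v"
      by (auto simp: valuation_ring_def valuation_ideal_def)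
    ultimately show ?thesis by (simp add: Valuation)
  next
    case (Ordering r)
    have r: "field_ordering r" using assms Ordering by simp
    note D = field_orderingD[OF r]
    have neg: "(x, y) \<in> r \<longleftrightarrow> (- y, - x) \<in> r" for x y
      using D(5)[of x y] D(5)[of "- y" "- x"] by simp
    have m: "x * y \<in> pre_m p" if "x \<in> pre_O p" "y \<in> pre_m p" for x y
    proof -
      have *: "(- 1, x) \<in> r" "(x, 1) \<in> r" "(- 1, y) \<in> r" "y \<noteq> - 1" "(y, 1) \<in> r" "y \<noteq> 1"
        using that by (simp_all add: Ordering)
      have "(- 1, - x) \<in> r" "(- x, 1) \<in> r" using * neg[of x 1] neg[of "- 1" x] by simp_all
      then have "(- x * y, 1) \<in> r \<and> - x * y \<noteq> 1"
        using ordering_mult_unit_interval[OF r _ _ *(3-6)] by blast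
      moreover have "(x * y, 1) \<in> r \<and> x * y \<noteq> 1"
        using ordering_mult_unit_interval[OF r *] .
      ultimately show ?thesis using neg[of "- 1" "x * y"] by (auto simp: Ordering)
    qed
    have i: "inverse x \<in> pre_m p" if "x \<notin> pre_O p"
    proof (rule ccontr)
      assume n: "inverse x \<notin> pre_m p"
      have o: "(0, 1 :: 'a) \<in> r" using D(8)[of 1] D(6)[of "- 1" "- 1"] by auto
      have "x \<noteq> 0" using that o neg[of 0 1] by (auto simp: Ordering)
      have sq: "z \<noteq> 0 \<Longrightarrow> (0, z) \<in> r \<Longrightarrow> (0, inverse z) \<in> r" for z
        using D(6)[of z "inverse z * inverse z"] D(6)[of "inverse z" "inverse z"]
          D(6)[of "- inverse z" "- inverse z"] D(8)[of "inverse z"]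
        by (auto simp flip: mult.assoc)
      have key: "inverse z \<in> pre_m p" if z: "(1, z) \<in> r" "z \<noteq> 1" for z
      proof -
        have z0: "(0, z) \<in> r" using D(3) o z by blast
        then have zn: "z \<noteq> 0" using D(2) o z by metis
        have iz: "(0, inverse z) \<in> r" using sq zn z0 by blast
        have "(0, (z - 1) * inverse z) \<in> r" using D(5)[of 1 z] z iz D(6) by blast
        moreover have "(z - 1) * inverse z = 1 - inverse z" using zn by (simp add: algebra_simps)
        ultimately have 1: "(inverse z, 1) \<in> r" using D(5) by metis
        have m1: "(- 1, 0) \<in> r" using o neg[of 0 1] by simp
        then have 2: "(- 1, inverse z) \<in> r" using D(3) iz by blast
        have 3: "inverse z \<noteq> 1" using z(2) by simp
        have 4: "inverse z \<noteq> - 1"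
        proof
          assume "inverse z = - 1"
          then have "(0, - 1 :: 'a) \<in> r" using iz by simp
          then show False using D(9)[of "1 :: 'a"] o by simp
        qed
        show ?thesis using 1 2 3 4 by (simp add: Ordering)
      qed
      have "\<not> (- 1, x) \<in> r \<or> \<not> (x, 1) \<in> r" using that by (simp add: Ordering)
      then show False
      proof
        assume "\<not> (x, 1) \<in> r"
        then have "(1, x) \<in> r" "x \<noteq> 1" using D(1,4) by metis+
        then show False using key n by blast
      next
        assume a: "\<not> (- 1, x) \<in> r"
        then have x1: "(x, - 1) \<in> r" "x \<noteq> - 1" using D(1,4) by metis+
        have "(1, - x) \<in> r" using x1(1) neg[of x "- 1"] by simp
        moreover have "- x \<noteq> 1" using x1(2) by (metis minus_minus)
        ultimately have "inverse (- x) \<in> pre_m p" by (rule key)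
        then have "- inverse x \<in> pre_m p" by simp
        then have "inverse x \<in> pre_m p"
          using neg[of "- 1" "inverse x"] neg[of "inverse x" 1] by (auto simp: Ordering)
        then show False using n by blast
      qed
    qed
    have "pre_m p \<subseteq> pre_O p" by (auto simp: Ordering)
    then show ?thesis using m i by blast
  next
    case (Absolute_Value a)
    have a: "0 \<le> a x" "a x = 0 \<longleftrightarrow> x = 0" "a (x * y) = a x * a y" for x y
      using assms by (simp_all add: Absolute_Value absolute_value_def)
    have "a 1 * a 1 = a 1" using a(3)[of 1 1] by simp
    then have a1: "a 1 = 1" using a(2)[of 1] by simp
    have "a (inverse x) < 1" if "\<not> a x \<le> 1"
    proof -
      have "x \<noteq> 0" using that a(2)[of x] by auto
      then have "a x * a (inverse x) = 1" using a(3)[of x "inverse x"] a1 by simp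
      then have "a (inverse x) = 1 / a x" using that by (simp add: field_simps)
      then show ?thesis using that by simp
    qed
    moreover have "a (x * y) < 1" if "a x \<le> 1" "a y < 1"
      using mult_right_mono[of "a x" 1 "a y"] that a(1)[of y] unfolding a(3) by simp
    ultimately show ?thesis by (auto simp: Absolute_Value)
  qed
  then show "pre_m p \<subseteq> pre_O p" "x \<notin> pre_O p \<Longrightarrow> inverse x \<in> pre_m p"
    "x \<in> pre_O p \<Longrightarrow> y \<in> pre_m p \<Longrightarrow> x * y \<in> pre_m p" by blast+
qed

lemma \<mm>_subset_\<O>: "\<mm> v \<subseteq> \<O> v"
  by (metis locality_obtain wf_prelocality_unit_balls(1))

lemma inverse_in_\<mm>: "x \<notin> \<O> v \<Longrightarrow> inverse x \<in> \<mm> v"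
  by (metis locality_obtain wf_prelocality_unit_balls(2))

lemma \<O>_mult_\<mm>: "x \<in> \<O> v \<Longrightarrow> y \<in> \<mm> v \<Longrightarrow> x * y \<in> \<mm> v"
  by (metis locality_obtain wf_prelocality_unit_balls(3))

text \<open>The trivial valuation is identified with the trivial absolute value.\<close>

lift_definition v_trivial :: "'a::field locality" is "Absolute_Value trivial_absolute_value"
  by (simp add: locality_rel_def absolute_value_trivial)

lemma krull_valuation_transfer:
  fixes G :: "'g monoid" and v :: "'a::field \<Rightarrow> 'g option"
  assumes K: "krull_valuation G r v"
  obtains H :: "'a set monoid" and s and w :: "'a \<Rightarrow> 'a set option"
  where "krull_valuation H s w" "valuation_ring H s w = valuation_ring G r v"
proof -
  interpret comm_group G
    using K by (simp add: krull_valuation_def ordered_abelian_group_def)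
  have o: "ordered_abelian_group G r" using K by (simp add: krull_valuation_def)
  note D = ordered_abelian_groupD[OF o]
  have rc: "a \<in> carrier G \<and> b \<in> carrier G" if "(a, b) \<in> r" for a b
    using o that by (auto simp: ordered_abelian_group_def order_on_defs)
  define f where "f = (\<lambda>g. {y. v y = Some g})"
  have ex: "\<exists>y. v y = Some g" if "g \<in> carrier G" for g
  proof -
    have "Some g \<in> range v" using K that by (simp add: krull_valuation_def)
    then show ?thesis by (metis rangeE)
  qed
  have inj: "inj_on f (carrier G)"
  proof (rule inj_onI)
    fix g h assume g: "g \<in> carrier G" and "f g = f h"
    then have eq: "v y = Some g \<longleftrightarrow> v y = Some h" for y
      unfolding f_def by (metis mem_Collect_eq)
    obtain y where "v y = Some g" using ex[OF g] by blast
    then show "g = h" using eq[of y] by simp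
  qed
  define k where "k = inv_into (carrier G) f"
  have kf: "k (f g) = g" if "g \<in> carrier G" for g
    using inv_into_f_f[OF inj that] by (simp add: k_def)
  define H where "H = \<lparr>carrier = f ` carrier G, mult = (\<lambda>A B. f (k A \<otimes>\<^bsub>G\<^esub> k B)), one = f \<one>\<^bsub>G\<^esub>\<rparr>"
  define s where "s = {(f a, f b) | a b. (a, b) \<in> r}"
  define w where "w = (\<lambda>x. map_option f (v x))"
  have Hc: "carrier H = f ` carrier G" and H1: "\<one>\<^bsub>H\<^esub> = f \<one>\<^bsub>G\<^esub>"
    by (simp_all add: H_def)
  have Hm: "f g \<otimes>\<^bsub>H\<^esub> f h = f (g \<otimes>\<^bsub>G\<^esub> h)" if "g \<in> carrier G" "h \<in> carrier G" for g h
    using that by (simp add: H_def kf)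
  have s_iff: "(f a, f b) \<in> s \<longleftrightarrow> (a, b) \<in> r" if "a \<in> carrier G" "b \<in> carrier G" for a b
  proof
    assume "(f a, f b) \<in> s"
    then obtain a' b' where *: "f a = f a'" "f b = f b'" "(a', b') \<in> r"
      unfolding s_def by blast
    then have "a = a'" "b = b'" using rc[OF *(3)] that inj by (auto dest: inj_onD)
    then show "(a, b) \<in> r" using * by simp
  qed (auto simp: s_def)
  have grp: "comm_group H"
  proof (rule comm_groupI)
    fix x assume "x \<in> carrier H"
    then obtain g where g: "g \<in> carrier G" "x = f g" by (auto simp: Hc)
    then have "f (inv\<^bsub>G\<^esub> g) \<otimes>\<^bsub>H\<^esub> x = \<one>\<^bsub>H\<^esub>" by (simp add: Hm H1)
    moreover have "f (inv\<^bsub>G\<^esub> g) \<in> carrier H" using g by (simp add: Hc)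
    ultimately show "\<exists>y\<in>carrier H. y \<otimes>\<^bsub>H\<^esub> x = \<one>\<^bsub>H\<^esub>" by blast
  next
    fix x y z assume "x \<in> carrier H" "y \<in> carrier H" "z \<in> carrier H"
    then obtain a b c where "a \<in> carrier G" "x = f a" "b \<in> carrier G" "y = f b"
      "c \<in> carrier G" "z = f c" by (auto simp: Hc)
    then show "x \<otimes>\<^bsub>H\<^esub> y \<otimes>\<^bsub>H\<^esub> z = x \<otimes>\<^bsub>H\<^esub> (y \<otimes>\<^bsub>H\<^esub> z)" by (simp add: Hm m_assoc)
  next
    fix x y assume "x \<in> carrier H" "y \<in> carrier H"
    then obtain a b where *: "a \<in> carrier G" "x = f a" "b \<in> carrier G" "y = f b"
      by (auto simp: Hc)
    then show "x \<otimes>\<^bsub>H\<^esub> y \<in> carrier H" by (simp add: Hm Hc)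
    from * show "x \<otimes>\<^bsub>H\<^esub> y = y \<otimes>\<^bsub>H\<^esub> x" by (simp add: Hm m_comm)
  next
    show "\<one>\<^bsub>H\<^esub> \<in> carrier H" by (simp add: Hc H1)
  next
    fix x assume "x \<in> carrier H"
    then obtain a where "a \<in> carrier G" "x = f a" by (auto simp: Hc)
    then show "\<one>\<^bsub>H\<^esub> \<otimes>\<^bsub>H\<^esub> x = x" by (simp add: Hm H1)
  qed
  have lin: "linear_order_on (carrier H) s"
    unfolding order_on_defs
  proof (intro conjI)
    show "s \<subseteq> carrier H \<times> carrier H" using rc by (auto simp: s_def Hc)
    show "refl_on (carrier H) s" using D(1) by (auto simp: refl_on_def s_iff Hc)
    show "total_on (carrier H) s" using D(4) by (auto simp: total_on_def s_iff Hc)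
    show "antisym s"
    proof (rule antisymI)
      fix x y assume xy: "(x, y) \<in> s" "(y, x) \<in> s"
      then obtain a b where ab: "x = f a" "y = f b" "(a, b) \<in> r" unfolding s_def by blast
      moreover have "(b, a) \<in> r" using xy(2) ab rc[OF ab(3)] s_iff by auto
      ultimately show "x = y" using D(2) by metis
    qed
    show "trans s"
    proof (rule transI)
      fix x y z assume xy: "(x, y) \<in> s" "(y, z) \<in> s"
      then obtain a b where ab: "x = f a" "y = f b" "(a, b) \<in> r" unfolding s_def by blast
      from xy(2) obtain b' c where bc: "y = f b'" "z = f c" "(b', c) \<in> r" unfolding s_def by blast
      have "b = b'" using ab bc rc[OF ab(3)] rc[OF bc(3)] inj by (auto dest: inj_onD)
      then have "(a, c) \<in> r" using D(3) ab bc by metis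
      then show "(x, z) \<in> s" using ab bc unfolding s_def by blast
    qed
  qed
  have ord: "ordered_abelian_group H s"
    unfolding ordered_abelian_group_def
  proof (intro conjI allI impI grp lin)
    fix x y z assume "(x, y) \<in> s" "z \<in> carrier H"
    then obtain a b c where *: "x = f a" "y = f b" "(a, b) \<in> r" "z = f c" "c \<in> carrier G"
      unfolding s_def Hc by blast
    with D(5)[OF *(3,5)] rc[OF *(3)] show "(x \<otimes>\<^bsub>H\<^esub> z, y \<otimes>\<^bsub>H\<^esub> z) \<in> s"
      by (simp add: Hm s_iff)
  qed
  have vc: "g \<in> carrier G" if "v x = Some g" for x g
  proof -
    have "Some g \<in> range v" using that by (metis rangeI)
    then show ?thesis using K by (auto simp: krull_valuation_def)
  qed
  have le: "le_inf s (w x) (w y) \<longleftrightarrow> le_inf r (v x) (v y)" for x y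
    using vc[of x] vc[of y] by (cases "v x"; cases "v y") (simp_all add: w_def s_iff)
  have "krull_valuation H s w"
    unfolding krull_valuation_def
  proof (intro conjI allI ord)
    have "range w = map_option f ` range v" by (auto simp: w_def)
    also have "range v = insert None (Some ` carrier G)" using K by (simp add: krull_valuation_def)
    finally show "range w = insert None (Some ` carrier H)" by (simp add: Hc image_image)
    show "w x = None \<longleftrightarrow> x = 0" for x using K by (simp add: krull_valuation_def w_def)
    show "w (x * y) = plus_inf H (w x) (w y)" for x y
    proof -
      have "v (x * y) = plus_inf G (v x) (v y)" using K unfolding krull_valuation_def by blast
      then show ?thesis
        using vc[of x] vc[of y] by (cases "v x"; cases "v y") (simp_all add: w_def Hm)
    qed
    show "le_inf s (w x) (w (x + y)) \<or> le_inf s (w y) (w (x + y))" for x y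
      using K unfolding le krull_valuation_def by blast
  qed
  moreover have "valuation_ring H s w = valuation_ring G r v"
  proof -
    have "w 1 = Some \<one>\<^bsub>H\<^esub>" by (simp add: w_def krull_valuation_one[OF K] H1)
    then show ?thesis
      using le[of 1] krull_valuation_one[OF K] by (simp add: valuation_ring_def)
  qed
  ultimately show ?thesis by (rule that)
qed


section \<open>Topologies on the field\<close>

definition field_topology :: "'a::field topology \<Rightarrow> bool" where
  "field_topology T \<longleftrightarrow> topspace T = UNIV \<and>
     continuous_map (prod_topology T T) T (\<lambda>(x, y). x + y) \<and>
     continuous_map T T uminus \<and>
     continuous_map (prod_topology T T) T (\<lambda>(x, y). x * y) \<and>
     continuous_map (subtopology T (- {0})) T inverse"

definition nhds_base :: "'a topology \<Rightarrow> 'a \<Rightarrow> 'a set set \<Rightarrow> bool" where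
  "nhds_base T a \<B> \<longleftrightarrow> (\<forall>N\<in>\<B>. \<exists>U. openin T U \<and> a \<in> U \<and> U \<subseteq> N) \<and>
     (\<forall>U. openin T U \<longrightarrow> a \<in> U \<longrightarrow> (\<exists>N\<in>\<B>. N \<subseteq> U))"

text \<open>
  A field topology is determined by any neighbourhood base \<open>\<B>\<close> at 0: it is
  \<open>topology_from_base \<B>\<close>, by lemma \<open>field_topology_eq_topology_from_base\<close>.
\<close>

definition topology_from_base :: "'a::field set set \<Rightarrow> 'a topology" where
  "topology_from_base \<B> = topology (\<lambda>U. \<forall>a\<in>U. \<exists>N\<in>\<B>. a +o N \<subseteq> U)"

lemma openin_topology_from_base:
  assumes dir: "\<And>M N. M \<in> \<B> \<Longrightarrow> N \<in> \<B> \<Longrightarrow> \<exists>L\<in>\<B>. L \<subseteq> M \<inter> N"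
  shows "openin (topology_from_base \<B>) U \<longleftrightarrow> (\<forall>a\<in>U. \<exists>N\<in>\<B>. a +o N \<subseteq> U)"
proof -
  have "istopology (\<lambda>U. \<forall>a\<in>U. \<exists>N\<in>\<B>. a +o N \<subseteq> U)"
    unfolding istopology_def
  proof (intro conjI allI impI ballI)
    fix S T a
    assume S: "\<forall>a\<in>S. \<exists>N\<in>\<B>. a +o N \<subseteq> S" and T: "\<forall>a\<in>T. \<exists>N\<in>\<B>. a +o N \<subseteq> T"
      and a: "a \<in> S \<inter> T"
    obtain M N where *: "M \<in> \<B>" "a +o M \<subseteq> S" "N \<in> \<B>" "a +o N \<subseteq> T" using S T a by blast
    obtain L where "L \<in> \<B>" "L \<subseteq> M \<inter> N" using dir[OF *(1,3)] by blast
    then show "\<exists>N\<in>\<B>. a +o N \<subseteq> S \<inter> T"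
      using *(2,4) set_plus_mono[of L M a] set_plus_mono[of L N a] by (intro bexI[of _ L]) blast+
  next
    fix \<K> a
    assume "\<forall>K\<in>\<K>. \<forall>a\<in>K. \<exists>N\<in>\<B>. a +o N \<subseteq> K" "a \<in> \<Union> \<K>"
    then show "\<exists>N\<in>\<B>. a +o N \<subseteq> \<Union> \<K>" by (meson Sup_upper UnionE order_trans)
  qed
  then show ?thesis by (simp add: topology_from_base_def topology_inverse')
qed

lemma field_topology_eq_topology_from_base:
  assumes T: "field_topology T" and B: "nhds_base T 0 \<B>"
  shows "T = topology_from_base \<B>"
proof -
  have top: "topspace T = UNIV" using T by (simp add: field_topology_def)
  have B1: "\<exists>U. openin T U \<and> 0 \<in> U \<and> U \<subseteq> N" if "N \<in> \<B>" for N
    using B that by (simp add: nhds_base_def)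
  have B2: "\<exists>N\<in>\<B>. N \<subseteq> U" if "openin T U" "0 \<in> U" for U
    using B that by (simp add: nhds_base_def)
  have dir: "\<exists>L\<in>\<B>. L \<subseteq> M \<inter> N" if "M \<in> \<B>" "N \<in> \<B>" for M N
  proof -
    obtain U where U: "openin T U" "0 \<in> U" "U \<subseteq> M"
      using B1[OF \<open>M \<in> \<B>\<close>] by (elim exE conjE)
    obtain V where V: "openin T V" "0 \<in> V" "V \<subseteq> N"
      using B1[OF \<open>N \<in> \<B>\<close>] by (elim exE conjE)
    have "openin T (U \<inter> V)" "0 \<in> U \<inter> V" using U V by auto
    then obtain L where "L \<in> \<B>" "L \<subseteq> U \<inter> V" using B2 by meson
    then show ?thesis using U V by blast
  qed
  have cont: "continuous_map T T (\<lambda>x. a + x)" for a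
  proof -
    have "continuous_map T (prod_topology T T) (\<lambda>x. (a, x))"
      by (simp add: continuous_map_pairwise o_def top)
    then have "continuous_map T T ((\<lambda>(x, y). x + y) \<circ> (\<lambda>x. (a, x)))"
      using T by (intro continuous_map_compose) (auto simp: field_topology_def)
    then show ?thesis by (simp add: o_def)
  qed
  have op: "openin T {x. a + x \<in> U}" if "openin T U" for a U
    using openin_continuous_map_preimage[OF cont that, of a] by (simp add: top)
  have "openin T U \<longleftrightarrow> (\<forall>a\<in>U. \<exists>N\<in>\<B>. a +o N \<subseteq> U)" for U
  proof
    assume U: "openin T U"
    show "\<forall>a\<in>U. \<exists>N\<in>\<B>. a +o N \<subseteq> U"
    proof
      fix a assume "a \<in> U"
      then have 0: "0 \<in> {x. a + x \<in> U}" by simp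
      obtain N where "N \<in> \<B>" "N \<subseteq> {x. a + x \<in> U}"
        using B2[OF op[OF U] 0] by (elim bexE)
      then show "\<exists>N\<in>\<B>. a +o N \<subseteq> U" by (intro bexI[of _ N]) (auto simp: elt_set_plus_def)
    qed
  next
    assume R: "\<forall>a\<in>U. \<exists>N\<in>\<B>. a +o N \<subseteq> U"
    show "openin T U"
    proof (subst openin_subopen, intro ballI)
      fix a assume "a \<in> U"
      then obtain N where N: "N \<in> \<B>" "a +o N \<subseteq> U" using R by blast
      obtain V where V: "openin T V" "0 \<in> V" "V \<subseteq> N"
        using B1[OF N(1)] by (elim exE conjE)
      have "{x. - a + x \<in> V} \<subseteq> U"
      proof
        fix x assume "x \<in> {x. - a + x \<in> V}"
        then have "- a + x \<in> N" using V(3) by auto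
        then have "a + (- a + x) \<in> a +o N" by (rule set_plus_intro2)
        then show "x \<in> U" using N(2) by auto
      qed
      then show "\<exists>T'. openin T T' \<and> a \<in> T' \<and> T' \<subseteq> U"
        using op[OF V(1), of "- a"] V(2) by (intro exI[of _ "{x. - a + x \<in> V}"]) simp
    qed
  qed
  then show ?thesis by (simp add: topology_eq openin_topology_from_base[OF dir])
qed

definition v_topology :: "'a::field locality \<Rightarrow> 'a topology" where
  "v_topology v = topology_from_base {z *o \<mm> v | z. z \<noteq> 0}"

lemma openin_v_topology:
  "openin (v_topology v) U \<longleftrightarrow> (\<forall>a\<in>U. \<exists>z. z \<noteq> 0 \<and> a +o (z *o \<mm> v) \<subseteq> U)"
proof -
  have sub: "x *o \<mm> v \<subseteq> y *o \<mm> v" if "inverse y * x \<in> \<O> v" "y \<noteq> 0" for x y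
  proof
    fix c assume "c \<in> x *o \<mm> v"
    then obtain b where b: "b \<in> \<mm> v" "c = x * b" by (auto simp: elt_set_times_def)
    have "c = y * (inverse y * x * b)" using b that(2) by (simp add: field_simps)
    moreover have "inverse y * x * b \<in> \<mm> v" using \<O>_mult_\<mm> that(1) b(1) by blast
    ultimately show "c \<in> y *o \<mm> v" by (auto simp: elt_set_times_def)
  qed
  have cmp: "x *o \<mm> v \<subseteq> y *o \<mm> v \<or> y *o \<mm> v \<subseteq> x *o \<mm> v" if "x \<noteq> 0" "y \<noteq> 0" for x y
  proof (cases "inverse y * x \<in> \<O> v")
    case True
    then show ?thesis using sub that by blast
  next
    case False
    then have "inverse (inverse y * x) \<in> \<O> v" using inverse_in_\<mm> \<mm>_subset_\<O> by blast
    then have "inverse x * y \<in> \<O> v" by (simp add: mult.commute)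
    then show ?thesis using sub that by blast
  qed
  show ?thesis
    unfolding v_topology_def
  proof (subst openin_topology_from_base)
    fix M N assume MN: "M \<in> {z *o \<mm> v | z. z \<noteq> 0}" "N \<in> {z *o \<mm> v | z. z \<noteq> 0}"
    then consider "M \<subseteq> N" | "N \<subseteq> M" using cmp by blast
    then show "\<exists>L\<in>{z *o \<mm> v | z. z \<noteq> 0}. L \<subseteq> M \<inter> N"
    proof cases
      case 1
      then show ?thesis using MN(1) by (intro bexI[of _ M]) simp_all
    next
      case 2
      then show ?thesis using MN(2) by (intro bexI[of _ N]) simp_all
    qed
  qed (simp add: setcompr_eq_image)
qed

definition independent_localities :: "'a::field locality \<Rightarrow> 'a locality \<Rightarrow> bool" where
  "independent_localities v w \<longleftrightarrow> v_topology v \<noteq> v_topology w"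

definition \<mm>_of :: "'a::field locality set \<Rightarrow> 'a set" where
  "\<mm>_of S' = (\<Inter>v\<in>S'. \<mm> v)"

definition set_topology :: "'a::field locality set \<Rightarrow> 'a topology" where
  "set_topology S' = topology_from_base {z *o \<mm>_of S' | z. z \<in> \<mm>_of S' - {0}}"


lemma openin_set_topology:
  "openin (set_topology S') U \<longleftrightarrow>
     (\<forall>a\<in>U. \<exists>z\<in>\<mm>_of S' - {0}. a +o (z *o \<mm>_of S') \<subseteq> U)"
proof -
  have mult: "x * y \<in> \<mm>_of S'" if "x \<in> \<mm>_of S'" "y \<in> \<mm>_of S'" for x y
    using that by (auto simp: \<mm>_of_def intro: \<O>_mult_\<mm> subsetD[OF \<mm>_subset_\<O>])
  show ?thesis
    unfolding set_topology_def
  proof (subst openin_topology_from_base)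
    fix M N
    assume "M \<in> {z *o \<mm>_of S' | z. z \<in> \<mm>_of S' - {0}}" "N \<in> {z *o \<mm>_of S' | z. z \<in> \<mm>_of S' - {0}}"
    then obtain x y where xy: "M = x *o \<mm>_of S'" "N = y *o \<mm>_of S'" "x \<in> \<mm>_of S'" "x \<noteq> 0"
      "y \<in> \<mm>_of S'" "y \<noteq> 0" by blast
    have "(x * y) *o \<mm>_of S' \<subseteq> M \<inter> N"
    proof
      fix c assume "c \<in> (x * y) *o \<mm>_of S'"
      then obtain b where b: "b \<in> \<mm>_of S'" "c = x * y * b" by (auto simp: elt_set_times_def)
      have "c = x * (y * b)" "c = y * (x * b)" using b by (simp_all add: ac_simps)
      moreover have "y * b \<in> \<mm>_of S'" "x * b \<in> \<mm>_of S'" using mult xy b(1) by simp_all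
      ultimately show "c \<in> M \<inter> N"
        unfolding xy(1,2) using set_times_intro2 by (metis IntI)
    qed
    moreover have "x * y \<in> \<mm>_of S' - {0}" using mult xy by simp
    ultimately show "\<exists>L\<in>{z *o \<mm>_of S' | z. z \<in> \<mm>_of S' - {0}}. L \<subseteq> M \<inter> N"
      by (intro bexI[of _ "(x * y) *o \<mm>_of S'"]) auto
  qed (simp add: setcompr_eq_image Bex_def conj_assoc)
qed


section \<open>Topologies on the set of localities\<close>

text \<open>Both subbases cover the type, as \<open>0 \<in> \<mm> v\<close> for all \<open>v\<close>.\<close>

definition zariski_star :: "'a::field locality topology" where
  "zariski_star = topology_generated_by {{v. x \<in> \<mm> v} | x. True}"

definition constructible :: "'a::field locality topology" where
  "constructible = topology_generated_by ({{v. x \<in> \<O> v} | x. True} \<union> {{v. x \<in> \<mm> v} | x. True})"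


section \<open>Affine space, hereditary continuity, exceptional uniformity\<close>

text \<open>Points of the affine space of dimension \<open>l\<close> are the extensional functions on \<open>{1..l}\<close>.\<close>

definition affine_space :: "nat \<Rightarrow> (nat \<Rightarrow> 'a) set" where
  "affine_space l = {1..l} \<rightarrow>\<^sub>E UNIV"

definition power_topology :: "'a topology \<Rightarrow> nat \<Rightarrow> (nat \<Rightarrow> 'a) topology" where
  "power_topology T l = product_topology (\<lambda>_. T) {1..l}"

definition ball_locality ::
    "nat \<Rightarrow> 'a::field locality \<Rightarrow> (nat \<Rightarrow> 'a) \<Rightarrow> (nat \<Rightarrow> 'a) \<Rightarrow> (nat \<Rightarrow> 'a) set" where
  "ball_locality m v y z = (\<Pi>\<^sub>E j\<in>{1..m}. y j +o (z j *o \<mm> v))"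

definition hereditarily_continuous ::
    "'a::field locality set \<Rightarrow> nat \<Rightarrow> nat \<Rightarrow> (nat \<Rightarrow> 'a) set \<Rightarrow> ((nat \<Rightarrow> 'a) \<Rightarrow> (nat \<Rightarrow> 'a)) \<Rightarrow> bool" where
  "hereditarily_continuous S l m D g \<longleftrightarrow>
     (\<forall>S'. S' \<subseteq> S \<longrightarrow> S' \<noteq> {} \<longrightarrow> compactin zariski_star S' \<longrightarrow>
        continuous_map (subtopology (power_topology (set_topology S') l) D)
          (power_topology (set_topology S') m) g)"

definition exceptional_uniformity :: "nat \<Rightarrow> (nat \<Rightarrow> 'a::field locality set) \<Rightarrow> 'a \<Rightarrow> bool" where
  "exceptional_uniformity n S t \<longleftrightarrow>
     (\<exists>f d. d = degree f \<and> d \<ge> 2 \<and>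
        (\<forall>v\<in>(\<Union>i\<in>{1..n}. S i).
           (\<forall>x\<in>\<O> v. poly f x \<in> \<O> v) \<and>
           (\<forall>x. x \<notin> \<O> v \<longrightarrow>
              poly f x \<in> ((x ^ d) *o (\<O> v - t *o \<mm> v)) \<inter>
                ((lead_coeff f * x ^ d) +o ((x ^ (d - 1)) *o \<O> v))) \<and>
           \<O> v + \<O> v \<subseteq> inverse t *o \<O> v) \<and>
        (\<forall>i\<in>{1..n}. infinite (S i) \<longrightarrow>
           (\<forall>v\<in>S i. \<forall>x\<in>\<O> v. poly f x \<notin> t *o \<mm> v)))"

end

theory Submission
  imports Defs
begin

text \<open>
  Call \<open>A\<close> and \<open>B\<close> separated if there are elements arbitrarily small on \<open>A\<close> and arbitrarily large
  on \<open>B\<close>. Independent localities are separated from each other. This spreads to compact sets by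
  covering \<open>B\<close> with finitely many neighbourhoods on which some element is large, and folding these
  elements with the form \<open>Y ^ d * f (X / Y)\<close>, which by the uniformity assumption behaves like
  \<open>max |X| |Y| ^ d\<close>; at the finitely many localities where \<open>f\<close> may have small values, one adds a last
  argument that dominates the rest. Applying this twice, with inverses in between, separates
  disjoint compact sets, and \<open>1 / (1 + x)\<close> turns a separating \<open>x\<close> into an approximate idempotent, so
  that weak approximation holds for finitely many disjoint compact sets. Finally, each \<open>S i\<close> is
  partitioned into finitely many clopen pieces on which one of the given points works; by
  hereditary continuity it can be moved a little on each piece.

  For the last step \<open>\<mm>_of P\<close> has to be open in the \<open>P\<close>-topology, which needs for \<open>b \<in> \<mm> v\<close> a lower
  bound on the distance from \<open>b\<close> to the unit sphere that is uniform near \<open>v\<close>: if 2 is large and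
  \<open>b + z\<close>, \<open>b - z\<close> are in the unit ball, then this distance is at least \<open>|z ^ 2 / 16|\<close>.
\<close>


section \<open>Unit balls of localities\<close>

lemma wf_prelocality_zero_one:
  assumes "wf_prelocality p"
  shows "0 \<in> pre_m p \<and> 1 \<notin> pre_m p"
proof (cases p)
  case (Valuation G r v)
  then have K: "krull_valuation G r v" using assms by simp
  have "v 0 = None" using K by (simp add: krull_valuation_def)
  then show ?thesis using krull_valuation_one[OF K] by (simp add: Valuation valuation_ideal_def)
next
  case (Ordering r)
  then have r: "field_ordering r" using assms by simp
  note D = field_orderingD[OF r]
  have "(0, 1) \<in> r" using D(8)[of 1] D(6)[of "- 1" "- 1"] by auto
  moreover from this have "(- 1, 0) \<in> r" using D(5)[of "- 1" 0] by simp
  ultimately show ?thesis by (simp add: Ordering)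
next
  case (Absolute_Value a)
  have a: "\<And>x. a x = 0 \<longleftrightarrow> x = 0" "\<And>x y. a (x * y) = a x * a y"
    using assms by (simp_all add: Absolute_Value absolute_value_def)
  have "a 1 = 1" using a(2)[of 1 1] a(1)[of 1] by simp
  then show ?thesis using a(1)[of 0] by (simp add: Absolute_Value)
qed

lemma zero_in_\<mm> [simp]: "0 \<in> \<mm> v"
  and one_notin_\<mm> [simp]: "1 \<notin> \<mm> v"
  by (metis locality_obtain wf_prelocality_zero_one)+

lemma \<mm>_imp_\<O>: "x \<in> \<mm> v \<Longrightarrow> x \<in> \<O> v"
  using \<mm>_subset_\<O> by blast

lemma zero_in_\<O> [simp]: "0 \<in> \<O> v"
  by (simp add: \<mm>_imp_\<O>)

text \<open>If a nonzero \<open>x\<close> is in \<open>\<mm> v\<close> and \<open>inverse x\<close>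
  in \<open>\<O> v\<close>, their product 1 is in \<open>\<mm> v\<close>. This duality lets most
  later arguments treat valuations, orderings and absolute values alike.\<close>

lemma \<mm>_iff_inverse: "x \<in> \<mm> v \<longleftrightarrow> x = 0 \<or> inverse x \<notin> \<O> v"
  using \<O>_mult_\<mm>[of "inverse x" v x] inverse_in_\<mm>[of "inverse x" v] by auto

lemma \<O>_iff_inverse: "x \<in> \<O> v \<longleftrightarrow> x = 0 \<or> inverse x \<notin> \<mm> v"
  using \<mm>_iff_inverse[of "inverse x" v] by auto

lemma one_in_\<O> [simp]: "1 \<in> \<O> v"
  by (simp add: \<O>_iff_inverse)

lemma \<O>_mult: "x \<in> \<O> v \<Longrightarrow> y \<in> \<O> v \<Longrightarrow> x * y \<in> \<O> v"
proof (rule ccontr)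
  assume x: "x \<in> \<O> v" and y: "y \<in> \<O> v" and xy: "x * y \<notin> \<O> v"
  have nz: "x \<noteq> 0" "y \<noteq> 0" using xy by auto
  have "x * inverse (x * y) \<in> \<mm> v" using inverse_in_\<mm>[OF xy] x \<O>_mult_\<mm> by blast
  also have "x * inverse (x * y) = inverse y" using nz by (simp add: field_simps)
  finally show False using y nz \<O>_iff_inverse by blast
qed

lemma \<O>_power: "x \<in> \<O> v \<Longrightarrow> x ^ n \<in> \<O> v"
  by (induction n) (auto intro: \<O>_mult)

lemma \<mm>_mult_\<O>: "x \<in> \<mm> v \<Longrightarrow> y \<in> \<O> v \<Longrightarrow> x * y \<in> \<mm> v"
  using \<O>_mult_\<mm>[of y v x] by (simp add: mult.commute)

lemma minus_one_in_\<O>: "- 1 \<in> \<O> v"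
  using \<mm>_imp_\<O>[of "- 1" v] by (auto simp: \<O>_iff_inverse)

lemma \<O>_uminus_iff [simp]: "- x \<in> \<O> v \<longleftrightarrow> x \<in> \<O> v"
  using \<O>_mult[OF minus_one_in_\<O>, of x v] \<O>_mult[OF minus_one_in_\<O>, of "- x" v] by auto

lemma \<mm>_uminus_iff [simp]: "- x \<in> \<mm> v \<longleftrightarrow> x \<in> \<mm> v"
  using \<O>_mult_\<mm>[OF minus_one_in_\<O>, of x v] \<O>_mult_\<mm>[OF minus_one_in_\<O>, of "- x" v] by auto

lemma in_elt_set_times_iff:
  fixes c :: "'a::field"
  assumes "c \<noteq> 0" shows "x \<in> c *o M \<longleftrightarrow> x / c \<in> M"
  using assms by (force simp: elt_set_times_def)

lemma eq_v_trivialI: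
  assumes "wf_prelocality p" "rep_locality v = p" and "identified p (Absolute_Value trivial_absolute_value)"
  shows "v = v_trivial"
proof -
  have "locality_rel (rep_locality v) (Absolute_Value trivial_absolute_value)"
    using assms by (auto simp: locality_rel_def absolute_value_trivial intro: r_into_equivclp)
  moreover have "abs_locality (rep_locality v) = v"
    using Quotient3_locality by (rule Quotient3_abs_rep)
  ultimately show ?thesis
    unfolding v_trivial_def using Quotient3_rel_abs[OF Quotient3_locality] by metis
qed

text \<open>If \<open>\<mm> v\<close> is zero, every nonzero element is a unit at \<open>v\<close>:
  a valuation then has a trivial value group and an absolute value is 1 off 0. An ordering cannot
  occur, because it puts \<open>inverse 2\<close> into \<open>\<mm> v\<close>.\<close>

lemma \<mm>_nontrivial:
  fixes v :: "'a::field locality"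
  assumes "v \<noteq> v_trivial"
  obtains x where "x \<noteq> 0" "x \<in> \<mm> v"
proof (rule ccontr)
  assume "\<not> thesis"
  then have m: "\<And>x. x \<in> \<mm> v \<Longrightarrow> x = 0" using that by blast
  define p where "p = rep_locality v"
  have mp: "\<mm> v = pre_m p" by (simp add: \<mm>.rep_eq p_def)
  have wf: "wf_prelocality p"
    using Quotient3_rep_reflp[OF Quotient3_locality, of v] by (simp add: p_def locality_rel_def)
  have "identified p (Absolute_Value trivial_absolute_value)"
  proof (cases p)
    case (Valuation G r w)
    have K: "krull_valuation G r w" using wf Valuation by simp
    then interpret comm_group G by (simp add: krull_valuation_def ordered_abelian_group_def)
    have o: "ordered_abelian_group G r" using K by (simp add: krull_valuation_def)
    have un: "g = \<one>\<^bsub>G\<^esub>" if g: "g \<in> carrier G" for g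
    proof -
      have "\<exists>x. w x = Some g" using K g unfolding krull_valuation_def by (metis image_eqI insertCI rangeE)
      then obtain x where x: "w x = Some g" by blast
      have "w x = None \<longleftrightarrow> x = 0" using K by (simp add: krull_valuation_def)
      with x have x0: "x \<noteq> 0" by auto
      have "x \<notin> valuation_ideal G r w" "inverse x \<notin> valuation_ideal G r w"
        using m[of x] m[of "inverse x"] x0 by (auto simp: mp Valuation)
      then have "inverse x \<in> valuation_ring G r w" "inverse (inverse x) \<in> valuation_ring G r w"
        using valuation_inverse[OF K] x0 by (metis, metis inverse_nonzero_iff_nonzero)
      then have "x \<in> valuation_ring G r w" by simp
      then show ?thesis using \<open>x \<notin> valuation_ideal G r w\<close> x
        by (simp add: valuation_ideal_def valuation_ring_def)
    qed
    show ?thesis unfolding Valuation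
    proof (rule rank_one[OF K absolute_value_trivial, where \<phi> = "\<lambda>_. 0"])
      show "\<forall>g\<in>carrier G. \<forall>h\<in>carrier G. ((g, h) \<in> r) = (0 \<le> (0::real))"
        using un ordered_abelian_groupD(1)[OF o] by auto
      show "\<forall>x g. w x = Some g \<longrightarrow> trivial_absolute_value x = exp (- 0)"
      proof (intro allI impI)
        fix x g assume "w x = Some g"
        moreover have "w x = None \<longleftrightarrow> x = 0" using K by (simp add: krull_valuation_def)
        ultimately show "trivial_absolute_value x = exp (- 0)"
          by (auto simp: trivial_absolute_value_def)
      qed
    qed simp
  next
    case (Ordering r)
    have r: "field_ordering r" using wf Ordering by simp
    note D = field_orderingD[OF r]
    have o: "(0, 1) \<in> r" using D(8)[of 1] D(6)[of "- 1" "- 1"] by auto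
    have two: "(0, 2) \<in> r" using D(7)[OF o o] by simp
    have "2 \<noteq> (0::'a)"
    proof
      assume "2 = (0::'a)"
      then have "- 1 = (1::'a)" by (metis add.inverse_unique one_add_one)
      then have "(0, - 1) \<in> r" using o by (simp only:)
      then show False using D(9)[of 1] o by simp
    qed
    have "(2 :: 'a) \<notin> \<O> v" 
    proof
      assume "2 \<in> \<O> v"
      then have "(2, 1) \<in> r" by (simp add: \<O>.rep_eq Ordering flip: p_def)
      then have "(0, 1 - 2) \<in> r" using D(5) by blast
      then have "(0, - 1) \<in> r" by simp
      then show False using D(9)[of 1] o by simp
    qed
    from m[OF inverse_in_\<mm>[OF this]] show ?thesis using \<open>2 \<noteq> 0\<close> by simp
  next
    case (Absolute_Value a)
    have a: "absolute_value a" using wf Absolute_Value by simp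
    have eq: "a x = 1" if "x \<noteq> 0" for x
    proof -
      have "\<not> a x < 1" "\<not> a (inverse x) < 1" using m[of x] m[of "inverse x"] that
        by (auto simp: mp Absolute_Value)
      moreover have "a x * a (inverse x) = 1 "
      proof -
        have mm: "a (x * y) = a x * a y" for x y using a by (simp add: absolute_value_def)
        have "a 1 = 1" using mm[of 1 1] a by (simp add: absolute_value_def)
        then show ?thesis using mm[of x "inverse x"] that by simp
      qed
      ultimately show ?thesis by (smt (verit) mult_less_cancel_left2)
    qed
    have "a = trivial_absolute_value"
      using a eq by (auto simp: fun_eq_iff trivial_absolute_value_def absolute_value_def)
    then show ?thesis unfolding Absolute_Value
      by (intro equivalent_absolute_values[of _ _ 1] a) (use a in \<open>auto simp: absolute_value_def\<close>)
  qed
  then show False using eq_v_trivialI[OF wf] assms p_def by blast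
qed


section \<open>Separation and weak approximation\<close>

text \<open>Read \<open>x / c \<in> \<mm> v\<close> as \<open>|x| < |c|\<close> at \<open>v\<close>. A finite set \<open>C\<close> of bounds is allowed because over
  infinitely many localities there need not be a single smallest bound.\<close>

definition separated :: "'a::field locality set \<Rightarrow> 'a locality set \<Rightarrow> bool" where
  "separated A B \<longleftrightarrow> (\<forall>C. finite C \<longrightarrow> 0 \<notin> C \<longrightarrow> (\<exists>x. (\<forall>v\<in>A. \<forall>c\<in>C. x / c \<in> \<mm> v) \<and>
     (\<forall>v\<in>B. x \<noteq> 0 \<and> (\<forall>c\<in>C. inverse x / c \<in> \<mm> v))))"

lemma separatedD:
  assumes "separated A B" "finite C" "0 \<notin> C"
  obtains x where "\<And>v c. v \<in> A \<Longrightarrow> c \<in> C \<Longrightarrow> x / c \<in> \<mm> v" "\<And>v. v \<in> B \<Longrightarrow> x \<noteq> 0"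
    "\<And>v c. v \<in> B \<Longrightarrow> c \<in> C \<Longrightarrow> inverse x / c \<in> \<mm> v"
  using assms unfolding separated_def by meson

lemma separated_empty: "separated A {}"
  unfolding separated_def by (auto intro!: exI[of _ 0])

text \<open>Invert the separating element; a point of \<open>B\<close> guarantees that it is
  nonzero.\<close>

lemma separated_swap:
  assumes "separated A B" "B \<noteq> {}"
  shows "separated B A"
  unfolding separated_def
proof (intro allI impI)
  fix C :: "'a set" assume "finite C" "0 \<notin> C"
  from separatedD[OF assms(1) this] obtain x where "\<And>v c. v \<in> A \<Longrightarrow> c \<in> C \<Longrightarrow> x / c \<in> \<mm> v"
    "\<And>v. v \<in> B \<Longrightarrow> x \<noteq> 0" "\<And>v c. v \<in> B \<Longrightarrow> c \<in> C \<Longrightarrow> inverse x / c \<in> \<mm> v" by blast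
  then show "\<exists>x. (\<forall>v\<in>B. \<forall>c\<in>C. x / c \<in> \<mm> v) \<and>
     (\<forall>v\<in>A. x \<noteq> 0 \<and> (\<forall>c\<in>C. inverse x / c \<in> \<mm> v))"
    using assms(2) by (intro exI[of _ "inverse x"]) auto
qed

text \<open>At a single locality any two nonzero elements are comparable, so one bound replaces
  finitely many.\<close>

lemma exists_smallest_multiple:
  assumes "finite C" "0 \<notin> C"
  shows "\<exists>b. b \<noteq> 0 \<and> (\<forall>c\<in>C. b / c \<in> \<O> v)"
  using assms
proof (induction C rule: finite_induct)
  case empty
  then show ?case by (auto intro: exI[of _ 1])
next
  case (insert c C)
  then obtain b where b: "b \<noteq> 0" "\<forall>c\<in>C. b / c \<in> \<O> v" by auto
  have c: "c \<noteq> 0" using insert by auto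
  show ?case
  proof (cases "b / c \<in> \<O> v")
    case True
    then show ?thesis using b by auto
  next
    case False
    then have cb: "c / b \<in> \<O> v" using inverse_in_\<mm>[OF False] by (simp add: \<mm>_imp_\<O>)
    have "c / x \<in> \<O> v" if "x \<in> C" for x
      using \<O>_mult[OF cb] b that by (metis nonzero_divide_eq_eq times_divide_eq_left times_divide_eq_right)
    then show ?thesis using c by (auto intro!: exI[of _ c])
  qed
qed

text \<open>An element \<open>s\<close> of \<open>\<mm> w\<close> absorbs the bound:
  \<open>(z * s / e) *o \<mm> v\<close> lies in \<open>z *o \<mm> w\<close>. Two such bounds, one in
  each direction, make the topologies equal.\<close>

lemma bounded_imp_v_topology_le:
  assumes "e \<noteq> 0" "s \<noteq> 0" "s \<in> \<mm> w" and bd: "\<And>x. x \<in> \<mm> v \<Longrightarrow> x / e \<in> \<O> w"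
    and U: "openin (v_topology w) U"
  shows "openin (v_topology v) U"
  unfolding openin_v_topology
proof
  fix a assume "a \<in> U"
  then obtain z where z: "z \<noteq> 0" "a +o (z *o \<mm> w) \<subseteq> U" using U unfolding openin_v_topology by blast
  have "(z * s / e) *o \<mm> v \<subseteq> z *o \<mm> w"
  proof
    fix x assume "x \<in> (z * s / e) *o \<mm> v"
    then obtain y where y: "y \<in> \<mm> v" "x = z * s / e * y" by (auto simp: elt_set_times_def)
    have "x = z * (y / e * s)" using y by simp
    moreover have "y / e * s \<in> \<mm> w" using bd[OF y(1)] assms(3) by (rule \<O>_mult_\<mm>)
    ultimately show "x \<in> z *o \<mm> w" unfolding elt_set_times_def by blast
  qed
  then show "\<exists>z. z \<noteq> 0 \<and> a +o (z *o \<mm> v) \<subseteq> U"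
    using z assms(1,2) set_plus_mono[of "(z * s / e) *o \<mm> v" "z *o \<mm> w" a]
    by (intro exI[of _ "z * s / e"]) auto
qed

text \<open>If no element were small at \<open>v\<close> and large at \<open>w\<close>, then \<open>\<mm> v\<close> would be bounded at \<open>w\<close>,
  and passing to inverses, a multiple of \<open>\<mm> w\<close> would be bounded at \<open>v\<close>.\<close>

lemma independent_imp_separated:
  assumes ind: "independent_localities v w" and "v \<noteq> v_trivial" "w \<noteq> v_trivial"
  shows "separated {v} {w}"
  unfolding separated_def
proof (intro allI impI)
  fix C :: "'a set" assume C: "finite C" "0 \<notin> C"
  obtain b where b: "b \<noteq> 0" "\<And>c. c \<in> C \<Longrightarrow> b / c \<in> \<O> v" using exists_smallest_multiple[OF C] by meson
  obtain b' where b': "b' \<noteq> 0" "\<And>c. c \<in> C \<Longrightarrow> b' / c \<in> \<O> w" using exists_smallest_multiple[OF C] by meson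
  have "\<exists>x. x \<noteq> 0 \<and> x / b \<in> \<mm> v \<and> inverse x / b' \<in> \<mm> w"
  proof (rule ccontr)
    assume no: "\<not> ?thesis"
    \<comment> \<open>Testing the failed claim on \<open>b * x\<close> with \<open>x\<close> in
      \<open>\<mm> v\<close> gives \<open>x * (b * b') \<in> \<O> w\<close>, that is, the bound
      \<open>e\<close> on \<open>\<mm> v\<close>.\<close>
    define e where "e = inverse (b * b')"
    have e: "e \<noteq> 0" using b b' by (simp add: e_def)
    have bd: "x / e \<in> \<O> w" if "x \<in> \<mm> v" for x
    proof (cases "x = 0")
      case False
      then have "inverse (b * x) / b' \<notin> \<mm> w" using no that b(1) by (metis mult_eq_0_iff nonzero_mult_div_cancel_left)
      moreover have "inverse (x / e) = inverse (b * x) / b'" by (simp add: e_def divide_inverse ac_simps)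
      ultimately show ?thesis using \<O>_iff_inverse by metis
    qed simp
    obtain r where r: "r \<noteq> 0" "r \<in> \<mm> v" using \<mm>_nontrivial assms(2) by blast
    obtain s where s: "s \<noteq> 0" "s \<in> \<mm> w" using \<mm>_nontrivial assms(3) by blast
    have bd': "y / e \<in> \<O> v" if "y \<in> \<mm> w" for y
    proof (rule ccontr)
      assume n: "y / e \<notin> \<O> v"
      then have "y \<noteq> 0" by auto
      have "inverse (y / e) / e \<in> \<O> w" using bd inverse_in_\<mm>[OF n] by blast
      then have "inverse y \<in> \<O> w" using e by (simp add: field_simps)
      then show False using that \<mm>_iff_inverse \<open>y \<noteq> 0\<close> by blast
    qed
    have "openin (v_topology v) U = openin (v_topology w) U" for U
      using bounded_imp_v_topology_le[OF e s bd] bounded_imp_v_topology_le[OF e r bd'] by blast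
    then show False using ind by (simp add: independent_localities_def topology_eq)
  qed
  then obtain x where x: "x \<noteq> 0" "x / b \<in> \<mm> v" "inverse x / b' \<in> \<mm> w" by blast
  have "x / c \<in> \<mm> v" if "c \<in> C" for c
    using \<O>_mult_\<mm>[OF b(2)[OF that] x(2)] b(1) by simp
  moreover have "inverse x / c \<in> \<mm> w" if "c \<in> C" for c
    using \<O>_mult_\<mm>[OF b'(2)[OF that] x(3)] b'(1) by simp
  ultimately show "\<exists>x. (\<forall>v\<in>{v}. \<forall>c\<in>C. x / c \<in> \<mm> v) \<and>
     (\<forall>v\<in>{w}. x \<noteq> 0 \<and> (\<forall>c\<in>C. inverse x / c \<in> \<mm> v))" using x(1) by blast
qed

text \<open>\<open>E\<close> stands for the localities in the finite \<open>S i\<close>, where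
  \<open>f\<close> may take small values on the unit ball.\<close>

locale uniform_localities =
  fixes S E :: "'a::field locality set" and t :: 'a and f :: "'a poly"
  assumes t_nz: "t \<noteq> 0" and degree_ge: "degree f \<ge> 2"
    and nontrivial: "v \<in> S \<Longrightarrow> v \<noteq> v_trivial"
    and poly_in_\<O>: "v \<in> S \<Longrightarrow> x \<in> \<O> v \<Longrightarrow> poly f x \<in> \<O> v"
    and poly_outside: "v \<in> S \<Longrightarrow> x \<notin> \<O> v \<Longrightarrow> poly f x \<in> x ^ degree f *o (\<O> v - t *o \<mm> v)"
    and add_\<O>: "v \<in> S \<Longrightarrow> x \<in> \<O> v \<Longrightarrow> y \<in> \<O> v \<Longrightarrow> t * (x + y) \<in> \<O> v"
    and finite_exceptional: "finite E"
    and poly_avoids: "v \<in> S - E \<Longrightarrow> x \<in> \<O> v \<Longrightarrow> poly f x \<notin> t *o \<mm> v"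
    and independent: "pairwise independent_localities S"
begin

section \<open>Addition and inversion up to the factor \<open>t\<close>\<close>

lemma t_in_\<O>: "v \<in> S \<Longrightarrow> t \<in> \<O> v"
  using add_\<O>[of v 1 0] by simp

text \<open>Factor out the larger summand, say \<open>x\<close>: the cofactor
  \<open>t * (1 + y / x)\<close> is in \<open>\<O> v\<close>.\<close>

lemma add_\<mm>:
  assumes v: "v \<in> S" and x: "x \<in> \<mm> v" and y: "y \<in> \<mm> v"
  shows "t * (x + y) \<in> \<mm> v"
proof -
  have *: "t * (x + y) \<in> \<mm> v" if xy: "x \<in> \<mm> v" "x \<noteq> 0" "y / x \<in> \<O> v" for x y
  proof -
    have "t * (1 + y / x) * x \<in> \<mm> v" using add_\<O>[OF v _ xy(3), of 1] xy(1) by (simp add: \<O>_mult_\<mm>)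
    also have "t * (1 + y / x) * x = t * (x + y)" using xy(2) by (simp add: field_simps)
    finally show ?thesis .
  qed
  show ?thesis
  proof (cases "x = 0 \<or> y = 0")
    case True
    then show ?thesis using x y t_in_\<O>[OF v] by (auto intro: \<O>_mult_\<mm>)
  next
    case False
    then show ?thesis
      using *[OF x, of y] *[OF y, of x] inverse_in_\<mm>[of "y / x" v] x y
      by (cases "y / x \<in> \<O> v") (auto simp: add.commute \<mm>_imp_\<O>)
  qed
qed

lemma add_\<mm>_div:
  assumes "v \<in> S" "c \<noteq> 0" "x / (t * c) \<in> \<mm> v" "y / (t * c) \<in> \<mm> v"
  shows "(x + y) / c \<in> \<mm> v"
  using add_\<mm>[OF assms(1,3,4)] t_nz by (simp add: add_divide_distrib[symmetric])

text \<open>Were \<open>(1 + x) / t\<close> in \<open>\<mm> v\<close>, subtracting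
  \<open>x / t\<close> and applying \<open>add_\<mm>\<close> would put 1 there. So inverting
  \<open>1 + x\<close> costs at most the factor \<open>t\<close>.\<close>

lemma one_plus_small:
  assumes v: "v \<in> S" and x: "x / t \<in> \<mm> v"
  shows "1 + x \<noteq> 0" "t / (1 + x) \<in> \<O> v"
proof -
  have n: "(1 + x) / t \<notin> \<mm> v"
  proof
    assume "(1 + x) / t \<in> \<mm> v"
    from add_\<mm>[OF v this, of "- (x / t)"] x have "t * ((1 + x) / t - x / t) \<in> \<mm> v" by simp
    then show False using t_nz by (simp add: diff_divide_distrib[symmetric])
  qed
  then show "1 + x \<noteq> 0" by auto
  show "t / (1 + x) \<in> \<O> v" using n \<O>_iff_inverse[of "t / (1 + x)" v] by simp
qed

lemma dominated_sum_large:
  assumes v: "v \<in> S" and "c \<noteq> 0" "x \<noteq> 0" "inverse x / (t * c) \<in> \<mm> v" "y / x / t \<in> \<mm> v"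
  shows "x + y \<noteq> 0" "inverse (x + y) / c \<in> \<mm> v"
proof -
  note o = one_plus_small[OF v assms(5)]
  have e: "x + y = x * (1 + y / x)" using assms(3) by (simp add: field_simps)
  show "x + y \<noteq> 0" unfolding e using o(1) assms(3) by simp
  have "t / (1 + y / x) * (inverse x / (t * c)) \<in> \<mm> v" using o(2) assms(4) by (rule \<O>_mult_\<mm>)
  also have "t / (1 + y / x) * (inverse x / (t * c)) = inverse (x + y) / c"
    unfolding e using t_nz by (simp add: divide_inverse ac_simps)
  finally show "inverse (x + y) / c \<in> \<mm> v" .
qed

text \<open>Given \<open>a\<close> large at \<open>w\<close> and \<open>b\<close> large on \<open>B\<close> and dominating \<open>a\<close> there, either \<open>b\<close> is
  also large at \<open>w\<close>, or \<open>a\<close> dominates \<open>b\<close> at \<open>w\<close>, so that \<open>a + b\<close> is large everywhere.\<close>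

lemma separated_finite:
  assumes "finite B" and A: "A \<subseteq> S" and "B \<subseteq> S" "\<And>w. w \<in> B \<Longrightarrow> separated A {w}"
  shows "separated A B"
  using assms(1,3,4)
proof (induction B rule: finite_induct)
  case empty
  show ?case by (rule separated_empty)
next
  case (insert w B)
  then have sB: "separated A B" and sw: "separated A {w}" and w: "w \<in> S" and BS: "B \<subseteq> S" by auto
  show ?case
    unfolding separated_def
  proof (intro allI impI)
    fix C :: "'a set" assume C: "finite C" "0 \<notin> C"
    \<comment> \<open>The factor \<open>t\<close> compensates for the loss when \<open>a\<close> and
      \<open>b\<close> are added.\<close>
    define C1 where "C1 = (\<lambda>c. t * c) ` C"
    have C1: "finite C1" "0 \<notin> C1" using C t_nz by (auto simp: C1_def)
    obtain a where a: "\<And>v c. v \<in> A \<Longrightarrow> c \<in> C1 \<Longrightarrow> a / c \<in> \<mm> v" "a \<noteq> 0"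
      "\<And>c. c \<in> C1 \<Longrightarrow> inverse a / c \<in> \<mm> w"
      using separatedD[OF sw C1] by (metis singletonI)
    \<comment> \<open>The bound \<open>t / a\<close> makes \<open>b\<close> so large on
      \<open>B\<close> that \<open>a / b / t\<close> is in the ideal there.\<close>
    define C2 where "C2 = insert (t / a) (C \<union> C1)"
    have C2: "finite C2" "0 \<notin> C2" using C C1 t_nz a(2) by (auto simp: C2_def)
    obtain b where b: "\<And>v c. v \<in> A \<Longrightarrow> c \<in> C2 \<Longrightarrow> b / c \<in> \<mm> v" "\<And>v. v \<in> B \<Longrightarrow> b \<noteq> 0"
      "\<And>v c. v \<in> B \<Longrightarrow> c \<in> C2 \<Longrightarrow> inverse b / c \<in> \<mm> v"
      using separatedD[OF sB C2] by blast
    show "\<exists>x. (\<forall>v\<in>A. \<forall>c\<in>C. x / c \<in> \<mm> v) \<and>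
      (\<forall>v\<in>insert w B. x \<noteq> 0 \<and> (\<forall>c\<in>C. inverse x / c \<in> \<mm> v))"
    proof (cases "b \<noteq> 0 \<and> (\<forall>c\<in>C. inverse b / c \<in> \<mm> w)")
      case True
      then show ?thesis using b by (intro exI[of _ b]) (auto simp: C2_def)
    next
      case False
      \<comment> \<open>A bound \<open>c\<close> at which \<open>b\<close> fails to be large gives
        \<open>b * c \<in> \<O> w\<close>, while \<open>a\<close> is large beyond
        \<open>t * c\<close>; multiplying, \<open>a\<close> dominates \<open>b\<close>.\<close>
      have ba: "b / a / t \<in> \<mm> w"
      proof (cases "b = 0")
        case nz: False
        then obtain c where c: "c \<in> C" "inverse b / c \<notin> \<mm> w" using False by blast
        have "c \<noteq> 0" using c(1) C(2) by auto
        have "inverse (inverse b / c) \<in> \<O> w"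
          using c(2) \<mm>_iff_inverse by blast
        then have "inverse (inverse b / c) * (inverse a / (t * c)) \<in> \<mm> w"
          using c(1) a(3) by (intro \<O>_mult_\<mm>) (auto simp: C1_def)
        then show ?thesis using \<open>c \<noteq> 0\<close> by (simp add: field_simps)
      qed simp
      show ?thesis
      proof (intro exI[of _ "a + b"] conjI ballI)
        fix v c assume vc: "v \<in> A" "c \<in> C"
        then have "t * c \<in> C1" unfolding C1_def by (intro imageI)
        then show "(a + b) / c \<in> \<mm> v"
          using vc a(1) b(1) A C(2) by (intro add_\<mm>_div) (auto simp: C2_def)
      next
        fix v assume v: "v \<in> insert w B"
        have *: "a + b \<noteq> 0 \<and> (\<forall>c\<in>C. inverse (a + b) / c \<in> \<mm> v)"
        proof (cases "v = w")
          case True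
          have "1 + b / a \<noteq> 0" using one_plus_small[OF w ba] by simp
          then have "a + b \<noteq> 0" using a(2) by (simp add: add_divide_distrib[symmetric] field_simps)
          moreover have "inverse (a + b) / c \<in> \<mm> w" if "c \<in> C" for c
            by (rule dominated_sum_large[OF w _ a(2) a(3) ba]) (use that C(2) in \<open>auto simp: C1_def\<close>)
          ultimately show ?thesis using True by blast
        next
          case False
          then have vB: "v \<in> B" "v \<in> S" using v BS by auto
          have "inverse b / (t / a) \<in> \<mm> v" using b(3)[OF vB(1), of "t / a"] by (simp only: C2_def insertI1)
          then have ab: "a / b / t \<in> \<mm> v" using a(2) by (simp add: field_simps)
          have "1 + a / b \<noteq> 0" using one_plus_small[OF vB(2) ab] by simp
          then have "a + b \<noteq> 0" using b(2)[OF vB(1)] by (simp add: add_divide_distrib[symmetric] field_simps)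
          moreover have "inverse (b + a) / c \<in> \<mm> v" if "c \<in> C" for c
            by (rule dominated_sum_large[OF vB(2) _ b(2)[OF vB(1)] b(3)[OF vB(1)] ab])
              (use that C(2) in \<open>auto simp: C1_def C2_def\<close>)
          ultimately show ?thesis by (simp add: add.commute)
        qed
        show "a + b \<noteq> 0" using * by blast
        show "inverse (a + b) / c \<in> \<mm> v" if "c \<in> C" for c using * that by blast
      qed
    qed
  qed
qed

text \<open>The homogenisation \<open>Y ^ d * f (X / Y)\<close> behaves like \<open>max |X| |Y| ^ d\<close> up to factors bounded
  in terms of \<open>t\<close>, at exceptional localities at least where \<open>X\<close> dominates.\<close>

definition form :: "'a \<Rightarrow> 'a \<Rightarrow> 'a" where
  "form X Y = (if Y = 0 then X else Y ^ degree f * poly f (X / Y))"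

lemma form_outside:
  assumes "v \<in> S" "Y \<noteq> 0" "X / Y \<notin> \<O> v"
  obtains u where "u \<in> \<O> v" "u / t \<notin> \<mm> v" "form X Y = X ^ degree f * u"
proof -
  from poly_outside[OF assms(1,3)] obtain u where
    u: "u \<in> \<O> v" "u \<notin> t *o \<mm> v" "poly f (X / Y) = (X / Y) ^ degree f * u"
    by (auto simp: elt_set_times_def)
  then show ?thesis using that[of u] assms(2) t_nz
    by (simp add: form_def in_elt_set_times_iff power_divide)
qed

text \<open>For nonzero \<open>Y\<close> the form is \<open>Z ^ degree f * u\<close> with
  \<open>Z\<close> one of the arguments and \<open>u\<close> in the unit ball. One factor
  \<open>Z\<close> yields the bound \<open>c\<close>; the bound \<open>t\<close> puts the remaining
  powers into the unit ball.\<close>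

lemma form_small:
  assumes v: "v \<in> S" and c: "X / c \<in> \<mm> v" "Y / c \<in> \<mm> v" and "X / t \<in> \<mm> v" "Y / t \<in> \<mm> v"
  shows "form X Y / c \<in> \<mm> v"
proof -
  have m: "X \<in> \<O> v" "Y \<in> \<O> v"
    using assms(4,5) t_nz \<O>_mult_\<mm>[OF t_in_\<O>[OF v] assms(4)] \<O>_mult_\<mm>[OF t_in_\<O>[OF v] assms(5)]
    by (simp_all add: \<mm>_imp_\<O>)
  have *: "Z ^ degree f * u / c \<in> \<mm> v" if "Z / c \<in> \<mm> v" "Z \<in> \<O> v" "u \<in> \<O> v" for Z u
  proof -
    have "Z ^ degree f = Z * Z ^ (degree f - 1)"
      using degree_ge by (simp add: power_eq_if)
    then have "Z ^ degree f * u / c = (Z / c) * (Z ^ (degree f - 1) * u)" by simp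
    then show ?thesis using that by (simp only: \<mm>_mult_\<O> \<O>_mult \<O>_power)
  qed
  show ?thesis
  proof (cases "Y = 0")
    case True
    then show ?thesis using c by (simp add: form_def)
  next
    case False
    show ?thesis
    proof (cases "X / Y \<in> \<O> v")
      case True
      then show ?thesis using *[OF c(2) m(2) poly_in_\<O>[OF v True]] False by (simp add: form_def)
    next
      case False
      obtain u where "u \<in> \<O> v" "form X Y = X ^ degree f * u"
        using form_outside[OF v \<open>Y \<noteq> 0\<close> False] by blast
      then show ?thesis using *[OF c(1) m(1)] by simp
    qed
  qed
qed

text \<open>Here degree at least 2 enters: of the factors \<open>inverse Z\<close>, one yields the
  bound \<open>c\<close>, a second compensates for \<open>u\<close> being as small as
  \<open>t\<close>, and the others are in the unit ball.\<close>

lemma power_mult_large: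
  assumes v: "v \<in> S" and Z: "Z \<noteq> 0" "inverse Z / c \<in> \<mm> v" "inverse Z / t \<in> \<mm> v" and u: "u / t \<notin> \<mm> v"
  shows "Z ^ degree f * u \<noteq> 0 \<and> inverse (Z ^ degree f * u) / c \<in> \<mm> v"
proof
  have u': "u \<noteq> 0" "t / u \<in> \<O> v" using u \<O>_iff_inverse[of "t / u" v] by auto
  show "Z ^ degree f * u \<noteq> 0" using Z u' by simp
  have m: "inverse Z \<in> \<O> v"
    using \<O>_mult_\<mm>[OF t_in_\<O>[OF v] Z(3)] t_nz by (simp add: \<mm>_imp_\<O>)
  define k where "k = degree f - 2"
  have k: "degree f = Suc (Suc k)" using degree_ge by (simp add: k_def)
  have "inverse Z / t * (q * (t / u)) = inverse Z * q * inverse u" for q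
    using t_nz u'(1) by (simp add: divide_inverse)
  then have "inverse (Z ^ degree f * u) / c = (inverse Z / c) * (inverse Z / t * (inverse Z ^ k * (t / u)))"
    using t_nz by (simp add: k divide_inverse power_inverse mult.assoc mult.left_commute)
  moreover have "(inverse Z / c) * (inverse Z / t * (inverse Z ^ k * (t / u))) \<in> \<mm> v"
    by (intro \<mm>_mult_\<O> Z \<O>_mult \<O>_power m u' \<mm>_imp_\<O>[OF Z(3)])
  ultimately show "inverse (Z ^ degree f * u) / c \<in> \<mm> v" by simp
qed

text \<open>A dominant \<open>X\<close> means that \<open>f\<close> is evaluated outside the unit
  ball, where its values are controlled even at localities of \<open>E\<close>.\<close>

lemma form_large_if_dominant:
  assumes v: "v \<in> S" and X: "X \<noteq> 0" "inverse X / c \<in> \<mm> v" "inverse X / t \<in> \<mm> v" and XY: "Y / X \<in> \<mm> v"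
  shows "form X Y \<noteq> 0 \<and> inverse (form X Y) / c \<in> \<mm> v"
proof (cases "Y = 0")
  case True
  then show ?thesis using X by (simp add: form_def)
next
  case False
  then have "X / Y \<notin> \<O> v" using XY X(1) \<mm>_iff_inverse[of "Y / X" v] by simp
  then obtain u where "u / t \<notin> \<mm> v" "form X Y = X ^ degree f * u" using form_outside[OF v False] by metis
  then show ?thesis using power_mult_large[OF v X] by simp
qed

lemma form_large:
  assumes v: "v \<in> S - E"
    and XY: "X \<noteq> 0 \<and> inverse X / c \<in> \<mm> v \<and> inverse X / t \<in> \<mm> v \<or>
       Y \<noteq> 0 \<and> inverse Y / c \<in> \<mm> v \<and> inverse Y / t \<in> \<mm> v"
  shows "form X Y \<noteq> 0 \<and> inverse (form X Y) / c \<in> \<mm> v"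
proof -
  have vS: "v \<in> S" using v by simp
  have mult: "x * (inverse y / d) \<in> \<mm> v" if "x \<in> \<O> v" "inverse y / d \<in> \<mm> v" for x y d
    using that by (rule \<O>_mult_\<mm>)
  show ?thesis
  proof (cases "Y = 0")
    case True
    then show ?thesis using XY by (auto simp: form_def)
  next
    case Y: False
    show ?thesis
    proof (cases "X / Y \<in> \<O> v")
      case True
      \<comment> \<open>Here \<open>Y\<close> is at least as large as \<open>X\<close>, so it
        inherits largeness from \<open>X\<close>.\<close>
      have large: "inverse Y / c \<in> \<mm> v \<and> inverse Y / t \<in> \<mm> v"
        using XY
      proof
        assume X: "X \<noteq> 0 \<and> inverse X / c \<in> \<mm> v \<and> inverse X / t \<in> \<mm> v"
        then have "X / Y * (inverse X / d) = inverse Y / d" for d by (simp add: field_simps)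
        then show ?thesis using X mult[OF True, of X] by metis
      qed simp
      have "poly f (X / Y) / t \<notin> \<mm> v" using poly_avoids[OF v True] t_nz by (simp add: in_elt_set_times_iff)
      then have "Y ^ degree f * poly f (X / Y) \<noteq> 0 \<and> inverse (Y ^ degree f * poly f (X / Y)) / c \<in> \<mm> v"
        using large by (intro power_mult_large[OF vS Y]) auto
      then show ?thesis unfolding form_def using Y by simp
    next
      case False
      then have X: "X \<noteq> 0" by auto
      have YX: "Y / X \<in> \<mm> v" using inverse_in_\<mm>[OF False] by simp
      have "inverse X / c \<in> \<mm> v \<and> inverse X / t \<in> \<mm> v"
        using XY
      proof
        assume Y: "Y \<noteq> 0 \<and> inverse Y / c \<in> \<mm> v \<and> inverse Y / t \<in> \<mm> v"
        then have "Y / X * (inverse Y / d) = inverse X / d" for d by (simp add: field_simps)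
        then show ?thesis using Y mult[OF \<mm>_imp_\<O>[OF YX], of Y] by metis
      qed simp
      then show ?thesis using form_large_if_dominant[OF vS X _ _ YX] by blast
    qed
  qed
qed

section \<open>Separation of compact sets\<close>

lemma separated_compact:
  assumes A: "A \<subseteq> S" and B: "B \<subseteq> S" "compactin zariski_star B" and AB: "\<And>w. w \<in> B \<Longrightarrow> separated A {w}"
  shows "separated A B"
  unfolding separated_def
proof (intro allI impI)
  fix C :: "'a set" assume C: "finite C" "0 \<notin> C"
  \<comment> \<open>The bound \<open>t\<close> is carried through the fold because
    \<open>form_small\<close> and \<open>form_large\<close> require it.\<close>
  define C1 where "C1 = insert t C"
  have C1: "finite C1" "0 \<notin> C1" using C t_nz by (auto simp: C1_def)
  have "\<forall>w\<in>B. \<exists>x. (\<forall>v\<in>A. \<forall>c\<in>C1. x / c \<in> \<mm> v) \<and> x \<noteq> 0 \<and> (\<forall>c\<in>C1. inverse x / c \<in> \<mm> w)"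
  proof
    fix w assume "w \<in> B"
    from separatedD[OF AB[OF this] C1] show "\<exists>x. (\<forall>v\<in>A. \<forall>c\<in>C1. x / c \<in> \<mm> v) \<and> x \<noteq> 0 \<and>
      (\<forall>c\<in>C1. inverse x / c \<in> \<mm> w)" by (metis singletonI)
  qed
  then obtain x where x: "\<And>w v c. w \<in> B \<Longrightarrow> v \<in> A \<Longrightarrow> c \<in> C1 \<Longrightarrow> x w / c \<in> \<mm> v"
    "\<And>w. w \<in> B \<Longrightarrow> x w \<noteq> 0" "\<And>w c. w \<in> B \<Longrightarrow> c \<in> C1 \<Longrightarrow> inverse (x w) / c \<in> \<mm> w" by metis
  define N where "N w = (\<Inter>c\<in>C1. {v. inverse (x w) / c \<in> \<mm> v})" for w
  have "openin zariski_star {v. a \<in> \<mm> v}" for a :: 'a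
    unfolding zariski_star_def by (rule topology_generated_by_Basis) blast
  then have "openin zariski_star (N w)" for w
    unfolding N_def using C1(1) by (intro openin_INT2) (auto simp: C1_def)
  moreover have "w \<in> N w" if "w \<in> B" for w using x(3) that by (auto simp: N_def)
  ultimately have "\<exists>\<F>. finite \<F> \<and> \<F> \<subseteq> N ` B \<and> B \<subseteq> \<Union>\<F>"
    using B(2) unfolding compactin_def by (metis (no_types, lifting) UN_I imageE subsetI)
  then obtain W where W: "finite W" "W \<subseteq> B" "B \<subseteq> \<Union>(N ` W)" by (metis finite_subset_image)
  \<comment> \<open>The fold leaves out \<open>E\<close>, where the form of large arguments may be
    small.\<close>
  have "\<exists>X. (\<forall>v\<in>A. \<forall>c\<in>C1. X / c \<in> \<mm> v) \<and>
    (\<forall>v\<in>(S - E) \<inter> \<Union>(N ` W). X \<noteq> 0 \<and> (\<forall>c\<in>C1. inverse X / c \<in> \<mm> v))"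
    using W(1,2)
  proof (induction W rule: finite_induct)
    case empty
    then show ?case by (auto intro!: exI[of _ 0])
  next
    case (insert w W)
    then obtain Y where Y: "\<And>v c. v \<in> A \<Longrightarrow> c \<in> C1 \<Longrightarrow> Y / c \<in> \<mm> v"
      "\<And>v. v \<in> (S - E) \<inter> \<Union>(N ` W) \<Longrightarrow> Y \<noteq> 0 \<and> (\<forall>c\<in>C1. inverse Y / c \<in> \<mm> v)"
      by (metis (no_types, lifting) insert_subset)
    show ?case
    proof (intro exI[of _ "form (x w) Y"] conjI ballI)
      fix v c assume "v \<in> A" "c \<in> C1"
      then show "form (x w) Y / c \<in> \<mm> v"
        using A Y(1)[of v] x(1)[of w v] insert by (intro form_small) (auto simp: C1_def)
    next
      fix v assume v: "v \<in> (S - E) \<inter> \<Union>(N ` insert w W)"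
      have *: "form (x w) Y \<noteq> 0 \<and> inverse (form (x w) Y) / c \<in> \<mm> v" if "c \<in> C1" for c
      proof (rule form_large)
        have "t \<in> C1" by (simp add: C1_def)
        then show "x w \<noteq> 0 \<and> inverse (x w) / c \<in> \<mm> v \<and> inverse (x w) / t \<in> \<mm> v \<or>
           Y \<noteq> 0 \<and> inverse Y / c \<in> \<mm> v \<and> inverse Y / t \<in> \<mm> v"
          using v Y(2)[of v] x(2)[of w] insert that by (auto simp: N_def)
      qed (use v in auto)
      show "form (x w) Y \<noteq> 0" using *[of t] by (simp add: C1_def)
      show "inverse (form (x w) Y) / c \<in> \<mm> v" if "c \<in> C1" for c using * that by blast
    qed
  qed
  then obtain X where X1: "\<forall>v\<in>A. \<forall>c\<in>C1. X / c \<in> \<mm> v"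
    and X2: "\<forall>v\<in>(S - E) \<inter> \<Union>(N ` W). X \<noteq> 0 \<and> (\<forall>c\<in>C1. inverse X / c \<in> \<mm> v)" by blast
  have X: "X / c \<in> \<mm> v" if "v \<in> A" "c \<in> C1" for v c using X1 that by blast
  have Xl: "X \<noteq> 0 \<and> (\<forall>c\<in>C1. inverse X / c \<in> \<mm> v)" if "v \<in> B - E" for v
    using X2 W(3) B(1) that by blast
  \<comment> \<open>The bound \<open>inverse X\<close> makes \<open>u\<close> dominate
    \<open>X\<close> on \<open>B \<inter> E\<close>, so that \<open>form u X\<close> is large
    there.\<close>
  define C2 where "C2 = (if X = 0 then C1 else insert (inverse X) C1)"
  have C2: "finite C2" "0 \<notin> C2" "C1 \<subseteq> C2" using C1 by (auto simp: C2_def)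
  have sE: "separated A (B \<inter> E)" 
  proof (rule separated_finite[OF _ A])
    show "separated A {w}" if "w \<in> B \<inter> E" for w using that by (intro AB) simp
  qed (use finite_exceptional B in auto)
  then obtain u where u: "\<And>v c. v \<in> A \<Longrightarrow> c \<in> C2 \<Longrightarrow> u / c \<in> \<mm> v" "\<And>v. v \<in> B \<inter> E \<Longrightarrow> u \<noteq> 0"
    "\<And>v c. v \<in> B \<inter> E \<Longrightarrow> c \<in> C2 \<Longrightarrow> inverse u / c \<in> \<mm> v"
    using separatedD[OF sE C2(1,2)] by blast
  show "\<exists>x. (\<forall>v\<in>A. \<forall>c\<in>C. x / c \<in> \<mm> v) \<and> (\<forall>v\<in>B. x \<noteq> 0 \<and> (\<forall>c\<in>C. inverse x / c \<in> \<mm> v))"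
  proof (intro exI[of _ "form u X"] conjI ballI)
    fix v c assume "v \<in> A" "c \<in> C"
    then show "form u X / c \<in> \<mm> v"
      using A X[of v] u(1)[of v] C2(3) by (intro form_small) (auto simp: C1_def)
  next
    fix v assume v: "v \<in> B"
    have *: "form u X \<noteq> 0 \<and> inverse (form u X) / c \<in> \<mm> v" if "c \<in> C1" for c
    proof (cases "v \<in> E")
      case True
      show ?thesis
      proof (rule form_large_if_dominant)
        show "X / u \<in> \<mm> v"
        proof (cases "X = 0")
          case False
          then have "inverse u / inverse X \<in> \<mm> v" using u(3)[of v "inverse X"] True v by (simp add: C2_def)
          then show ?thesis by (simp add: divide_inverse mult.commute)
        qed simp
      qed (use True v u B C2(3) that in \<open>auto simp: C1_def\<close>)
    next
      case False
      then show ?thesis using Xl[of v] v B that by (intro form_large) (auto simp: C1_def)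
    qed
    show "form u X \<noteq> 0" using *[of t] by (simp add: C1_def)
    show "inverse (form u X) / c \<in> \<mm> v" if "c \<in> C" for c using * that by (simp add: C1_def)
  qed
qed

text \<open>Smallness on the empty set is vacuous, so this provides elements that are large
  throughout a compact set. At one locality, nontriviality supplies \<open>s\<close>, and
  \<open>inverse (b * s)\<close> is large.\<close>

lemma separated_empty_left:
  assumes "B \<subseteq> S" "compactin zariski_star B"
  shows "separated {} B"
proof (rule separated_compact)
  fix w assume "w \<in> B"
  then have "w \<noteq> v_trivial" using assms nontrivial by auto
  then obtain s where s: "s \<noteq> 0" "s \<in> \<mm> w" using \<mm>_nontrivial by blast
  show "separated {} {w}"
    unfolding separated_def
  proof (intro allI impI)
    fix C :: "'a set" assume C: "finite C" "0 \<notin> C"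
    obtain b where b: "b \<noteq> 0" "\<And>c. c \<in> C \<Longrightarrow> b / c \<in> \<O> w" using exists_smallest_multiple[OF C] by meson
    have "inverse (inverse (b * s)) / c \<in> \<mm> w" if "c \<in> C" for c
      using \<O>_mult_\<mm>[OF b(2)[OF that] s(2)] by simp
    then show "\<exists>x. (\<forall>v\<in>{}. \<forall>c\<in>C. x / c \<in> \<mm> v) \<and> (\<forall>v\<in>{w}. x \<noteq> 0 \<and> (\<forall>c\<in>C. inverse x / c \<in> \<mm> v))"
      using b(1) s(1) by (intro exI[of _ "inverse (b * s)"]) auto
  qed
qed (use assms in auto)

lemma separated_disjoint_compact:
  assumes A: "A \<subseteq> S" "compactin zariski_star A" and B: "B \<subseteq> S" "compactin zariski_star B" and "A \<inter> B = {}"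
  shows "separated A B"
proof (cases "A = {}")
  case True
  then show ?thesis using separated_empty_left B by simp
next
  case False
  show ?thesis
  proof (rule separated_compact[OF A(1) B])
    fix w assume w: "w \<in> B"
    \<comment> \<open>With \<open>w\<close> fixed, compactness of \<open>A\<close> is used first;
      after the swap, the outer application uses that of \<open>B\<close>.\<close>
    have "separated {w} A"
    proof (rule separated_compact[OF _ A])
      fix v assume v: "v \<in> A"
      have "w \<noteq> v" using v w assms(5) by auto
      then show "separated {w} {v}"
        using v w A(1) B(1) pairwiseD[OF independent, of w v] nontrivial[of v] nontrivial[of w]
        by (intro independent_imp_separated) auto
    qed (use w B in auto)
    then show "separated A {w}" using False by (rule separated_swap)
  qed
qed

lemma exists_small:
  assumes B: "B \<subseteq> S" "compactin zariski_star B" and C: "finite C" "0 \<notin> C"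
  obtains w where "w \<noteq> 0" "\<And>v c. v \<in> B \<Longrightarrow> c \<in> C \<Longrightarrow> w / c \<in> \<mm> v"
proof -
  obtain x where x: "\<And>v. v \<in> B \<Longrightarrow> x \<noteq> 0" "\<And>v c. v \<in> B \<Longrightarrow> c \<in> C \<Longrightarrow> inverse x / c \<in> \<mm> v"
    using separatedD[OF separated_empty_left[OF B] C] by metis
  show ?thesis
  proof (cases "B = {}")
    case True
    \<comment> \<open>For empty \<open>B\<close> the separating element may be 0, so its inverse
      need not be a valid witness.\<close>
    then show ?thesis using that[of 1] by auto
  next
    case False
    then show ?thesis using that[of "inverse x"] x by auto
  qed
qed

section \<open>Approximate idempotents and weak approximation\<close>

lemma exists_idempotent_like:
  assumes A: "A \<subseteq> S" "compactin zariski_star A" and B: "B \<subseteq> S" "compactin zariski_star B" and "A \<inter> B = {}"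
    and c: "c \<noteq> 0"
  obtains e where "\<And>v. v \<in> A \<Longrightarrow> (1 - e) / c \<in> \<mm> v" "\<And>v. v \<in> B \<Longrightarrow> e / c \<in> \<mm> v"
proof -
  have C: "finite {t, t * c}" "0 \<notin> {t, t * c}" using c t_nz by auto
  obtain x where x: "\<And>v d. v \<in> A \<Longrightarrow> d \<in> {t, t * c} \<Longrightarrow> x / d \<in> \<mm> v" "\<And>v. v \<in> B \<Longrightarrow> x \<noteq> 0"
    "\<And>v d. v \<in> B \<Longrightarrow> d \<in> {t, t * c} \<Longrightarrow> inverse x / d \<in> \<mm> v"
    using separatedD[OF separated_disjoint_compact[OF A B assms(5)] C] by metis
  \<comment> \<open>With \<open>e = inverse (1 + x)\<close>, both errors have the form
    \<open>y / (1 + y)\<close>: on \<open>A\<close> it is \<open>1 - e\<close> with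
    \<open>y = x\<close>, on \<open>B\<close> it is \<open>e\<close> with
    \<open>y = inverse x\<close>.\<close>
  have *: "(y / (1 + y)) / c \<in> \<mm> v" "1 + y \<noteq> 0"
    if "v \<in> S" "y / t \<in> \<mm> v" "y / (t * c) \<in> \<mm> v" for v y
  proof -
    note o = one_plus_small[OF that(1,2)]
    show "1 + y \<noteq> 0" by (rule o)
    have "t / (1 + y) * (y / (t * c)) \<in> \<mm> v" using o(2) that(3) by (rule \<O>_mult_\<mm>)
    then show "(y / (1 + y)) / c \<in> \<mm> v" using t_nz by (simp add: mult.commute)
  qed
  show ?thesis
  proof (rule that[of "inverse (1 + x)"])
    fix v assume v: "v \<in> A"
    have "(x / (1 + x)) / c \<in> \<mm> v" "1 + x \<noteq> 0" using *[of v x] v A x(1)[OF v] by auto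
    moreover have "1 - inverse (1 + x) = x / (1 + x)" using \<open>1 + x \<noteq> 0\<close> by (simp add: field_simps)
    ultimately show "(1 - inverse (1 + x)) / c \<in> \<mm> v" by simp
  next
    fix v assume v: "v \<in> B"
    have "(inverse x / (1 + inverse x)) / c \<in> \<mm> v" "1 + inverse x \<noteq> 0"
      using *[of v "inverse x"] v B x(3)[OF v] by auto
    moreover have "inverse x / (1 + inverse x) = inverse (1 + x)"
      using x(2)[OF v] \<open>1 + inverse x \<noteq> 0\<close> by (simp add: divide_inverse flip: inverse_mult_distrib) (simp add: algebra_simps)
    ultimately show "inverse (1 + x) / c \<in> \<mm> v" by simp
  qed
qed

text \<open>Newton-style interpolation: the approximation on the old pieces is corrected by
  \<open>e * (\<xi> i - x)\<close>, which is nearly 0 on them and nearly the full difference on the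
  new piece.\<close>

lemma weak_approximation:
  assumes "finite I" and "\<And>i. i \<in> I \<Longrightarrow> P i \<subseteq> S" "\<And>i. i \<in> I \<Longrightarrow> compactin zariski_star (P i)"
    and "disjoint_family_on P I" and "c \<noteq> 0"
  shows "\<exists>x. \<forall>i\<in>I. \<forall>v\<in>P i. (x - \<xi> i) / c \<in> \<mm> v"
  using assms
proof (induction I arbitrary: c rule: finite_induct)
  case empty
  then show ?case by simp
next
  case (insert i I)
  have "disjoint_family_on P I" using insert by (auto simp: disjoint_family_on_def)
  then have "\<exists>x. \<forall>j\<in>I. \<forall>v\<in>P j. (x - \<xi> j) / (t * c) \<in> \<mm> v"
    using insert.prems t_nz by (intro insert.IH) auto
  then obtain x where x: "\<And>j v. j \<in> I \<Longrightarrow> v \<in> P j \<Longrightarrow> (x - \<xi> j) / (t * c) \<in> \<mm> v" by blast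
  \<comment> \<open>Accuracy \<open>d\<close> for \<open>e\<close> brings the errors of
    \<open>e * (\<xi> i - x)\<close> below \<open>t * c\<close>. If \<open>\<xi> i = x\<close> there
    is nothing to correct, and 1 serves as a nonzero value.\<close>
  define d where "d = (if \<xi> i = x then 1 else t * c / (\<xi> i - x))"
  have d: "d \<noteq> 0" using insert.prems t_nz by (simp add: d_def)
  have "compactin zariski_star (\<Union>j\<in>I. P j)" using insert by (intro compactin_Union) auto
  moreover have "P i \<inter> (\<Union>j\<in>I. P j) = {}" using insert by (auto simp: disjoint_family_on_def)
  ultimately obtain e where e: "\<And>v. v \<in> P i \<Longrightarrow> (1 - e) / d \<in> \<mm> v" "\<And>v. v \<in> (\<Union>j\<in>I. P j) \<Longrightarrow> e / d \<in> \<mm> v"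
    using exists_idempotent_like[of "P i" "\<Union>j\<in>I. P j" d] insert.prems d by (metis UN_least insertCI)
  have scale: "a * (\<xi> i - x) / (t * c) \<in> \<mm> v" if "a / d \<in> \<mm> v" for a v
    using that by (cases "\<xi> i = x") (auto simp: d_def)
  show ?case
  proof (intro exI[of _ "x + e * (\<xi> i - x)"] ballI)
    fix j v assume j: "j \<in> insert i I" and v: "v \<in> P j"
    then have vS: "v \<in> S" using insert.prems by blast
    show "(x + e * (\<xi> i - x) - \<xi> j) / c \<in> \<mm> v"
    proof (cases "j = i")
      case True
      have "- ((1 - e) * (\<xi> i - x) / (t * c)) \<in> \<mm> v" using scale e(1) v True by (simp only: \<mm>_uminus_iff)
      moreover have "t * - ((1 - e) * (\<xi> i - x) / (t * c)) = (x + e * (\<xi> i - x) - \<xi> i) / c"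
        using t_nz insert.prems(4) by (simp add: field_simps)
      ultimately show ?thesis using \<O>_mult_\<mm>[OF t_in_\<O>[OF vS]] True by metis
    next
      case False
      then have "j \<in> I" using j by simp
      moreover have "e * (\<xi> i - x) / (t * c) \<in> \<mm> v"
        using v \<open>j \<in> I\<close> by (intro scale e(2)) blast
      ultimately have "((x - \<xi> j) + e * (\<xi> i - x)) / c \<in> \<mm> v"
        using x v vS insert.prems by (intro add_\<mm>_div) auto
      then show ?thesis by (simp add: algebra_simps)
    qed
  qed
qed

end


section \<open>Openness of the unit ball\<close>

lemma absolute_valueD:
  assumes "absolute_value a"
  shows "0 \<le> a x" "a x = 0 \<longleftrightarrow> x = 0" "a (x * y) = a x * a y" "a (x + y) \<le> a x + a y"
    "a 0 = 0" "a 1 = 1" "a (- x) = a x" "a (x ^ n) = a x ^ n" "a (of_nat n) \<le> n"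
    "a (of_int i) \<le> \<bar>i\<bar>"
proof -
  show nn: "0 \<le> a x" "a x = 0 \<longleftrightarrow> x = 0" "a (x * y) = a x * a y" "a (x + y) \<le> a x + a y" for x y
    using assms by (simp_all add: absolute_value_def)
  show a0: "a 0 = 0" using nn(2) by simp
  show a1: "a 1 = 1" using nn(2)[of 1] nn(3)[of 1 1] by simp
  have "a (- 1) * a (- 1) = 1" using nn(3)[of "- 1" "- 1"] a1 by simp
  then have "a (- 1) = 1" using nn(1)[of "- 1"] by (metis abs_of_nonneg abs_mult_self_eq abs_one real_sqrt_abs2 real_sqrt_one)
  then show um: "a (- x) = a x" for x using nn(3)[of "- 1" x] by simp
  show "a (x ^ n) = a x ^ n" by (induction n) (simp_all add: a1 nn(3))
  show ofn: "a (of_nat n) \<le> n" for n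
  proof (induction n)
    case (Suc n)
    then show ?case using nn(4)[of 1 "of_nat n"] a1 by simp
  qed (simp add: a0)
  show "a (of_int i) \<le> \<bar>i\<bar>"
    using ofn[of "nat \<bar>i\<bar>"] um[of "of_int i"] by (cases "i \<ge> 0") auto
qed

lemma absolute_value_sum:
  assumes "absolute_value a"
  shows "a (\<Sum>i\<in>I. h i) \<le> (\<Sum>i\<in>I. a (h i))"
proof (induction I rule: infinite_finite_induct)
  case (insert i I)
  then show ?case using absolute_valueD(4)[OF assms, of "h i" "sum h I"] by simp
qed (simp_all add: absolute_valueD[OF assms])

text \<open>Taking \<open>N\<close>-th roots removes the polynomial factor.\<close>

lemma le_if_powers_le:
  fixes q r :: real
  assumes q: "0 \<le> q" and r: "0 \<le> r" and le: "\<And>N. q ^ N \<le> (real N + 1) ^ 2 * r ^ N"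
  shows "q \<le> r"
proof (rule ccontr)
  assume "\<not> q \<le> r"
  then have rq: "r < q" by simp
  then have "r \<noteq> 0" using le[of 1] r by auto
  \<comment> \<open>The square root matches the square in the factor, so that the contradiction
    comes from \<open>n * x ^ n\<close> tending to 0.\<close>
  define x where "x = sqrt (r / q)"
  have x: "0 < x" "x < 1" using rq r \<open>r \<noteq> 0\<close> by (auto simp: x_def)
  have b: "x \<le> real (Suc N) * x ^ Suc N" for N
  proof -
    have "1 \<le> (real N + 1) ^ 2 * (r / q) ^ N"
      using le[of N] rq r by (simp add: power_divide field_simps)
    also have "\<dots> = ((real N + 1) * x ^ N) ^ 2"
      using r q by (simp add: x_def power_mult_distrib flip: power_mult power_even_eq)
        (simp add: mult.commute[of _ 2] power_mult)
    finally have "1 \<le> (real N + 1) * x ^ N"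
      using power2_le_imp_le[of 1 "(real N + 1) * x ^ N"] x by simp
    then show ?thesis using x mult_right_mono[of 1 "(real N + 1) * x ^ N" x] by (simp add: ac_simps)
  qed
  have "(\<lambda>n. real n * x ^ n) \<longlonglongrightarrow> 0"
    using powser_times_n_limit_0[of x] x by simp
  then have "(\<lambda>n. real (Suc n) * x ^ Suc n) \<longlonglongrightarrow> 0" by (rule LIMSEQ_Suc)
  then have "x \<le> 0" by (rule LIMSEQ_le_const) (use b in auto)
  then show False using x by simp
qed

text \<open>Horner's scheme in base 2, each digit having absolute value at most 1. For
  \<open>k = 0\<close> the truncated exponent is harmless, the factor \<open>real k\<close> being
  0.\<close>

lemma absolute_value_of_nat_digits:
  assumes a: "absolute_value a" and A: "1 \<le> A" "a 2 \<le> A"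
  shows "n < 2 ^ k \<Longrightarrow> a (of_nat n) \<le> real k * A ^ (k - 1)"
proof (induction k arbitrary: n)
  case 0
  then show ?case by (simp add: absolute_valueD[OF a])
next
  case (Suc k)
  note D = absolute_valueD[OF a]
  have "a (of_nat n) = a (2 * of_nat (n div 2) + of_nat (n mod 2))"
    by (metis mult_div_mod_eq of_nat_add of_nat_mult of_nat_numeral)
  also have "\<dots> \<le> a 2 * a (of_nat (n div 2)) + a (of_nat (n mod 2))"
    using D(4)[of "2 * of_nat (n div 2)"] by (simp add: D(3))
  also have "\<dots> \<le> A * (real k * A ^ (k - 1)) + 1"
  proof (intro add_mono mult_mono)
    show "a (of_nat (n div 2)) \<le> real k * A ^ (k - 1)" by (rule Suc.IH) (use Suc.prems in auto)
    have "real (n mod 2) \<le> 1" by linarith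
    then show "a (of_nat (n mod 2)) \<le> 1" using D(9)[of "n mod 2"] by linarith
  qed (use A D in auto)
  also have "A * (real k * A ^ (k - 1)) = real k * A ^ k" by (cases k) auto
  also have "real k * A ^ k + 1 \<le> real (Suc k) * A ^ k" using one_le_power[OF A(1), of k] by (simp add: algebra_simps)
  finally show ?case by simp
qed

text \<open>If \<open>n\<close> has \<open>k + 1\<close> binary digits, then
  \<open>2 ^ k \<le> n\<close> turns the digit bound into a power of \<open>n\<close>. The factor
  depends on \<open>N\<close> only, hence is common to all binomial coefficients of order
  \<open>N\<close>.\<close>

lemma absolute_value_of_nat_le:
  assumes a: "absolute_value a" and s: "0 \<le> s" "a 2 \<le> 2 powr s" and n: "1 \<le> n" "n \<le> 2 ^ N"
  shows "a (of_nat n) \<le> (real N + 1) * real n powr s"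
proof -
  obtain k where k: "2 ^ k \<le> n" "n < 2 ^ (k + 1)" using ex_power_ivl1[of 2 n] n by auto
  have "k \<le> N" using k n by (meson le_trans one_less_numeral_iff power_increasing_iff semiring_norm(76))
  have "a (of_nat n) \<le> real (k + 1) * (2 powr s) ^ (k + 1 - 1)"
    by (rule absolute_value_of_nat_digits[OF a _ s(2) k(2)]) (use s in \<open>simp add: ge_one_powr_ge_zero\<close>)
  also have "(2 powr s) ^ (k + 1 - 1) = (2 ^ k) powr s"
    by (simp add: powr_powr flip: powr_realpow) (simp add: mult.commute)
  also have "real (k + 1) * (2 ^ k) powr s \<le> (real N + 1) * real n powr s"
  proof (intro mult_mono powr_mono2 s)
    show "2 ^ k \<le> real n" using k(1) by (metis of_nat_le_iff of_nat_numeral of_nat_power)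
  qed (use \<open>k \<le> N\<close> in auto)
  finally show ?thesis .
qed

text \<open>Expand \<open>(x + y) ^ N\<close>: there are \<open>N + 1\<close> terms, each
  coefficient costs another factor \<open>N + 1\<close>, and these factors disappear on taking
  roots. The case \<open>s = 0\<close> gives the ultrametric inequality, the case
  \<open>2 powr s = a 2\<close> the normalisation.\<close>

lemma absolute_value_add_le:
  assumes a: "absolute_value a" and s: "0 \<le> s" "a 2 \<le> 2 powr s" and R: "0 \<le> R"
    and bd: "\<And>N j. j \<le> N \<Longrightarrow> real (N choose j) powr s * (a x ^ j * a y ^ (N - j)) \<le> R ^ N"
  shows "a (x + y) \<le> R"
proof (rule le_if_powers_le)
  note D = absolute_valueD[OF a]
  fix N
  have "a (x + y) ^ N = a (\<Sum>j\<le>N. of_nat (N choose j) * x ^ j * y ^ (N - j))"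
    by (simp add: D(8)[symmetric] binomial_ring)
  also have "\<dots> \<le> (\<Sum>j\<le>N. a (of_nat (N choose j) * x ^ j * y ^ (N - j)))"
    by (rule absolute_value_sum[OF a])
  also have "\<dots> \<le> (\<Sum>j\<le>N. (real N + 1) * R ^ N)"
  proof (rule sum_mono)
    fix j assume j: "j \<in> {..N}"
    have "a (of_nat (N choose j) * x ^ j * y ^ (N - j)) = a (of_nat (N choose j)) * (a x ^ j * a y ^ (N - j))"
      by (simp add: D)
    also have "\<dots> \<le> (real N + 1) * real (N choose j) powr s * (a x ^ j * a y ^ (N - j))"
      using j by (intro mult_right_mono absolute_value_of_nat_le[OF a s]) (auto simp: D binomial_le_pow2 Suc_le_eq)
    also have "\<dots> \<le> (real N + 1) * R ^ N" using bd[of j N] j by (simp add: mult.assoc)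
    finally show "a (of_nat (N choose j) * x ^ j * y ^ (N - j)) \<le> (real N + 1) * R ^ N" .
  qed
  also have "\<dots> = (real N + 1) ^ 2 * R ^ N" by (simp add: power2_eq_square algebra_simps)
  finally show "a (x + y) ^ N \<le> (real N + 1) ^ 2 * R ^ N" .
qed (use R absolute_valueD[OF a] in auto)

lemma absolute_value_ultrametric:
  assumes a: "absolute_value a" and "a 2 \<le> 1"
  shows "a (x + y) \<le> max (a x) (a y)"
proof (rule absolute_value_add_le[OF a, of 0])
  note D = absolute_valueD[OF a]
  fix N j :: nat assume j: "j \<le> N"
  have "a x ^ j * a y ^ (N - j) \<le> max (a x) (a y) ^ j * max (a x) (a y) ^ (N - j)"
    by (intro mult_mono power_mono zero_le_power) (auto simp: D le_max_iff_disj)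
  also have "\<dots> = max (a x) (a y) ^ N" using j by (simp flip: power_add)
  finally show "real (N choose j) powr 0 * (a x ^ j * a y ^ (N - j)) \<le> max (a x) (a y) ^ N"
    using j by simp
qed (use assms absolute_valueD[OF a] in \<open>auto simp: le_max_iff_disj\<close>)

lemma power_powr_nonneg: "0 \<le> (u :: real) \<Longrightarrow> (u ^ j) powr s = (u powr s) ^ j"
  by (induction j) (simp_all add: powr_mult)

text \<open>The exponent \<open>1 / s\<close> is at least 1, so the triangle inequality needs an
  argument: each term of the expansion of \<open>(b x + b y) ^ N\<close> is at most the whole, and
  the \<open>s\<close>-th power of this is the hypothesis of
  \<open>absolute_value_add_le\<close>.\<close>

lemma absolute_value_normalise:
  assumes a: "absolute_value a" and a2: "1 < a 2"
  obtains b where "absolute_value b" "b 2 = 2" "\<And>x. b x \<le> 1 \<longleftrightarrow> a x \<le> 1" "\<And>x. b x < 1 \<longleftrightarrow> a x < 1"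
proof -
  note D = absolute_valueD[OF a]
  define s where "s = log 2 (a 2)"
  have s: "s > 0" "2 powr s = a 2" using a2 by (simp_all add: s_def)
  define b where "b x = a x powr (1 / s)" for x
  have ab: "a x = b x powr s" for x using s(1) D(1) by (simp add: b_def powr_powr)
  have b0: "0 \<le> b x" for x by (simp add: b_def)
  have "b (x + y) \<le> b x + b y" for x y
  proof -
    have "a (x + y) \<le> (b x + b y) powr s"
    proof (rule absolute_value_add_le[OF a less_imp_le[OF s(1)]])
      fix N j :: nat assume j: "j \<le> N"
      have "real (N choose j) powr s * (a x ^ j * a y ^ (N - j)) = (real (N choose j) * (b x ^ j * b y ^ (N - j))) powr s"
        by (simp add: powr_mult b0 power_powr_nonneg ab)
      also have "\<dots> \<le> ((b x + b y) ^ N) powr s"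
      proof (rule powr_mono2)
        have "real (N choose j) * (b x ^ j * b y ^ (N - j)) \<le> (\<Sum>j\<le>N. real (N choose j) * b x ^ j * b y ^ (N - j))"
          using j member_le_sum[of j "{..N}" "\<lambda>j. real (N choose j) * b x ^ j * b y ^ (N - j)"] b0
          by (simp add: mult.assoc)
        then show "real (N choose j) * (b x ^ j * b y ^ (N - j)) \<le> (b x + b y) ^ N" by (simp add: binomial_ring)
      qed (use s b0 in auto)
      also have "\<dots> = ((b x + b y) powr s) ^ N" by (simp add: power_powr_nonneg b0)
      finally show "real (N choose j) powr s * (a x ^ j * a y ^ (N - j)) \<le> ((b x + b y) powr s) ^ N" .
    qed (use s in auto)
    then have "b (x + y) \<le> ((b x + b y) powr s) powr (1 / s)"
      unfolding b_def[of "x + y"] using s(1) D(1) by (intro powr_mono2) auto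
    then show ?thesis using s(1) b0[of x] b0[of y] by (simp add: powr_powr)
  qed
  then have "absolute_value b"
    unfolding absolute_value_def using b0 by (simp add: b_def D powr_mult)
  moreover have "b 2 = 2" by (simp add: b_def powr_powr s(1) less_imp_neq[symmetric] flip: s(2))
  moreover have "b x \<le> 1 \<longleftrightarrow> a x \<le> 1" "b x < 1 \<longleftrightarrow> a x < 1" for x
    using powr_mono2[of s "b x" 1] powr_less_mono2[of s "b x" 1] powr_mono2[of s 1 "b x"]
      powr_less_mono2[of s 1 "b x"] s(1) b0[of x] unfolding ab by (fastforce simp: not_le not_less)+
  ultimately show ?thesis by (rule that)
qed

section \<open>Central binomial coefficients and the expansion of
  \<open>(x + y) ^ N * (x - y)\<close>\<close>

lemma central_binomial_bound: "real ((2 * M) choose M) ^ 2 * (2 * real M + 1) \<le> 16 ^ M"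
proof (induction M)
  case (Suc M)
  define c where "c = real ((2 * M) choose M)"
  have "real (Suc M) * real ((2 * Suc M) choose Suc M) = 2 * (2 * real M + 1) * c"
  proof -
    have "((2 * Suc M) choose Suc M) * Suc M = 2 * (Suc (2 * M) choose M) * Suc M"
      using Suc_times_binomial_eq[of "Suc (2 * M)" M] by (simp del: binomial_Suc_Suc add: algebra_simps)
    then have 1: "((2 * Suc M) choose Suc M) = 2 * (Suc (2 * M) choose M)"
      by (simp only: mult_cancel2) simp
    have "Suc M * (Suc (2 * M) choose Suc M) = Suc (2 * M) * ((2 * M) choose M)"
      using Suc_times_binomial_eq[of "2 * M" M] by (simp add: mult.commute)
    moreover have "Suc (2 * M) choose Suc M = Suc (2 * M) choose M"
      using binomial_symmetric[of "Suc M" "Suc (2 * M)"] by simp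
    ultimately have "Suc M * (Suc (2 * M) choose M) = Suc (2 * M) * ((2 * M) choose M)" by metis
    then have "Suc M * ((2 * Suc M) choose Suc M) = 2 * (Suc (2 * M) * ((2 * M) choose M))"
      unfolding 1 by (metis mult.left_commute)
    then have "real (Suc M * ((2 * Suc M) choose Suc M)) = real (2 * (Suc (2 * M) * ((2 * M) choose M)))"
      by (rule arg_cong)
    then show ?thesis unfolding c_def of_nat_mult by (simp add: algebra_simps del: binomial_Suc_Suc)
  qed
  then have e: "real ((2 * Suc M) choose Suc M) = 2 * (2 * real M + 1) * c / (real M + 1)"
    by (simp add: field_simps)
  have "real ((2 * Suc M) choose Suc M) ^ 2 * (2 * real (Suc M) + 1) =
    (c ^ 2 * (2 * real M + 1)) * (4 * ((2 * real M + 1) * (2 * real M + 3)) / (real M + 1) ^ 2)"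
    unfolding e by (simp add: power2_eq_square field_simps)
  \<comment> \<open>The ratio of consecutive left-hand sides is at most 16 because
    \<open>(2 * M + 1) * (2 * M + 3) \<le> (2 * M + 2) ^ 2\<close>.\<close>
  also have "\<dots> \<le> 16 ^ M * 16"
  proof (rule mult_mono)
    show "4 * ((2 * real M + 1) * (2 * real M + 3)) / (real M + 1) ^ 2 \<le> 16"
    proof -
      have "0 < (real M + 1) ^ 2" by simp
      then show ?thesis by (subst pos_divide_le_eq) (simp_all add: power2_eq_square algebra_simps)
    qed
  qed (use Suc in \<open>auto simp: c_def\<close>)
  finally show ?case by simp
qed simp

text \<open>The coefficient of \<open>x ^ k * y ^ (N + 1 - k)\<close> in
  \<open>(x + y) ^ N * (x - y)\<close>. The case \<open>k = 0\<close> is separate since truncated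
  \<open>k - 1\<close> would contribute 1 there.\<close>

definition skew_binomial :: "nat \<Rightarrow> nat \<Rightarrow> int" where
  "skew_binomial N k = (if k = 0 then 0 else int (N choose (k - 1))) - int (N choose k)"

lemma skew_binomial_ring:
  fixes x y :: "'a::comm_ring_1"
  shows "(x + y) ^ N * (x - y) = (\<Sum>k\<le>Suc N. of_int (skew_binomial N k) * (x ^ k * y ^ (Suc N - k)))"
proof -
  have "(x + y) ^ N * x = (\<Sum>k\<le>N. of_nat (N choose k) * x ^ Suc k * y ^ (N - k))"
    unfolding binomial_ring sum_distrib_right by (rule sum.cong) (auto simp: ac_simps)
  also have "\<dots> = (\<Sum>k\<le>Suc N. of_int (if k = 0 then 0 else int (N choose (k - 1))) * (x ^ k * y ^ (Suc N - k)))"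
    by (subst sum.atMost_Suc_shift) (simp add: mult.assoc)
  finally have 1: "(x + y) ^ N * x = \<dots>" .
  have "(x + y) ^ N * y = (\<Sum>k\<le>N. of_nat (N choose k) * (x ^ k * y ^ (Suc N - k)))"
    unfolding binomial_ring sum_distrib_right by (rule sum.cong) (auto simp: Suc_diff_le ac_simps)
  then have 2: "(x + y) ^ N * y = (\<Sum>k\<le>Suc N. of_int (int (N choose k)) * (x ^ k * y ^ (Suc N - k)))"
    by (simp add: binomial_eq_0)
  show ?thesis
    unfolding right_diff_distrib 1 2 skew_binomial_def of_int_diff left_diff_distrib sum_subtractf ..
qed

text \<open>The coefficients are differences of neighbouring binomial coefficients, which rise up to
  the middle and then fall to 0; the sum is their total variation, twice the peak.\<close>

lemma sum_abs_skew_binomial: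
  "(\<Sum>k\<le>Suc (2 * M). \<bar>skew_binomial (2 * M) k\<bar>) = 2 * int ((2 * M) choose M)"
proof -
  have low: "(\<Sum>k\<le>m. \<bar>skew_binomial (2 * M) k\<bar>) = int ((2 * M) choose m)" if "m \<le> M" for m
    using that
  proof (induction m)
    case (Suc m)
    have "(2 * M) choose m \<le> (2 * M) choose (Suc m)" by (rule binomial_mono) (use Suc in auto)
    then show ?case using Suc by (simp add: skew_binomial_def)
  qed (simp add: skew_binomial_def)
  have "(\<Sum>k\<le>M + m. \<bar>skew_binomial (2 * M) k\<bar>) = 2 * int ((2 * M) choose M) - int ((2 * M) choose (M + m))" for m
  proof (induction m)
    case 0
    then show ?case using low[of M] by simp
  next
    case (Suc m)
    have "(2 * M) choose (Suc (M + m)) \<le> (2 * M) choose (M + m)"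
      by (cases "Suc (M + m) \<le> 2 * M") (auto intro: binomial_antimono simp: binomial_eq_0)
    then show ?case using Suc by (simp add: skew_binomial_def)
  qed
  moreover have "M + Suc M = Suc (2 * M)" by simp
  moreover have "(2 * M) choose Suc (2 * M) = 0" by (simp add: binomial_eq_0)
  ultimately show ?thesis by (metis diff_zero of_nat_0)
qed

text \<open>Over the real or complex numbers this follows from the parallelogram law. Here, write
  \<open>2 b = P + Q\<close> and \<open>2 z = P - Q\<close> with \<open>a P, a Q \<le> 1\<close>: the coefficients of
  \<open>(P + Q) ^ (2 M) * (P - Q)\<close> have absolute sum only \<open>2 * ((2 M) choose M)\<close>, of order \<open>4 ^ M / sqrt M\<close>,
  which bounds \<open>a b ^ (2 M) * a z\<close> by \<open>1 / sqrt M\<close>; then take \<open>M\<close> about \<open>1 / (8 (1 - a b))\<close>.\<close>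

lemma absolute_value_midpoint:
  assumes a: "absolute_value a" and a2: "a 2 = 2" and P: "a (b + z) \<le> 1" and Q: "a (b - z) \<le> 1" and b: "a b < 1"
  shows "(a z) ^ 2 \<le> 16 * (1 - a b)"
proof -
  note D = absolute_valueD[OF a]
  have key: "(2 * real M + 1) * (a b ^ (4 * M) * a z ^ 2) \<le> 1" for M
  proof -
    define P Q where "P = b + z" and "Q = b - z"
    have "(2 :: 'a) ^ (2 * M + 1) * (b ^ (2 * M) * z) = (P + Q) ^ (2 * M) * (P - Q)"
      by (simp add: P_def Q_def power_mult_distrib flip: mult_2)
    then have "2 ^ (2 * M + 1) * (a b ^ (2 * M) * a z) = a ((P + Q) ^ (2 * M) * (P - Q))"
      using D(3,8) a2 by metis
    also have "\<dots> \<le> (\<Sum>k\<le>Suc (2 * M). a (of_int (skew_binomial (2 * M) k) * (P ^ k * Q ^ (Suc (2 * M) - k))))"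
      unfolding skew_binomial_ring by (rule absolute_value_sum[OF a])
    also have "\<dots> \<le> (\<Sum>k\<le>Suc (2 * M). real_of_int \<bar>skew_binomial (2 * M) k\<bar>)"
    proof (rule sum_mono)
      fix k
      have "a P ^ k * a Q ^ (Suc (2 * M) - k) \<le> 1 * 1"
        using assms by (intro mult_mono power_le_one) (auto simp: D P_def Q_def)
      then have "a (of_int (skew_binomial (2 * M) k)) * (a P ^ k * a Q ^ (Suc (2 * M) - k)) \<le>
        real_of_int \<bar>skew_binomial (2 * M) k\<bar> * 1"
        using D(10)[of "skew_binomial (2 * M) k"] by (intro mult_mono) (auto simp: D)
      then show "a (of_int (skew_binomial (2 * M) k) * (P ^ k * Q ^ (Suc (2 * M) - k))) \<le>
        real_of_int \<bar>skew_binomial (2 * M) k\<bar>" by (simp only: D(3,8) mult_1_right)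
    qed
    also have "\<dots> = 2 * real ((2 * M) choose M)"
      using sum_abs_skew_binomial[of M] by (metis of_int_mult of_int_numeral of_int_of_nat_eq of_int_sum)
    finally have le: "4 ^ M * (a b ^ (2 * M) * a z) \<le> real ((2 * M) choose M)"
      by (simp add: power_mult)
    have "16 ^ M * ((2 * real M + 1) * (a b ^ (4 * M) * a z ^ 2)) = (4 ^ M * (a b ^ (2 * M) * a z)) ^ 2 * (2 * real M + 1)"
    proof -
      have "(4 ^ M) ^ 2 = ((4 :: real) ^ 2) ^ M" by (simp only: power_mult[symmetric] mult.commute)
      then have "(4 ^ M) ^ 2 = (16 :: real) ^ M" by simp
      moreover have "(a b ^ (2 * M)) ^ 2 = a b ^ (4 * M)" by (simp flip: power_mult)
      ultimately show ?thesis by (simp add: power_mult_distrib ac_simps)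
    qed
    also have "\<dots> \<le> real ((2 * M) choose M) ^ 2 * (2 * real M + 1)"
      using le D(1) by (intro mult_right_mono power_mono) auto
    also have "\<dots> \<le> 16 ^ M" by (rule central_binomial_bound)
    finally show ?thesis by simp
  qed
  define \<delta> where "\<delta> = 1 - a b"
  have \<delta>: "0 < \<delta>" "\<delta> \<le> 1" using b D(1)[of b] by (simp_all add: \<delta>_def)
  \<comment> \<open>This gives \<open>4 * M * \<delta> \<le> 1 / 2\<close>, so that Bernoulli's
    inequality keeps \<open>(1 - \<delta>) ^ (4 * M)\<close> at least 1 / 2, while
    \<open>M + 1\<close> is still at least \<open>1 / (8 * \<delta>)\<close>.\<close>
  define M where "M = nat \<lfloor>1 / (8 * \<delta>)\<rfloor>"
  have M: "real M \<le> 1 / (8 * \<delta>)" "1 / (8 * \<delta>) \<le> real M + 1" using \<delta> by (simp_all add: M_def)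
  have "1 / 2 \<le> 1 - real (4 * M) * \<delta>" using M(1) \<delta> by (simp add: field_simps)
  also have "\<dots> \<le> (1 - \<delta>) ^ (4 * M)" using Bernoulli_inequality[of "- \<delta>" "4 * M"] \<delta> by simp
  finally have h: "1 / 2 \<le> a b ^ (4 * M)" by (simp add: \<delta>_def)
  have "1 / (8 * \<delta>) * (1 / 2 * a z ^ 2) \<le> (2 * real M + 1) * (a b ^ (4 * M) * a z ^ 2)"
    using M(2) h \<delta> by (intro mult_mono) auto
  also note key
  finally show ?thesis using \<delta> by (simp add: field_simps \<delta>_def)
qed

section \<open>Interior points of the unit ball at a single locality\<close>

lemma absolute_value_interior:
  assumes a: "absolute_value a" and a2: "a 2 = 2" and P: "a (b + z) \<le> 1" and Q: "a (b - z) \<le> 1" and b: "a b < 1"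
    and y: "a y < 1"
  shows "a (b + z ^ 2 / 16 * y) < 1"
proof -
  note D = absolute_valueD[OF a]
  \<comment> \<open>Since 16 is \<open>2 ^ 4\<close> and \<open>a 2 = 2\<close>, division by 16
    cancels the constant in \<open>absolute_value_midpoint\<close>.\<close>
  have "a ((2 :: 'a) ^ 4) = 16" unfolding D(8) a2 by simp
  moreover have "(2 :: 'a) ^ 4 = 16" by simp
  ultimately have "a 16 = 16" by metis
  have "(16 :: 'a) \<noteq> 0" using \<open>a 16 = 16\<close> D(5) by auto
  then have "a (z ^ 2 / 16) * a 16 = a z ^ 2" by (simp flip: D(3,8))
  then have z: "a (z ^ 2 / 16) \<le> 1 - a b" using absolute_value_midpoint[OF assms(1-5)] \<open>a 16 = 16\<close> by simp
  have "a (b + z ^ 2 / 16 * y) \<le> a b + a (z ^ 2 / 16) * a y" using D(3,4) by metis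
  also have "\<dots> \<le> a b + (1 - a b) * a y" using z D(1) by (intro add_left_mono mult_right_mono) auto
  also have "\<dots> < a b + (1 - a b) * 1" using y b by (intro add_strict_left_mono mult_strict_left_mono) auto
  finally show ?thesis by simp
qed

text \<open>No ordering has 2 in its unit ball, and absolute values with this property are
  ultrametric.\<close>

lemma add_\<mm>_if_two_in_\<O>:
  assumes two: "2 \<in> \<O> v" and x: "x \<in> \<mm> v" and y: "y \<in> \<mm> v"
  shows "x + y \<in> \<mm> v"
proof -
  obtain p where p: "wf_prelocality p" "\<O> v = pre_O p" "\<mm> v = pre_m p" by (rule locality_obtain)
  show ?thesis
  proof (cases p)
    case (Valuation G r w)
    then have K: "krull_valuation G r w" using p(1) by simp
    have ring: "a + b \<in> \<O> v" if "a \<in> \<O> v" "b \<in> \<O> v" for a b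
    proof -
      have o: "ordered_abelian_group G r" using K by (simp add: krull_valuation_def)
      have tr: "le_inf r (Some \<one>\<^bsub>G\<^esub>) d" if "le_inf r (Some \<one>\<^bsub>G\<^esub>) c" "le_inf r c d" for c d
        using that by (cases c; cases d; simp) (blast intro: ordered_abelian_groupD(3)[OF o])
      have "le_inf r (w a) (w (a + b)) \<or> le_inf r (w b) (w (a + b))"
        using K unfolding krull_valuation_def by blast
      then show ?thesis using that tr unfolding p(2) Valuation by (auto simp: valuation_ring_def)
    qed
    have *: "x + y \<in> \<mm> v" if "x \<in> \<mm> v" "x \<noteq> 0" "y / x \<in> \<O> v" for x y
    proof -
      have "(1 + y / x) * x \<in> \<mm> v" using ring[OF one_in_\<O> that(3)] that(1) by (rule \<O>_mult_\<mm>)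
      moreover have "(1 + y / x) * x = x + y" using that(2) by (simp add: distrib_right)
      ultimately show ?thesis by simp
    qed
    show ?thesis
    proof (cases "x = 0 \<or> y = 0")
      case True
      then show ?thesis using x y by auto
    next
      case False
      then show ?thesis
        using *[OF x, of y] *[OF y, of x] inverse_in_\<mm>[of "y / x" v]
        by (cases "y / x \<in> \<O> v") (auto simp: add.commute \<mm>_imp_\<O>)
    qed
  next
    case (Ordering r)
    have r: "field_ordering r" using p(1) Ordering by simp
    note D = field_orderingD[OF r]
    have o: "(0, 1) \<in> r" using D(8)[of 1] D(6)[of "- 1" "- 1"] by auto
    have "(2, 1) \<in> r" using two by (simp add: p Ordering)
    then have "(0, 1 - 2) \<in> r" using D(5) by blast
    then show ?thesis using D(9)[of 1] o by simp
  next
    case (Absolute_Value a)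
    then have a: "absolute_value a" and "a 2 \<le> 1" using p two by auto
    then show ?thesis using absolute_value_ultrametric[of a x y] x y by (simp add: p Absolute_Value)
  qed
qed

lemma ordering_halve:
  assumes r: "field_ordering r" and two: "2 \<noteq> (0 :: 'a::field)" and x: "(0, x + x :: 'a) \<in> r"
  shows "(0, x) \<in> r"
proof (rule ccontr)
  note D = field_orderingD[OF r]
  assume n: "(0, x) \<notin> r"
  then have "(0, - x) \<in> r" using D(8) by blast
  from D(7)[OF this this] have "(0, - (x + x)) \<in> r" by simp
  then have "x + x = 0" using D(9) x by blast
  then have "2 * x = 0" by (simp only: mult_2)
  then have "x = 0" using two by simp
  then show False using n D(1) by simp
qed

lemma two_notin_\<O>_imp_not_valuation:
  assumes "2 \<notin> \<O> v" "\<O> v = pre_O (Valuation G r w)"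
  shows "\<not> krull_valuation G r w"
proof
  assume K: "krull_valuation G r w"
  have o: "ordered_abelian_group G r" using K by (simp add: krull_valuation_def)
  have "le_inf r (w 1) (w (1 + 1)) \<or> le_inf r (w 1) (w (1 + 1))"
    using K unfolding krull_valuation_def by blast
  then have "2 \<in> \<O> v"
    using krull_valuation_one[OF K] by (simp add: assms(2) valuation_ring_def)
  then show False using assms by simp
qed

text \<open>An ordering need not embed into the reals, so that case is a convexity argument in the
  field itself; absolute values are first normalised to value 2 at 2.\<close>

lemma interior_if_two_notin_\<O>:
  assumes two: "2 \<notin> \<O> v" and b: "b \<in> \<mm> v" and P: "b + z \<in> \<O> v" and Q: "b - z \<in> \<O> v" and y: "y \<in> \<mm> v"
  shows "b + z ^ 2 / 16 * y \<in> \<mm> v"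
proof -
  obtain p where p: "wf_prelocality p" "\<O> v = pre_O p" "\<mm> v = pre_m p" by (rule locality_obtain)
  have two0: "2 \<noteq> (0 :: 'a)" using two by auto
  show ?thesis
  proof (cases p)
    case (Valuation G r w)
    then show ?thesis using two_notin_\<O>_imp_not_valuation[of v G r w] two p by simp
  next
    case (Ordering r)
    have r: "field_ordering r" using p(1) Ordering by simp
    note D = field_orderingD[OF r]
    have O: "x \<in> \<O> v \<longleftrightarrow> (0, 1 - x) \<in> r \<and> (0, 1 + x) \<in> r" for x
      using D(5)[of x 1] D(5)[of "- 1" x] by (auto simp: p Ordering add.commute)
    have M: "x \<in> \<mm> v \<longleftrightarrow> (0, 1 - x) \<in> r \<and> (0, 1 + x) \<in> r \<and> x \<noteq> 1 \<and> x \<noteq> - 1" for x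
      using D(5)[of x 1] D(5)[of "- 1" x] by (auto simp: p Ordering add.commute)
    define P Q where "P = b + z" and "Q = b - z"
    have PQb: "2 * b = P + Q" by (simp add: P_def Q_def)
    have PQ: "P \<in> \<O> v" "Q \<in> \<O> v" using assms by (simp_all add: P_def Q_def)
    have "(0, (1 - z) + (1 - z)) \<in> r"
    proof -
      have "(0, (1 - P) + (1 + Q)) \<in> r" using PQ O D(7) by blast
      then show ?thesis by (simp add: P_def Q_def algebra_simps)
    qed
    moreover have "(0, (1 + z) + (1 + z)) \<in> r"
    proof -
      have "(0, (1 + P) + (1 - Q)) \<in> r" using PQ O D(7) by blast
      then show ?thesis by (simp add: P_def Q_def algebra_simps)
    qed
    ultimately have z: "z \<in> \<O> v" using O ordering_halve[OF r two0] by blast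
    \<comment> \<open>As half of \<open>P - Q\<close>, \<open>z\<close> is in the unit ball, so
      \<open>z ^ 2 / 16 * y\<close> is \<open>z * h\<close> with \<open>h\<close> in
      \<open>\<mm> v\<close>.\<close>
    define h where "h = z * inverse 2 ^ 4 * y"
    have "inverse 2 \<in> \<O> v" using inverse_in_\<mm>[OF two] by (rule \<mm>_imp_\<O>)
    then have h: "h \<in> \<mm> v" unfolding h_def using z y by (intro \<O>_mult_\<mm> \<O>_mult \<O>_power)
    define w where "w = b + z * h"
    have w: "b + z ^ 2 / 16 * y = w"
    proof -
      have "(2 :: 'a) ^ 4 = 16" by simp
      then have "inverse 2 ^ 4 = inverse (16 :: 'a)" by (metis power_inverse)
      then show ?thesis unfolding w_def h_def by (simp only: divide_inverse power2_eq_square ac_simps)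
    qed
    have "h \<noteq> 1" "h \<noteq> - 1" using h M by blast+
    then have h1: "1 + h \<noteq> 0" "1 - h \<noteq> 0" by (auto simp: add_eq_0_iff)
    \<comment> \<open>These express \<open>2 * w = (1 + h) * P + (1 - h) * Q\<close>. The weights
      are positive, so \<open>w\<close> can reach 1 or -1 only if both \<open>P\<close> and
      \<open>Q\<close> do, and then so does \<open>b\<close>.\<close>
    have e1: "(1 - w) + (1 - w) = (1 + h) * (1 - P) + (1 - h) * (1 - Q)"
      and e2: "(1 + w) + (1 + w) = (1 + h) * (1 + P) + (1 - h) * (1 + Q)"
      by (simp_all add: w_def P_def Q_def algebra_simps)
    have pos: "(0, (1 + h) * (1 - P)) \<in> r" "(0, (1 - h) * (1 - Q)) \<in> r"
      "(0, (1 + h) * (1 + P)) \<in> r" "(0, (1 - h) * (1 + Q)) \<in> r"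
      using PQ h unfolding O M by (blast intro: D(6))+
    have sum0: "a = 0 \<and> c = 0" if "(0, a) \<in> r" "(0, c) \<in> r" "a + c = 0" for a c
    proof -
      have "c = - a" "a = - c" using that(3) by (simp_all add: add_eq_0_iff add_eq_0_iff2)
      then show ?thesis using that(1,2) D(9)[of a] D(9)[of c] by metis
    qed
    have "w \<noteq> 1"
    proof
      assume "w = 1"
      then have "1 - P = 0 \<and> 1 - Q = 0" using sum0[OF pos(1,2)] e1 h1 by simp
      then have "P = 1" "Q = 1" by simp_all
      then have "2 * b = 2 * 1" using PQb by simp
      then have "b = 1" using two0 by (simp only: mult_cancel_left) simp
      then show False using b M by simp
    qed
    moreover have "w \<noteq> - 1"
    proof
      assume "w = - 1"
      then have "1 + P = 0 \<and> 1 + Q = 0" using sum0[OF pos(3,4)] e2 h1 by simp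
      then have "P = - 1" "Q = - 1" by (simp_all add: add_eq_0_iff)
      then have "2 * b = 2 * - 1" using PQb by simp
      then have "b = - 1" using two0 by (simp only: mult_cancel_left) simp
      then show False using b M by simp
    qed
    moreover have "(0, 1 - w) \<in> r" "(0, 1 + w) \<in> r"
      using ordering_halve[OF r two0] D(7)[OF pos(1,2)] D(7)[OF pos(3,4)] e1 e2 by metis+
    ultimately show ?thesis unfolding w by (simp add: M)
  next
    case (Absolute_Value a)
    then have a: "absolute_value a" and "1 < a 2" using p two by auto
    from absolute_value_normalise[OF this] obtain a' where a': "absolute_value a'" "a' 2 = 2"
      "\<And>x. a' x \<le> 1 \<longleftrightarrow> a x \<le> 1" "\<And>x. a' x < 1 \<longleftrightarrow> a x < 1" by blast
    have "x \<in> \<O> v \<longleftrightarrow> a' x \<le> 1" "x \<in> \<mm> v \<longleftrightarrow> a' x < 1" for x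
      using a' by (simp_all add: p Absolute_Value)
    then show ?thesis using absolute_value_interior[OF a'(1,2)] assms by simp
  qed
qed

lemma exists_symmetric_neighbours:
  assumes two: "2 \<notin> \<O> v" and b: "b \<in> \<mm> v"
  shows "\<exists>z. z \<noteq> 0 \<and> b + z \<in> \<O> v \<and> b - z \<in> \<O> v"
proof -
  obtain p where p: "wf_prelocality p" "\<O> v = pre_O p" "\<mm> v = pre_m p" by (rule locality_obtain)
  show ?thesis
  proof (cases p)
    case (Valuation G r w)
    then show ?thesis using two_notin_\<O>_imp_not_valuation[of v G r w] two p by simp
  next
    case (Ordering r)
    have r: "field_ordering r" using p(1) Ordering by simp
    note D = field_orderingD[OF r]
    have O: "x \<in> \<O> v \<longleftrightarrow> (0, 1 - x) \<in> r \<and> (0, 1 + x) \<in> r" for x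
      using D(5)[of x 1] D(5)[of "- 1" x] by (auto simp: p Ordering add.commute)
    \<comment> \<open>For nonnegative \<open>c\<close> step up to the end point 1; the mirror point
      \<open>2 * c - 1\<close> is then still at least -1. Negative \<open>b\<close> is reduced to
      this by a change of sign.\<close>
    have *: "1 - c \<noteq> 0 \<and> c + (1 - c) \<in> \<O> v \<and> c - (1 - c) \<in> \<O> v" if c: "c \<in> \<mm> v" "(0, c) \<in> r" for c
    proof -
      have "(0, (1 - c) + (1 - c)) \<in> r" using \<mm>_imp_\<O>[OF c(1)] O D(7) by blast
      moreover have "(0, c + c) \<in> r" using c D(7) by blast
      ultimately have "c - (1 - c) \<in> \<O> v" unfolding O by (simp add: algebra_simps)
      then show ?thesis using c(1) by auto
    qed
    show ?thesis
    proof (cases "(0, b) \<in> r")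
      case True
      then show ?thesis using *[OF b] by blast
    next
      case False
      then have "(0, - b) \<in> r" using D(8) by blast
      then have n: "1 + b \<noteq> 0" "- b - (1 + b) \<in> \<O> v" using *[of "- b"] b by auto
      have "- (- b - (1 + b)) \<in> \<O> v" "b - (1 + b) \<in> \<O> v" using n(2) minus_one_in_\<O> by (simp_all only: \<O>_uminus_iff) simp
      then show ?thesis using n(1) by (intro exI[of _ "1 + b"]) (simp add: algebra_simps)
    qed
  next
    case (Absolute_Value a)
    then have a: "absolute_value a" and "1 < a 2" using p two by auto
    note D = absolute_valueD[OF a]
    have "2 \<noteq> (0 :: 'a)" using \<open>1 < a 2\<close> D(5) by auto
    then have "a (inverse 2) * a 2 = 1" by (simp flip: D(3) add: D(6))
    then have "a (inverse 2) = 1 / a 2" using \<open>1 < a 2\<close> by (simp add: field_simps)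
    then have "a (inverse 2) < 1" using \<open>1 < a 2\<close> by simp
    moreover have "0 < 1 - a b" using b by (simp add: p Absolute_Value)
    \<comment> \<open>As \<open>a 2\<close> exceeds 1, powers of 1 / 2 become smaller than the
      distance from \<open>b\<close> to the unit sphere.\<close>
    ultimately obtain k where k: "a (inverse 2) ^ k < 1 - a b" using real_arch_pow_inv by blast
    define z where "z = (inverse 2 :: 'a) ^ k"
    have z: "z \<noteq> 0" "a b + a z \<le> 1" using k \<open>2 \<noteq> 0\<close> by (simp_all add: z_def D(8))
    have "a (b + z) \<le> 1" "a (b - z) \<le> 1"
      using D(4)[of b z] D(4)[of b "- z"] D(7)[of z] z(2) by simp_all
    then show ?thesis using z(1) by (auto simp: p Absolute_Value)
  qed
qed

section \<open>Neighbourhoods in the constructible topology\<close>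

lemma openin_constructible:
  "openin constructible {v. x \<in> \<O> v}" "openin constructible {v. x \<in> \<mm> v}"
    "openin constructible {v. x \<notin> \<O> v}" "openin constructible {v. x \<notin> \<mm> v}"
proof -
  show O: "openin constructible {v. x \<in> \<O> v}" for x :: 'a
    unfolding constructible_def by (rule topology_generated_by_Basis) blast
  show M: "openin constructible {v. x \<in> \<mm> v}" for x :: 'a
    unfolding constructible_def by (rule topology_generated_by_Basis) blast
  \<comment> \<open>For nonzero \<open>x\<close>, duality under inversion makes the complement of a
    subbasic set subbasic again, so these sets are clopen.\<close>
  show "openin constructible {v. x \<notin> \<O> v}"
  proof (cases "x = 0")
    case False
    then have "{v. x \<notin> \<O> v} = {v. inverse x \<in> \<mm> v}" by (simp add: \<O>_iff_inverse)
    then show ?thesis using M by simp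
  qed simp
  show "openin constructible {v. x \<notin> \<mm> v}"
  proof (cases "x = 0")
    case False
    then have "{v. x \<notin> \<mm> v} = {v. inverse x \<in> \<O> v}" by (simp add: \<mm>_iff_inverse)
    then show ?thesis using O by simp
  qed simp
qed

text \<open>For a single locality the existence of \<open>w\<close> is clear; the point is that one \<open>w\<close> serves a
  constructible neighbourhood, on which orderings and complex absolute values may be mixed.\<close>

lemma \<mm>_locally_uniformly_open:
  assumes b: "b \<in> \<mm> v"
  obtains w U where "w \<noteq> 0" "openin constructible U" "v \<in> U"
    "\<And>v' y. v' \<in> U \<Longrightarrow> b \<in> \<mm> v' \<Longrightarrow> y \<in> \<mm> v' \<Longrightarrow> b + w * y \<in> \<mm> v'"
proof (cases "2 \<in> \<O> v")
  case True
  \<comment> \<open>With 2 in the unit ball, the ideal is closed under addition, so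
    \<open>w = 1\<close> serves.\<close>
  show ?thesis
  proof (rule that[of 1 "{v. 2 \<in> \<O> v}"])
    show "b + 1 * y \<in> \<mm> v'" if "v' \<in> {v. 2 \<in> \<O> v}" "b \<in> \<mm> v'" "y \<in> \<mm> v'" for v' y
      using that add_\<mm>_if_two_in_\<O> by simp
  qed (use True in \<open>auto simp: openin_constructible\<close>)
next
  case False
  then obtain z where z: "z \<noteq> 0" "b + z \<in> \<O> v" "b - z \<in> \<O> v" using exists_symmetric_neighbours b by blast
  have "2 \<noteq> (0 :: 'a)" using False by auto
  then have "(2 :: 'a) ^ 4 \<noteq> 0" by (rule power_not_zero)
  then have s: "(16 :: 'a) \<noteq> 0" by simp
  show ?thesis
  proof (rule that[of "z ^ 2 / 16" "{v. 2 \<notin> \<O> v} \<inter> {v. b + z \<in> \<O> v} \<inter> {v. b - z \<in> \<O> v}"])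
    show "openin constructible ({v. 2 \<notin> \<O> v} \<inter> {v. b + z \<in> \<O> v} \<inter> {v. b - z \<in> \<O> v})"
      by (intro openin_Int openin_constructible)
    show "b + z ^ 2 / 16 * y \<in> \<mm> v'"
      if "v' \<in> {v. 2 \<notin> \<O> v} \<inter> {v. b + z \<in> \<O> v} \<inter> {v. b - z \<in> \<O> v}" "b \<in> \<mm> v'" "y \<in> \<mm> v'" for v' y
      using that interior_if_two_notin_\<O>[of v' b z y] by simp
  qed (use z s False in auto)
qed


section \<open>Approximation of hereditarily continuous maps\<close>

lemma in_translate_iff:
  fixes a z :: "'a::field"
  assumes "z \<noteq> 0"
  shows "c \<in> a +o (z *o M) \<longleftrightarrow> (c - a) / z \<in> M"
proof
  assume "c \<in> a +o (z *o M)"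
  then show "(c - a) / z \<in> M" using assms by (auto simp: elt_set_plus_def elt_set_times_def)
next
  assume "(c - a) / z \<in> M"
  moreover have "c = a + z * ((c - a) / z)" using assms by simp
  ultimately show "c \<in> a +o (z *o M)" unfolding elt_set_plus_def elt_set_times_def by blast
qed

lemma in_ball_locality_iff:
  assumes "x \<in> affine_space m" "\<And>j. j \<in> {1..m} \<Longrightarrow> z j \<noteq> 0"
  shows "x \<in> ball_locality m v y z \<longleftrightarrow> (\<forall>j\<in>{1..m}. (x j - y j) / z j \<in> \<mm> v)"
  using assms by (auto simp: ball_locality_def affine_space_def PiE_iff in_translate_iff)

lemma compactin_zariski_star:
  assumes "compactin constructible P"
  shows "compactin zariski_star P"
proof -
  have "openin constructible U" if "openin zariski_star U" for U :: "'a::field locality set"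
  proof -
    have "generate_topology_on {{v. x \<in> \<mm> v} | x. True} U"
      using that unfolding zariski_star_def by (simp add: openin_topology_generated_by_iff)
    then show ?thesis
    proof induction
      case (Basis U)
      then show ?case using openin_constructible(2) by auto
    qed auto
  qed
  moreover have "topspace zariski_star = (UNIV :: 'a locality set)"
  proof -
    have "openin zariski_star {v. (0 :: 'a) \<in> \<mm> v}"
      unfolding zariski_star_def by (rule topology_generated_by_Basis) blast
    then show ?thesis using openin_subset by fastforce
  qed
  ultimately show ?thesis using assms unfolding compactin_def by (metis subset_UNIV)
qed

text \<open>Cut the sets off one after another; the remainder stays compact because the removed set
  is open.\<close>

lemma clopen_partition:
  assumes "finite F" "compactin X T" "T \<subseteq> (\<Union>v\<in>F. N v)"
    and "\<And>v. v \<in> F \<Longrightarrow> closedin X (N v)" "\<And>v. v \<in> F \<Longrightarrow> openin X (N v)"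
  shows "\<exists>P. (\<forall>v\<in>F. P v \<subseteq> T \<inter> N v \<and> compactin X (P v)) \<and> disjoint_family_on P F \<and> (\<Union>v\<in>F. P v) = T"
  using assms
proof (induction F arbitrary: T rule: finite_induct)
  case empty
  then show ?case by (auto simp: disjoint_family_on_def)
next
  case (insert v F)
  have T: "T \<subseteq> topspace X" using insert.prems by (simp add: compactin_def)
  have "T - N v = T \<inter> (topspace X - N v)" using T by auto
  then have "compactin X (T - N v)" using insert.prems by (simp add: compact_Int_closedin closedin_diff)
  moreover have "T - N v \<subseteq> (\<Union>v\<in>F. N v)" using insert.prems by auto
  ultimately obtain P where P: "\<forall>u\<in>F. P u \<subseteq> (T - N v) \<inter> N u \<and> compactin X (P u)" "disjoint_family_on P F"
    "(\<Union>u\<in>F. P u) = T - N v" using insert.IH[of "T - N v"] insert.prems by auto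
  have c: "compactin X (T \<inter> N v)" using insert.prems by (simp add: compact_Int_closedin)
  show ?case
  proof (intro exI[of _ "P(v := T \<inter> N v)"] conjI)
    show "disjoint_family_on (P(v := T \<inter> N v)) (insert v F)"
      using P(1,2) insert.hyps unfolding disjoint_family_on_def by auto
    show "(\<Union>u\<in>insert v F. (P(v := T \<inter> N v)) u) = T" using P(3) insert.hyps by auto
    show "\<forall>u\<in>insert v F. (P(v := T \<inter> N v)) u \<subseteq> T \<inter> N u \<and> compactin X ((P(v := T \<inter> N v)) u)"
      using P(1) c by auto
  qed
qed

text \<open>\<open>M\<close> is arbitrary so as to cover both the \<open>v\<close>-topology and the
  set topologies.\<close>

lemma power_topology_neighbourhood:
  fixes T :: "'a::field topology"
  assumes "openin (power_topology T l) O'" "x \<in> O'"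
    and base: "\<And>U a. openin T U \<Longrightarrow> a \<in> U \<Longrightarrow> \<exists>\<zeta>. \<zeta> \<noteq> 0 \<and> a +o (\<zeta> *o M) \<subseteq> U"
  obtains \<zeta> where "\<And>j. \<zeta> j \<noteq> 0"
    "\<And>x'. x' \<in> affine_space l \<Longrightarrow> (\<And>j. j \<in> {1..l} \<Longrightarrow> (x' j - x j) / \<zeta> j \<in> M) \<Longrightarrow> x' \<in> O'"
proof -
  obtain U where U: "\<forall>j\<in>{1..l}. openin T (U j)" "x \<in> PiE {1..l} U" "PiE {1..l} U \<subseteq> O'"
    using assms(1,2) unfolding power_topology_def openin_product_topology_alt by blast
  have "\<forall>j. \<exists>\<zeta>. \<zeta> \<noteq> 0 \<and> (j \<in> {1..l} \<longrightarrow> x j +o (\<zeta> *o M) \<subseteq> U j)"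
  proof
    fix j
    show "\<exists>\<zeta>. \<zeta> \<noteq> 0 \<and> (j \<in> {1..l} \<longrightarrow> x j +o (\<zeta> *o M) \<subseteq> U j)"
    proof (cases "j \<in> {1..l}")
      case True
      then show ?thesis using U base[of "U j" "x j"] by (auto simp: PiE_iff)
    next
      case False
      then show ?thesis by (intro exI[of _ 1] conjI impI) simp_all
    qed
  qed
  then obtain \<zeta> where \<zeta>: "\<And>j. \<zeta> j \<noteq> 0" "\<And>j. j \<in> {1..l} \<Longrightarrow> x j +o (\<zeta> j *o M) \<subseteq> U j" by metis
  show ?thesis
  proof (rule that[of \<zeta>, OF \<zeta>(1)])
    fix x' assume x': "x' \<in> affine_space l" "\<And>j. j \<in> {1..l} \<Longrightarrow> (x' j - x j) / \<zeta> j \<in> M"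
    then have "x' j \<in> U j" if "j \<in> {1..l}" for j
      using \<zeta>(2)[OF that] \<zeta>(1) that by (metis in_translate_iff subsetD)
    then have "x' \<in> PiE {1..l} U" using x'(1) by (auto simp: affine_space_def PiE_iff)
    then show "x' \<in> O'" using U(3) by blast
  qed
qed

section \<open>Balls common to a compact set of localities, and moving points by continuity\<close>

context uniform_localities
begin

text \<open>Compactness reduces the local scales from \<open>\<mm>_locally_uniformly_open\<close> to
  finitely many, and one \<open>\<zeta>\<close> lies below all of them throughout
  \<open>P\<close>.\<close>

lemma openin_set_topology_ball:
  assumes P: "P \<subseteq> S" "compactin constructible P" and z: "z \<noteq> 0"
  shows "openin (set_topology P) {a. \<forall>v\<in>P. (a - y) / z \<in> \<mm> v}"
  unfolding openin_set_topology
proof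
  fix a assume "a \<in> {a. \<forall>v\<in>P. (a - y) / z \<in> \<mm> v}"
  then have a: "\<And>v. v \<in> P \<Longrightarrow> (a - y) / z \<in> \<mm> v" by simp
  define b where "b = (a - y) / z"
  have "\<forall>v. \<exists>w U. v \<in> P \<longrightarrow> w \<noteq> 0 \<and> openin constructible U \<and> v \<in> U \<and>
     (\<forall>v' y. v' \<in> U \<longrightarrow> b \<in> \<mm> v' \<longrightarrow> y \<in> \<mm> v' \<longrightarrow> b + w * y \<in> \<mm> v')"
    using \<mm>_locally_uniformly_open[of b] a unfolding b_def[symmetric] by metis
  then obtain w U where wU: "\<And>v. v \<in> P \<Longrightarrow> w v \<noteq> 0" "\<And>v. v \<in> P \<Longrightarrow> openin constructible (U v)"
    "\<And>v. v \<in> P \<Longrightarrow> v \<in> U v"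
    "\<And>v v' y. v \<in> P \<Longrightarrow> v' \<in> U v \<Longrightarrow> b \<in> \<mm> v' \<Longrightarrow> y \<in> \<mm> v' \<Longrightarrow> b + w v * y \<in> \<mm> v'"
    by metis
  have "\<exists>\<F>. finite \<F> \<and> \<F> \<subseteq> U ` P \<and> P \<subseteq> \<Union>\<F>"
    using P(2) wU(2,3) unfolding compactin_def by (metis (no_types, lifting) UN_I imageE subsetI)
  then obtain F where F: "finite F" "F \<subseteq> P" "P \<subseteq> \<Union>(U ` F)" by (metis finite_subset_image)
  \<comment> \<open>The bound 1 puts \<open>\<zeta>\<close> into \<open>\<mm>_of P\<close>; the
    bound \<open>z * w v\<close> makes the shift \<open>\<zeta> * u / z\<close> equal to
    \<open>w v\<close> times an element of the ideal.\<close>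
  define C where "C = insert 1 ((\<lambda>v. z * w v) ` F)"
  have C: "finite C" "0 \<notin> C" using F wU(1) z by (auto simp: C_def)
  obtain \<zeta> where \<zeta>: "\<zeta> \<noteq> 0" "\<And>v c. v \<in> P \<Longrightarrow> c \<in> C \<Longrightarrow> \<zeta> / c \<in> \<mm> v"
    using exists_small[OF P(1) compactin_zariski_star[OF P(2)] C] by blast
  show "\<exists>\<zeta>\<in>\<mm>_of P - {0}. a +o (\<zeta> *o \<mm>_of P) \<subseteq> {a. \<forall>v\<in>P. (a - y) / z \<in> \<mm> v}"
  proof
    have "\<zeta> \<in> \<mm> v" if "v \<in> P" for v using \<zeta>(2)[OF that, of 1] by (simp add: C_def)
    then show "\<zeta> \<in> \<mm>_of P - {0}" using \<zeta>(1) by (simp add: \<mm>_of_def)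
    show "a +o (\<zeta> *o \<mm>_of P) \<subseteq> {a. \<forall>v\<in>P. (a - y) / z \<in> \<mm> v}"
    proof (intro subsetI CollectI ballI)
      fix c v assume c: "c \<in> a +o (\<zeta> *o \<mm>_of P)" and v: "v \<in> P"
      from c obtain u where u: "u \<in> \<mm>_of P" "c = a + \<zeta> * u" by (auto simp: elt_set_plus_def elt_set_times_def)
      have uv: "u \<in> \<mm> v" using u(1) v by (simp add: \<mm>_of_def)
      obtain v' where v': "v' \<in> F" "v \<in> U v'" using F(3) v by blast
      then have "v' \<in> P" using F(2) by blast
      have "z * w v' \<in> C" using v'(1) unfolding C_def by (intro insertI2 imageI)
      then have "\<zeta> / (z * w v') \<in> \<mm> v" by (rule \<zeta>(2)[OF v])
      then have "\<zeta> / (z * w v') * u \<in> \<mm> v" using uv by (intro \<mm>_mult_\<O> \<mm>_imp_\<O>[of u])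
      then have "b + w v' * (\<zeta> / (z * w v') * u) \<in> \<mm> v"
        using wU(4)[OF \<open>v' \<in> P\<close> v'(2)] a[OF v] unfolding b_def by blast
      moreover have "b + w v' * (\<zeta> / (z * w v') * u) = (c - y) / z"
        using wU(1)[OF \<open>v' \<in> P\<close>] z by (simp add: b_def u(2) field_simps)
      ultimately show "(c - y) / z \<in> \<mm> v" by simp
    qed
  qed
qed

lemma topspace_set_topology:
  assumes P: "P \<subseteq> S" "compactin constructible P"
  shows "topspace (set_topology P) = UNIV"
proof -
  obtain \<zeta> where "\<zeta> \<noteq> 0" "\<And>v c. v \<in> P \<Longrightarrow> c \<in> {1} \<Longrightarrow> \<zeta> / c \<in> \<mm> v"
    using exists_small[OF P(1) compactin_zariski_star[OF P(2)], of "{1}"] by auto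
  then have "openin (set_topology P) UNIV" unfolding openin_set_topology by (auto simp: \<mm>_of_def)
  then show ?thesis using openin_subset by blast
qed

lemma hereditarily_continuous_neighbourhood:
  assumes P: "P \<subseteq> S" "compactin constructible P" and her: "P \<subseteq> S'" "hereditarily_continuous S' l m D g"
    and D: "D \<subseteq> affine_space l" "g \<in> D \<rightarrow> affine_space m" and z: "\<And>j. j \<in> {1..m} \<Longrightarrow> z j \<noteq> 0"
    and x: "x \<in> D" "\<And>v. v \<in> P \<Longrightarrow> g x \<in> ball_locality m v y z"
  shows "\<exists>\<zeta>. (\<forall>j. \<zeta> j \<noteq> 0) \<and> (\<forall>x'\<in>D. (\<forall>j\<in>{1..l}. \<forall>v\<in>P. (x' j - x j) / \<zeta> j \<in> \<mm> v) \<longrightarrow>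
    (\<forall>v\<in>P. g x' \<in> ball_locality m v y z))"
proof (cases "P = {}")
  case True
  \<comment> \<open>Hereditary continuity speaks of nonempty sets only, but pieces of the partition
    may be empty.\<close>
  then show ?thesis by (auto intro: exI[of _ "\<lambda>_. 1"])
next
  case False
  define T where "T = set_topology P"
  have top: "topspace T = UNIV" unfolding T_def by (rule topspace_set_topology[OF P])
  have cont: "continuous_map (subtopology (power_topology T l) D) (power_topology T m) g"
    using her False compactin_zariski_star[OF P(2)] unfolding hereditarily_continuous_def T_def by blast
  define V where "V = (\<Pi>\<^sub>E j\<in>{1..m}. {a. \<forall>v\<in>P. (a - y j) / z j \<in> \<mm> v})"
  have V: "g x' \<in> V \<longleftrightarrow> (\<forall>v\<in>P. g x' \<in> ball_locality m v y z)" if "x' \<in> D" for x'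
  proof -
    have "g x' \<in> affine_space m" using that D(2) by blast
    then have "g x' \<in> V \<longleftrightarrow> (\<forall>j\<in>{1..m}. \<forall>v\<in>P. (g x' j - y j) / z j \<in> \<mm> v)"
      by (simp add: V_def affine_space_def PiE_iff)
    then show ?thesis using in_ball_locality_iff[OF \<open>g x' \<in> affine_space m\<close>, of z] z by blast
  qed
  have "openin (power_topology T m) V"
    unfolding power_topology_def V_def T_def
    by (subst openin_PiE_gen, intro disjI2 conjI ballI openin_set_topology_ball[OF P z]) simp_all
  from openin_continuous_map_preimage[OF cont this]
  have "openin (subtopology (power_topology T l) D) {x' \<in> D. g x' \<in> V}"
    using D(1) by (simp add: power_topology_def top affine_space_def Collect_conj_eq Int_absorb1 flip: Int_assoc)
  then obtain O' where O': "openin (power_topology T l) O'" "{x' \<in> D. g x' \<in> V} = O' \<inter> D"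
    unfolding openin_subtopology by blast
  have "x \<in> O'" using O'(2) x V[OF x(1)] by blast
  have base: "\<exists>\<zeta>. \<zeta> \<noteq> 0 \<and> a +o (\<zeta> *o \<mm>_of P) \<subseteq> U" if "openin T U" "a \<in> U" for U a
    using that unfolding T_def openin_set_topology by blast
  obtain \<zeta> where \<zeta>: "\<And>j. \<zeta> j \<noteq> 0"
    "\<And>x'. x' \<in> affine_space l \<Longrightarrow> (\<And>j. j \<in> {1..l} \<Longrightarrow> (x' j - x j) / \<zeta> j \<in> \<mm>_of P) \<Longrightarrow> x' \<in> O'"
    using power_topology_neighbourhood[OF O'(1) \<open>x \<in> O'\<close> base] by blast
  have "\<forall>v\<in>P. g x' \<in> ball_locality m v y z"
    if "x' \<in> D" "\<forall>j\<in>{1..l}. \<forall>v\<in>P. (x' j - x j) / \<zeta> j \<in> \<mm> v" for x'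
  proof -
    have "x' \<in> O'" using that D(1) by (intro \<zeta>(2)) (auto simp: \<mm>_of_def)
    then show ?thesis using O'(2) that(1) V by blast
  qed
  then show ?thesis using \<zeta>(1) by blast
qed

end

lemma exceptional_uniformity_imp_uniform_localities:
  assumes "exceptional_uniformity n S t" "t \<noteq> 0"
    and "\<And>i. i \<in> {1..n} \<Longrightarrow> S i \<subseteq> UNIV - {v_trivial}"
    and "pairwise independent_localities (\<Union>i\<in>{1..n}. S i)"
  obtains f where "uniform_localities (\<Union>i\<in>{1..n}. S i) (\<Union>i\<in>{i \<in> {1..n}. finite (S i)}. S i) t f"
proof -
  define SS E where "SS = (\<Union>i\<in>{1..n}. S i)" and "E = (\<Union>i\<in>{i \<in> {1..n}. finite (S i)}. S i)"
  obtain f d where fd: "d = degree f" "d \<ge> 2"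
    and U: "\<forall>v\<in>SS. (\<forall>x\<in>\<O> v. poly f x \<in> \<O> v) \<and>
           (\<forall>x. x \<notin> \<O> v \<longrightarrow> poly f x \<in> ((x ^ d) *o (\<O> v - t *o \<mm> v)) \<inter>
                ((lead_coeff f * x ^ d) +o ((x ^ (d - 1)) *o \<O> v))) \<and>
           \<O> v + \<O> v \<subseteq> inverse t *o \<O> v"
    and N: "\<forall>i\<in>{1..n}. infinite (S i) \<longrightarrow> (\<forall>v\<in>S i. \<forall>x\<in>\<O> v. poly f x \<notin> t *o \<mm> v)"
    using assms(1) unfolding exceptional_uniformity_def SS_def[symmetric]
    by (elim exE conjE) (rule that)
  have "uniform_localities SS E t f"
  proof
    show "t * (x + y) \<in> \<O> v" if v: "v \<in> SS" and "x \<in> \<O> v" "y \<in> \<O> v" for v x y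
    proof -
      have "x + y \<in> inverse t *o \<O> v" using bspec[OF U v] set_plus_intro[OF that(2,3)] by blast
      then show ?thesis using \<open>t \<noteq> 0\<close> in_elt_set_times_iff[of "inverse t" "x + y"]
        by (simp add: divide_inverse mult.commute)
    qed
    show "v \<noteq> v_trivial" if "v \<in> SS" for v using that assms(3) unfolding SS_def by blast
    show "poly f x \<notin> t *o \<mm> v" if "v \<in> SS - E" "x \<in> \<O> v" for v x
      using that N by (auto simp: SS_def E_def)
    show "pairwise independent_localities SS" using assms(4) by (simp add: SS_def)
    show "poly f x \<in> x ^ degree f *o (\<O> v - t *o \<mm> v)" if "v \<in> SS" "x \<notin> \<O> v" for v x
      using bspec[OF U that(1)] that(2) unfolding fd(1) by blast
    show "poly f x \<in> \<O> v" if "v \<in> SS" "x \<in> \<O> v" for v x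
      using bspec[OF U that(1)] that(2) by blast
  qed (use assms(2) fd in \<open>auto simp: E_def\<close>)
  then show ?thesis using that by (simp add: SS_def E_def)
qed

section \<open>Gluing the given points over a clopen partition\<close>

theorem theorem7p8:
  fixes S :: "nat \<Rightarrow> 'a::field locality set"
    and t :: 'a
    and n l m :: nat
    and y z :: "nat \<Rightarrow> nat \<Rightarrow> 'a"
    and D :: "(nat \<Rightarrow> 'a) set"
    and g :: "(nat \<Rightarrow> 'a) \<Rightarrow> (nat \<Rightarrow> 'a)"
  assumes "n \<ge> 1"
    and "\<And>i. i \<in> {1..n} \<Longrightarrow> S i \<noteq> {}"
    and "\<And>i. i \<in> {1..n} \<Longrightarrow> S i \<subseteq> UNIV - {v_trivial}"
    and "disjoint_family_on S {1..n}"
    and "t \<noteq> 0"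
    and "\<And>i. i \<in> {1..n} \<Longrightarrow> y i \<in> affine_space m"
    and "\<And>i. i \<in> {1..n} \<Longrightarrow> z i \<in> affine_space m"
    and "\<And>i j. i \<in> {1..n} \<Longrightarrow> j \<in> {1..m} \<Longrightarrow> z i j \<noteq> 0"
    and "exceptional_uniformity n S t"
    and "\<And>i. i \<in> {1..n} \<Longrightarrow> compactin constructible (S i)"
    and "pairwise independent_localities (\<Union>i\<in>{1..n}. S i)"
    and "D \<subseteq> affine_space l"
    and "\<And>v. v \<in> (\<Union>i\<in>{1..n}. S i) \<Longrightarrow> openin (power_topology (v_topology v) l) D"
    and "g \<in> D \<rightarrow> affine_space m"
    and "\<And>i. i \<in> {1..n} \<Longrightarrow> hereditarily_continuous (S i) l m D g"
    and "\<And>i v. i \<in> {1..n} \<Longrightarrow> v \<in> S i \<Longrightarrow> \<exists>x\<in>D. g x \<in> ball_locality m v (y i) (z i)"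
  shows "\<exists>x\<in>D. \<forall>i\<in>{1..n}. \<forall>v\<in>S i. g x \<in> ball_locality m v (y i) (z i)"
proof -
  obtain f where "uniform_localities (\<Union>i\<in>{1..n}. S i) (\<Union>i\<in>{i \<in> {1..n}. finite (S i)}. S i) t f"
    using exceptional_uniformity_imp_uniform_localities[OF assms(9,5,3,11)] by blast
  then interpret uniform_localities "\<Union>i\<in>{1..n}. S i" "\<Union>i\<in>{i \<in> {1..n}. finite (S i)}. S i" t f .
  have "\<forall>i v. \<exists>x. i \<in> {1..n} \<longrightarrow> v \<in> S i \<longrightarrow> x \<in> D \<and> g x \<in> ball_locality m v (y i) (z i)"
    using assms(16) by blast
  then obtain X where X: "\<And>i v. i \<in> {1..n} \<Longrightarrow> v \<in> S i \<Longrightarrow> X i v \<in> D"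
    "\<And>i v. i \<in> {1..n} \<Longrightarrow> v \<in> S i \<Longrightarrow> g (X i v) \<in> ball_locality m v (y i) (z i)" by metis
  \<comment> \<open>The localities at which the point chosen for \<open>v\<close> still works: a
    finite intersection of clopen sets.\<close>
  define N where "N i v = {v'. g (X i v) \<in> ball_locality m v' (y i) (z i)}" for i v
  have N_eq: "N i v = (\<Inter>j\<in>{1..m}. {v'. (g (X i v) j - y i j) / z i j \<in> \<mm> v'})" if "i \<in> {1..n}" "v \<in> S i" for i v
  proof -
    have "g (X i v) \<in> affine_space m" using X(1)[OF that] assms(14) by blast
    then show ?thesis using in_ball_locality_iff[of "g (X i v)" m "z i"] assms(8)[OF that(1)] by (auto simp: N_def)
  qed
  have top: "topspace constructible = (UNIV :: 'a locality set)"
    using openin_subset[OF openin_constructible(1)[of 0]] by auto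
  have clo: "closedin constructible {v. a \<in> \<mm> v}" for a :: 'a
    unfolding closedin_def top using openin_constructible(4)[of a] by (simp add: Compl_eq_Diff_UNIV[symmetric] Collect_neg_eq)
  have N: "openin constructible (N i v)" "closedin constructible (N i v)" if "i \<in> {1..n}" "v \<in> S i" for i v
  proof -
    show "openin constructible (N i v)"
      unfolding N_eq[OF that] using openin_constructible(2) top
      by (cases "{1..m} = {}") (auto intro!: openin_INT2 simp flip: top)
    show "closedin constructible (N i v)"
      unfolding N_eq[OF that] using clo top
      by (cases "{1..m} = {}") (auto intro!: closedin_INT simp flip: top)
  qed
  define pieces where "pieces i F P \<longleftrightarrow> finite F \<and> F \<subseteq> S i \<and>
      (\<forall>v\<in>F. P v \<subseteq> S i \<inter> N i v \<and> compactin constructible (P v)) \<and>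
      disjoint_family_on P F \<and> (\<Union>v\<in>F. P v) = S i" for i F P
  have "\<exists>F P. pieces i F P" if i: "i \<in> {1..n}" for i
  proof -
    have "v \<in> N i v" if "v \<in> S i" for v using X(2)[OF i that] by (simp add: N_def)
    then have "\<exists>\<F>. finite \<F> \<and> \<F> \<subseteq> N i ` S i \<and> S i \<subseteq> \<Union>\<F>"
      using assms(10)[OF i] N(1)[OF i] unfolding compactin_def by (metis (no_types, lifting) UN_I imageE subsetI)
    then obtain F where F: "finite F" "F \<subseteq> S i" "S i \<subseteq> \<Union>(N i ` F)" by (metis finite_subset_image)
    have "\<exists>P. (\<forall>v\<in>F. P v \<subseteq> S i \<inter> N i v \<and> compactin constructible (P v)) \<and>
      disjoint_family_on P F \<and> (\<Union>v\<in>F. P v) = S i"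
      by (rule clopen_partition[OF F(1) assms(10)[OF i] F(3)]) (use N[OF i] F(2) in auto)
    then show ?thesis using F(1,2) unfolding pieces_def by metis
  qed
  then obtain F P where "\<And>i. i \<in> {1..n} \<Longrightarrow> pieces i (F i) (P i)" by metis
  note FP = this[unfolded pieces_def]
  define I where "I = Sigma {1..n} F"
  have finI: "finite I" using FP by (auto simp: I_def)
  have P: "P i u \<subseteq> (\<Union>i\<in>{1..n}. S i)" "compactin zariski_star (P i u)" if "(i, u) \<in> I" for i u
  proof -
    have i: "i \<in> {1..n}" "u \<in> F i" using that by (auto simp: I_def)
    then have "P i u \<subseteq> S i" "compactin constructible (P i u)" using FP[OF i(1)] by auto
    then show "P i u \<subseteq> (\<Union>i\<in>{1..n}. S i)" "compactin zariski_star (P i u)"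
      using i(1) compactin_zariski_star by auto
  qed
  have disj: "disjoint_family_on (\<lambda>(i, v). P i v) I"
    unfolding disjoint_family_on_def
  proof (intro ballI impI)
    fix p q assume p: "p \<in> I" and q: "q \<in> I" and pq: "p \<noteq> q"
    obtain i u k w where e: "p = (i, u)" "q = (k, w)" by (metis surj_pair)
    then have i: "i \<in> {1..n}" "u \<in> F i" "k \<in> {1..n}" "w \<in> F k" using p q by (auto simp: I_def)
    show "(case p of (i, v) \<Rightarrow> P i v) \<inter> (case q of (i, v) \<Rightarrow> P i v) = {}"
    proof (cases "i = k")
      case True
      then have "u \<noteq> w" using pq e by simp
      then show ?thesis using FP[OF i(1)] i True by (simp add: e disjoint_family_on_def)
    next
      case False
      then have "S i \<inter> S k = {}" using assms(4) i by (simp add: disjoint_family_on_def)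
      moreover have "P i u \<subseteq> S i" "P k w \<subseteq> S k" using FP[OF i(1)] FP[OF i(3)] i by auto
      ultimately show ?thesis by (auto simp: e)
    qed
  qed
  define nbhd where "nbhd i u \<zeta> \<longleftrightarrow> (\<forall>j. \<zeta> j \<noteq> 0) \<and>
    (\<forall>x'\<in>D. (\<forall>j\<in>{1..l}. \<forall>v\<in>P i u. (x' j - X i u j) / \<zeta> j \<in> \<mm> v) \<longrightarrow>
      (\<forall>v\<in>P i u. g x' \<in> ball_locality m v (y i) (z i)))" for i u \<zeta>
  have "\<exists>\<zeta>. nbhd i u \<zeta>" if i: "i \<in> {1..n}" "u \<in> F i" for i u
    unfolding nbhd_def
  proof (rule hereditarily_continuous_neighbourhood[OF _ _ _ assms(15)[OF i(1)] assms(12,14) assms(8)[OF i(1)]])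
    show "P i u \<subseteq> S i" "compactin constructible (P i u)" using FP[OF i(1)] i(2) by auto
    then show "P i u \<subseteq> (\<Union>i\<in>{1..n}. S i)" using i(1) by blast
    show "X i u \<in> D" using X(1)[OF i(1)] FP[OF i(1)] i(2) by blast
    show "g (X i u) \<in> ball_locality m v (y i) (z i)" if "v \<in> P i u" for v
      using FP[OF i(1)] i(2) that by (auto simp: N_def)
  qed
  then have "\<exists>\<zeta>. nbhd i u \<zeta>" if "(i, u) \<in> I" for i u using that by (simp add: I_def)
  then obtain \<zeta> where nbhd: "\<And>i u. (i, u) \<in> I \<Longrightarrow> nbhd i u (\<zeta> i u)" by metis
  have \<zeta>: "\<zeta> i u j \<noteq> 0" if "(i, u) \<in> I" for i u j
    using nbhd[OF that] by (simp add: nbhd_def)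
  \<comment> \<open>Membership in \<open>D\<close> is secured at one locality: \<open>D\<close> is
    open for \<open>v0\<close>, and the point constructed below is close to \<open>X 1 u0\<close>
    there.\<close>
  obtain v0 where v0: "v0 \<in> S 1" using assms(1,2) by force
  have one: "1 \<in> {1..n}" using assms(1) by simp
  obtain u0 where u0: "u0 \<in> F 1" "v0 \<in> P 1 u0" using FP[OF one] v0 by blast
  have "openin (power_topology (v_topology v0) l) D" using assms(13) one v0 by blast
  moreover have "X 1 u0 \<in> D" using X(1)[OF one] FP[OF one] u0(1) by blast
  ultimately obtain \<eta> where \<eta>: "\<And>j. \<eta> j \<noteq> 0"
    "\<And>x'. x' \<in> affine_space l \<Longrightarrow> (\<And>j. j \<in> {1..l} \<Longrightarrow> (x' j - X 1 u0 j) / \<eta> j \<in> \<mm> v0) \<Longrightarrow> x' \<in> D"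
    by (rule power_topology_neighbourhood[where M = "\<mm> v0"]) (unfold openin_v_topology, blast+)
  \<comment> \<open>All tolerances over the finitely many pieces and coordinates; the
    \<open>w\<close> chosen below is under each of them at every locality, so the single accuracy
    \<open>w\<close> suffices.\<close>
  define C where "C = (\<lambda>((i, u), j). \<zeta> i u j) ` (I \<times> {1..l}) \<union> \<eta> ` {1..l}"
  have C: "finite C" "0 \<notin> C" using finI \<zeta> \<eta>(1) by (auto simp: C_def)
  have "compactin zariski_star (\<Union>i\<in>{1..n}. S i)"
    using compactin_zariski_star[OF assms(10)] by (intro compactin_Union) blast+
  then obtain w where w: "w \<noteq> 0" "\<And>v c. v \<in> (\<Union>i\<in>{1..n}. S i) \<Longrightarrow> c \<in> C \<Longrightarrow> w / c \<in> \<mm> v"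
    using exists_small[OF order_refl _ C] by metis
  have "\<exists>x. \<forall>p\<in>I. \<forall>v\<in>(case p of (i, v) \<Rightarrow> P i v). (x - (case p of (i, u) \<Rightarrow> X i u j)) / w \<in> \<mm> v" for j
  proof (rule weak_approximation[OF finI _ _ disj w(1)])
    show "(case p of (i, v) \<Rightarrow> P i v) \<subseteq> (\<Union>i\<in>{1..n}. S i)" if "p \<in> I" for p
      using that P(1) by (cases p) simp
    show "compactin zariski_star (case p of (i, v) \<Rightarrow> P i v)" if "p \<in> I" for p
      using that P(2) by (cases p) simp
  qed
  then obtain x where x: "\<And>i u j v. (i, u) \<in> I \<Longrightarrow> v \<in> P i u \<Longrightarrow> (x j - X i u j) / w \<in> \<mm> v"
    by (metis (no_types, lifting) case_prod_conv)
  define x' where "x' = restrict x {1..l}"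
  have close: "(x' j - X i u j) / c \<in> \<mm> v" if "(i, u) \<in> I" "v \<in> P i u" "j \<in> {1..l}" "c \<in> C" for i u j v c
  proof -
    have i: "i \<in> {1..n}" "u \<in> F i" using that(1) by (auto simp: I_def)
    then have "v \<in> (\<Union>i\<in>{1..n}. S i)" using that(2) FP[OF i(1)] by blast
    then have "(x j - X i u j) / w * (w / c) \<in> \<mm> v"
      using x[OF that(1,2)] w(2) that(4) by (intro \<mm>_mult_\<O> \<mm>_imp_\<O>[of "w / c"]) auto
    then show ?thesis using w(1) that(3) by (simp add: x'_def)
  qed
  have "x' \<in> D"
  proof (rule \<eta>(2))
    show "x' \<in> affine_space l" by (simp add: x'_def affine_space_def)
    show "(x' j - X 1 u0 j) / \<eta> j \<in> \<mm> v0" if "j \<in> {1..l}" for j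
      using close[of 1 u0 v0 j "\<eta> j"] u0 one that by (auto simp: I_def C_def)
  qed
  moreover have "g x' \<in> ball_locality m v (y i) (z i)" if i: "i \<in> {1..n}" and v: "v \<in> S i" for i v
  proof -
    obtain u where u: "u \<in> F i" "v \<in> P i u" using FP[OF i] v by blast
    then have iu: "(i, u) \<in> I" using i by (simp add: I_def)
    have "\<zeta> i u j \<in> C" if "j \<in> {1..l}" for j using iu that by (force simp: C_def)
    then have "\<forall>j\<in>{1..l}. \<forall>v\<in>P i u. (x' j - X i u j) / \<zeta> i u j \<in> \<mm> v" using close[OF iu] by blast
    then show ?thesis using nbhd[OF iu] \<open>x' \<in> D\<close> u(2) unfolding nbhd_def by blast
  qed
  ultimately show ?thesis by blast
qed

end
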